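(* Let $p\ge1$ and let $\nu$ be a probability measure on $\mathbb{R}$ with finite moment of order $p$. Let $(X_t)_{t\ge0}$ be a stochastic process such that $X_t$ is drawn from $\nu$ for any $t\ge0$. Suppose that $$\forall\epsilon>0,\ \exists\xi,M>0,\ \forall t\in[\epsilon,\epsilon^{-1}],\quad \mathbb{E}\left[e^{\frac{p(1+\xi)\max(1,p-1)|X_t-X_0|^2}{2(e^{2t}-1)}}\right]\le M.$$ Then, for any $s>0$, $$W_p(\nu,\gamma)\le\int_0^\infty e^{-t}\,\mathbb{E}[S_p(t)^{p/2}]^{1/p}\,dt,$$ where $\gamma$ is the standard Gaussian measure on $\mathbb{R}$ and $$S_p(t)=\mathbb{E}\left[\frac{X_t-X_0}{s}+X_0\,\Big|\,X_0\right]^2+\frac{\max(1,p-1)}{e^{2t}-1}\,\mathbb{E}\left[\frac{(X_t-X_0)^2}{2s}-1\,\Big|\,X_0\right]^2+\sum_{k>2}\frac{\max(1,p-1)^{k-1}}{s^2\,k\,k!\,(e^{2t}-1)^{k-1}}\,\mathbb{E}[(X_t-X_0)^k\mid X_0]^2.$$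
   Context: $W_p$ is the Wasserstein distance of order $p$ on $\mathbb{R}$: $W_p(\nu,\mu)^p=\inf_\pi\int|y-x|^p\,\pi(dx,dy)$ over measures $\pi$ on $\mathbb{R}\times\mathbb{R}$ with marginals $\mu$ and $\nu$. The notation $\mathbb{E}[\,\cdot\mid X_0]^2$ means the square of the conditional expectation. *)

theory Defs
  imports "HOL-Probability.Probability"
begin

text \<open>Real powers on the extended nonnegative reals; only meant for exponents \<open>a > 0\<close>.\<close>

definition ennreal_powr :: "ennreal \<Rightarrow> real \<Rightarrow> ennreal" where
  "ennreal_powr x a = (if x = \<top> then \<top> else ennreal (enn2real x powr a))"

definition couplings :: "real measure \<Rightarrow> real measure \<Rightarrow> (real \<times> real) measure set" where
  "couplings \<mu> \<nu> = {\<pi>. sets \<pi> = sets (borel \<Otimes>\<^sub>M borel) \<and>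
     distr \<pi> borel fst = \<mu> \<and> distr \<pi> borel snd = \<nu>}"

definition wasserstein :: "real \<Rightarrow> real measure \<Rightarrow> real measure \<Rightarrow> ennreal" where
  "wasserstein p \<mu> \<nu> =
     ennreal_powr (INF \<pi>\<in>couplings \<mu> \<nu>. \<integral>\<^sup>+ (x, y). ennreal (\<bar>y - x\<bar> powr p) \<partial>\<pi>) (1 / p)"

definition std_gaussian :: "real measure" where
  "std_gaussian = density lborel (\<lambda>x. ennreal (std_normal_density x))"

definition cond_exp_given ::
  "'a measure \<Rightarrow> ('a \<Rightarrow> real) \<Rightarrow> ('a \<Rightarrow> real) \<Rightarrow> 'a \<Rightarrow> real" where
  "cond_exp_given M Z Y = real_cond_exp M (vimage_algebra (space M) Z borel) Y"

text \<open>The random variable \<open>S\<^sub>p(t)\<close>, for \<open>t > 0\<close>, with values in \<open>[0, \<infinity>]\<close> so that no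
  convergence of the series is presupposed.\<close>

definition S_series ::
  "'a measure \<Rightarrow> (real \<Rightarrow> 'a \<Rightarrow> real) \<Rightarrow> real \<Rightarrow> real \<Rightarrow> real \<Rightarrow> 'a \<Rightarrow> ennreal" where
  "S_series M X s p t \<omega> =
     ennreal ((cond_exp_given M (X 0) (\<lambda>w. (X t w - X 0 w) / s + X 0 w) \<omega>)\<^sup>2)
   + ennreal (max 1 (p - 1) / (exp (2 * t) - 1)
       * (cond_exp_given M (X 0) (\<lambda>w. (X t w - X 0 w)\<^sup>2 / (2 * s) - 1) \<omega>)\<^sup>2)
   + (\<Sum>k. if k > 2 then
        ennreal (max 1 (p - 1) ^ (k - 1) / (s\<^sup>2 * real k * fact k * (exp (2 * t) - 1) ^ (k - 1))
          * (cond_exp_given M (X 0) (\<lambda>w. (X t w - X 0 w) ^ k) \<omega>)\<^sup>2)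
      else 0)"

end

theory Submission
  imports Defs
begin

text \<open>Let \<open>X\<^sub>0\<close> have law \<open>\<nu>\<close>, let \<open>Z\<close> be a standard Gaussian variable independent of everything else, and put
\<open>a\<^sup>2 = exp (2 * t) - 1\<close>.  The law of \<open>F\<^sub>t = exp (- t) * (X\<^sub>0 + a * Z)\<close> leads from \<open>\<nu>\<close> at time zero to the
Gaussian measure at time infinity; it is the law at time \<open>t\<close> of the Ornstein-Uhlenbeck process
started from \<open>\<nu>\<close>.  The bound integrates the speed of this path of measures.

The density of \<open>F\<^sub>t\<close> is transported by a velocity field \<open>v\<^sub>t\<close>, and \<open>- exp t * v\<^sub>t (F\<^sub>t)\<close> is the
conditional expectation of \<open>X\<^sub>0 - Z / a\<close> given \<open>F\<^sub>t\<close>.  On the line the quantile functions of the laws of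
\<open>F\<^sub>t\<close> are trajectories of \<open>v\<^sub>t\<close> (\<open>T_deriv\<close>), so that the limits of these functions at times zero and
infinity couple \<open>\<nu>\<close> with the Gaussian measure.  By Minkowski's integral inequality this coupling
gives the bound of the Wasserstein distance by the time integral of the \<open>L\<^sup>p\<close> norms of \<open>v\<^sub>t (F\<^sub>t)\<close>
(\<open>wasserstein_le_velocity\<close>).

It remains to bound the norm of \<open>v\<^sub>t (F\<^sub>t)\<close> for fixed \<open>t\<close>.  Put \<open>D = X\<^sub>t - X\<^sub>0\<close>.  As \<open>X\<^sub>0\<close> and \<open>X\<^sub>t\<close> have
the same law, \<open>F\<^sub>t\<close> and \<open>exp (- t) * (X\<^sub>t + a * Z)\<close> give the same expectation to every test function \<open>f\<close>.
Expanding the difference in powers of \<open>D\<close>, with Hermite polynomials \<open>H\<^sub>k (Z)\<close> as coefficients, and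
integrating by parts shows that \<open>(\<Sum>k. D ^ Suc k * H\<^sub>k (Z) / (fact (Suc k) * a ^ k))\<close> is orthogonal to \<open>f' (F\<^sub>t)\<close>
(\<open>stein_expansion_tendsto_0\<close>; the exponential moment of \<open>D\<^sup>2\<close> makes the remainder vanish).  Hence \<open>1 / s\<close>
times this series can be added to \<open>X\<^sub>0 - Z / a\<close>, and every coefficient can be replaced by its
conditional expectation given \<open>X\<^sub>0\<close>, without changing the conditional expectation given \<open>F\<^sub>t\<close>.
The result is a Hermite series in \<open>Z\<close> whose coefficients depend on \<open>X\<^sub>0\<close> only.  Convexity removes
the conditioning on \<open>F\<^sub>t\<close> (\<open>convex_functional_bound\<close>), and hypercontractivity bounds the \<open>L\<^sup>p\<close> norm in \<open>Z\<close> of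
a Hermite sum with coefficients \<open>b\<^sub>k\<close> by the square root of \<open>(\<Sum>k. max 1 (p - 1) ^ k * b\<^sub>k\<^sup>2 * fact k)\<close>
(\<open>hypercontractivity\<close>).  For the coefficients at hand this sum is \<open>S\<^sub>p(t)\<close>.

Hypercontractivity is proved in its dual form, an inequality between
the expectation of \<open>f (X) powr \<alpha> * g (Y) powr \<beta>\<close> for correlated Gaussian variables and the product of
\<open>(E f (X)) powr \<alpha>\<close> and \<open>(E g (Y)) powr \<beta>\<close> (\<open>two_function_hypercontractivity\<close>).  For variables of small
variance \<open>t\<close> a Taylor expansion yields it up to an error of order \<open>t powr (3 / 2)\<close>; passing from \<open>t\<close> to
\<open>2 * t\<close> at most doubles the error, so the error at \<open>t = 1\<close> is zero.\<close>

section \<open>Gaussian integrals\<close>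

lemma prob_space_std_gaussian: "prob_space std_gaussian"
  unfolding std_gaussian_def by (rule prob_space_normal_density) simp

lemma sets_std_gaussian [measurable_cong, simp]: "sets std_gaussian = sets borel"
  by (simp add: std_gaussian_def)

lemma space_std_gaussian [simp]: "space std_gaussian = UNIV"
  by (simp add: std_gaussian_def)

interpretation gauss: real_distribution std_gaussian
  by (simp add: real_distribution_def real_distribution_axioms_def prob_space_std_gaussian)

lemma prob_std_gaussian_UNIV [simp]: "measure std_gaussian UNIV = 1"
  using gauss.prob_space by simp

lemma integral_std_gaussian:
  fixes f :: "real \<Rightarrow> real"
  assumes [measurable]: "f \<in> borel_measurable borel"
  shows "integral\<^sup>L std_gaussian f = (\<integral>z. std_normal_density z * f z \<partial>lborel)"
  unfolding std_gaussian_def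
  by (subst integral_density) auto

lemma integrable_std_gaussian:
  fixes f :: "real \<Rightarrow> real"
  assumes [measurable]: "f \<in> borel_measurable borel"
  shows "integrable std_gaussian f \<longleftrightarrow> integrable lborel (\<lambda>z. std_normal_density z * f z)"
  unfolding std_gaussian_def
  by (subst integrable_density) auto

lemma std_normal_density_shift:
  "std_normal_density (z - h) = std_normal_density z * exp (h * z - h\<^sup>2 / 2)"
proof -
  have "- (z - h)\<^sup>2 / 2 = - z\<^sup>2 / 2 + (h * z - h\<^sup>2 / 2)"
    by (simp add: power2_eq_square field_simps)
  then show ?thesis
    by (simp add: std_normal_density_def flip: exp_add)
qed

lemma integral_std_gaussian_shift:
  fixes f :: "real \<Rightarrow> real"
  assumes [measurable]: "f \<in> borel_measurable borel"
  shows "(\<integral>z. f (z + h) \<partial>std_gaussian) = (\<integral>z. f z * exp (h * z - h\<^sup>2 / 2) \<partial>std_gaussian)"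
proof -
  have "(\<integral>z. f (z + h) \<partial>std_gaussian) = (\<integral>z. std_normal_density z * f (z + h) \<partial>lborel)"
    by (rule integral_std_gaussian) simp
  also have "\<dots> = (\<integral>z. std_normal_density (z - h) * f z \<partial>lborel)"
    by (subst lborel_integral_real_affine[where c=1 and t="- h"]) auto
  also have "\<dots> = (\<integral>z. std_normal_density z * (f z * exp (h * z - h\<^sup>2 / 2)) \<partial>lborel)"
    by (simp add: std_normal_density_shift ac_simps)
  also have "\<dots> = (\<integral>z. f z * exp (h * z - h\<^sup>2 / 2) \<partial>std_gaussian)"
    by (rule integral_std_gaussian[symmetric]) simp
  finally show ?thesis .
qed

lemma integrable_exp_std_gaussian: "integrable std_gaussian (\<lambda>z. exp (k * z))"
proof -
  have "integrable lborel (\<lambda>z. std_normal_density z)"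
    by (rule integrable_normal_density) simp
  then have "integrable lborel (\<lambda>z. std_normal_density (- k + 1 * z))"
    by (subst lborel_integrable_real_affine_iff) auto
  then have "integrable lborel (\<lambda>z. exp (k\<^sup>2 / 2) * std_normal_density (- k + 1 * z))"
    by (rule integrable_mult_right)
  also have "(\<lambda>z. exp (k\<^sup>2 / 2) * std_normal_density (- k + 1 * z)) =
      (\<lambda>z. std_normal_density z * exp (k * z))"
  proof
    fix z
    have "- k + 1 * z = z - k" by simp
    then show "exp (k\<^sup>2 / 2) * std_normal_density (- k + 1 * z) = std_normal_density z * exp (k * z)"
      by (simp only: std_normal_density_shift) (simp add: exp_diff)
  qed
  finally show ?thesis
    by (subst integrable_std_gaussian) auto
qed

text \<open>The class of integrands used throughout: it contains polynomials, exponentials and bounded functions,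
is closed under the algebraic operations, and its members are Gaussian integrable with vanishing
boundary terms in integrations by parts.\<close>

definition expgrowth :: "(real \<Rightarrow> real) \<Rightarrow> bool" where
  "expgrowth g \<longleftrightarrow> g \<in> borel_measurable borel \<and>
     (\<exists>C k. 0 \<le> C \<and> 0 \<le> k \<and> (\<forall>z. \<bar>g z\<bar> \<le> C * exp (k * \<bar>z\<bar>)))"

lemma expgrowth_measurable: "expgrowth g \<Longrightarrow> g \<in> borel_measurable borel"
  by (simp add: expgrowth_def)

lemma expgrowthE:
  assumes "expgrowth g"
  obtains C k where "0 \<le> C" "0 \<le> k" "\<And>z. \<bar>g z\<bar> \<le> C * exp (k * \<bar>z\<bar>)"
  using assms by (auto simp: expgrowth_def)

lemma expgrowthI:
  assumes "g \<in> borel_measurable borel" "0 \<le> C" "0 \<le> k" "\<And>z. \<bar>g z\<bar> \<le> C * exp (k * \<bar>z\<bar>)"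
  shows "expgrowth g"
  using assms by (auto simp: expgrowth_def)

lemma expgrowth_bounded:
  assumes "g \<in> borel_measurable borel" "\<And>z. \<bar>g z\<bar> \<le> C"
  shows "expgrowth g"
  by (rule expgrowthI[of _ "max C 0" 0]) (use assms in \<open>auto intro: order_trans max.cobounded1\<close>)

lemma expgrowth_const [intro]: "expgrowth (\<lambda>z. c)"
  by (rule expgrowth_bounded[of _ "\<bar>c\<bar>"]) auto

lemma expgrowth_ident [intro]: "expgrowth (\<lambda>z. z)"
proof (rule expgrowthI[of _ 1 1])
  show "\<bar>z\<bar> \<le> 1 * exp (1 * \<bar>z\<bar>)" for z :: real
    using exp_ge_add_one_self[of "\<bar>z\<bar>"] by (simp del: exp_ge_add_one_self)
qed auto

lemma expgrowth_exp [intro]: "expgrowth (\<lambda>z. exp (k * z))"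
proof (rule expgrowthI[of _ 1 "\<bar>k\<bar>"])
  show "\<bar>exp (k * z)\<bar> \<le> 1 * exp (\<bar>k\<bar> * \<bar>z\<bar>)" for z
    by (simp flip: abs_mult)
qed auto

lemma expgrowth_add [intro]:
  assumes "expgrowth f" "expgrowth g"
  shows "expgrowth (\<lambda>z. f z + g z)"
proof -
  from assms(1) obtain C k where f: "0 \<le> C" "0 \<le> k" "\<And>z. \<bar>f z\<bar> \<le> C * exp (k * \<bar>z\<bar>)"
    by (rule expgrowthE) blast
  from assms(2) obtain D l where g: "0 \<le> D" "0 \<le> l" "\<And>z. \<bar>g z\<bar> \<le> D * exp (l * \<bar>z\<bar>)"
    by (rule expgrowthE) blast
  show ?thesis
  proof (rule expgrowthI[of _ "C + D" "k + l"])
    show "\<bar>f z + g z\<bar> \<le> (C + D) * exp ((k + l) * \<bar>z\<bar>)" for z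
    proof -
      have "C * exp (k * \<bar>z\<bar>) \<le> C * exp ((k + l) * \<bar>z\<bar>)" "D * exp (l * \<bar>z\<bar>) \<le> D * exp ((k + l) * \<bar>z\<bar>)"
        using f(1,2) g(1,2) by (auto intro!: mult_left_mono mult_right_mono)
      then show ?thesis using f(3)[of z] g(3)[of z] abs_triangle_ineq[of "f z" "g z"] by (simp add: distrib_right)
    qed
  qed (use f g assms[THEN expgrowth_measurable] in auto)
qed

lemma expgrowth_mult [intro]:
  assumes "expgrowth f" "expgrowth g"
  shows "expgrowth (\<lambda>z. f z * g z)"
proof -
  from assms(1) obtain C k where f: "0 \<le> C" "0 \<le> k" "\<And>z. \<bar>f z\<bar> \<le> C * exp (k * \<bar>z\<bar>)"
    by (rule expgrowthE) blast
  from assms(2) obtain D l where g: "0 \<le> D" "0 \<le> l" "\<And>z. \<bar>g z\<bar> \<le> D * exp (l * \<bar>z\<bar>)"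
    by (rule expgrowthE) blast
  show ?thesis
  proof (rule expgrowthI[of _ "C * D" "k + l"])
    show "\<bar>f z * g z\<bar> \<le> (C * D) * exp ((k + l) * \<bar>z\<bar>)" for z
    proof -
      have "\<bar>f z * g z\<bar> \<le> (C * exp (k * \<bar>z\<bar>)) * (D * exp (l * \<bar>z\<bar>))"
        unfolding abs_mult using f g by (intro mult_mono) auto
      also have "\<dots> = (C * D) * exp ((k + l) * \<bar>z\<bar>)"
        by (simp add: distrib_right exp_add)
      finally show ?thesis .
    qed
  qed (use f g assms[THEN expgrowth_measurable] in auto)
qed

lemma expgrowth_minus [intro]: "expgrowth f \<Longrightarrow> expgrowth (\<lambda>z. - f z)"
  using expgrowth_mult[OF expgrowth_const[of "- 1"], of f] by simp

lemma expgrowth_abs [intro]: "expgrowth f \<Longrightarrow> expgrowth (\<lambda>z. \<bar>f z\<bar>)"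
  unfolding expgrowth_def by auto

lemma expgrowth_diff [intro]: "expgrowth f \<Longrightarrow> expgrowth g \<Longrightarrow> expgrowth (\<lambda>z. f z - g z)"
  using expgrowth_add[OF _ expgrowth_minus, of f g] by simp

lemma expgrowth_power [intro]: "expgrowth f \<Longrightarrow> expgrowth (\<lambda>z. f z ^ n)"
  by (induction n) auto

lemma expgrowth_sum [intro]:
  assumes "\<And>i. i \<in> I \<Longrightarrow> expgrowth (f i)"
  shows "expgrowth (\<lambda>z. \<Sum>i\<in>I. f i z)"
  using assms by (induction I rule: infinite_finite_induct) auto

lemma expgrowth_affine:
  assumes "expgrowth f"
  shows "expgrowth (\<lambda>z. f (a + b * z))"
proof -
  from assms obtain C k where f: "0 \<le> C" "0 \<le> k" "\<And>z. \<bar>f z\<bar> \<le> C * exp (k * \<bar>z\<bar>)"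
    by (rule expgrowthE) blast
  have [measurable]: "f \<in> borel_measurable borel" using assms by (rule expgrowth_measurable)
  show ?thesis
  proof (rule expgrowthI[of _ "C * exp (k * \<bar>a\<bar>)" "k * \<bar>b\<bar>"])
    show "\<bar>f (a + b * z)\<bar> \<le> C * exp (k * \<bar>a\<bar>) * exp (k * \<bar>b\<bar> * \<bar>z\<bar>)" for z
    proof -
      have "k * \<bar>a + b * z\<bar> \<le> k * (\<bar>a\<bar> + \<bar>b\<bar> * \<bar>z\<bar>)"
        using f(2) by (intro mult_left_mono) (auto simp flip: abs_mult)
      then have "C * exp (k * \<bar>a + b * z\<bar>) \<le> C * exp (k * (\<bar>a\<bar> + \<bar>b\<bar> * \<bar>z\<bar>))"
        using f(1) by (intro mult_left_mono) auto
      with f(3)[of "a + b * z"] show ?thesis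
        by (simp add: distrib_left exp_add mult.assoc)
    qed
  qed (use f in auto)
qed

lemma expgrowth_abs_powr:
  assumes "expgrowth f" "0 \<le> r"
  shows "expgrowth (\<lambda>z. \<bar>f z\<bar> powr r)"
proof -
  from assms(1) obtain C k where f: "0 \<le> C" "0 \<le> k" "\<And>z. \<bar>f z\<bar> \<le> C * exp (k * \<bar>z\<bar>)"
    by (rule expgrowthE) blast
  have [measurable]: "f \<in> borel_measurable borel" using assms(1) by (rule expgrowth_measurable)
  show ?thesis
  proof (rule expgrowthI[of _ "C powr r" "r * k"])
    show "\<bar>\<bar>f z\<bar> powr r\<bar> \<le> C powr r * exp (r * k * \<bar>z\<bar>)" for z
    proof -
      have "\<bar>f z\<bar> powr r \<le> (C * exp (k * \<bar>z\<bar>)) powr r"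
        using f assms by (intro powr_mono2) auto
      also have "\<dots> = C powr r * exp (r * k * \<bar>z\<bar>)"
        using f by (simp add: powr_mult) (simp add: powr_def mult.assoc)
      finally show ?thesis by simp
    qed
  qed (use f assms in auto)
qed

lemma expgrowth_integrable:
  assumes "expgrowth f"
  shows "integrable std_gaussian f"
proof -
  from assms obtain C k where f: "0 \<le> C" "0 \<le> k" "\<And>z. \<bar>f z\<bar> \<le> C * exp (k * \<bar>z\<bar>)"
    by (rule expgrowthE) blast
  have [measurable]: "f \<in> borel_measurable borel" using assms by (rule expgrowth_measurable)
  show ?thesis
  proof (rule Bochner_Integration.integrable_bound)
    show "integrable std_gaussian (\<lambda>z. C * (exp (k * z) + exp (- k * z)))"
      by (intro integrable_mult_right Bochner_Integration.integrable_add integrable_exp_std_gaussian)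
    show "AE z in std_gaussian. norm (f z) \<le> norm (C * (exp (k * z) + exp (- k * z)))"
    proof (rule AE_I2)
      fix z
      have "C * exp (k * \<bar>z\<bar>) \<le> C * (exp (k * z) + exp (- k * z))"
        using f(1) by (intro mult_left_mono) (auto simp: abs_if)
      with f(3)[of z] show "norm (f z) \<le> norm (C * (exp (k * z) + exp (- k * z)))" by simp
    qed
  qed simp
qed

text \<open>Completing the square gives \<open>- z\<^sup>2 / 2 + k * z \<le> (k + 1)\<^sup>2 / 2 - z\<close>.\<close>

lemma std_normal_density_exp_tendsto_0:
  "((\<lambda>z. std_normal_density z * exp (k * \<bar>z\<bar>)) \<longlongrightarrow> 0) at_top"
  "((\<lambda>z. std_normal_density z * exp (k * \<bar>z\<bar>)) \<longlongrightarrow> 0) at_bot"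
proof -
  let ?c = "1 / sqrt (2 * pi) * exp ((k + 1)\<^sup>2 / 2)"
  have lim: "((\<lambda>z::real. ?c * exp (- z)) \<longlongrightarrow> 0) at_top"
    by (intro tendsto_mult_right_zero filterlim_compose[OF exp_at_bot] filterlim_uminus_at_bot_at_top)
  have "eventually (\<lambda>z. norm (std_normal_density z * exp (k * \<bar>z\<bar>)) \<le> ?c * exp (- z)) at_top"
    using eventually_ge_at_top[of 0]
  proof eventually_elim
    case (elim z)
    have "- z\<^sup>2 / 2 + k * z \<le> (k + 1)\<^sup>2 / 2 - z"
      using zero_le_power2[of "z - (k + 1)"] by (simp add: power2_eq_square algebra_simps)
    then have "exp (- z\<^sup>2 / 2) * exp (k * z) \<le> exp ((k + 1)\<^sup>2 / 2) * exp (- z)"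
      by (simp flip: exp_add)
    from mult_left_mono[OF this, of "1 / sqrt (2 * pi)"] elim show ?case
      by (simp add: std_normal_density_def)
  qed
  then show *: "((\<lambda>z. std_normal_density z * exp (k * \<bar>z\<bar>)) \<longlongrightarrow> 0) at_top"
    by (rule Lim_null_comparison[OF _ lim])
  show "((\<lambda>z. std_normal_density z * exp (k * \<bar>z\<bar>)) \<longlongrightarrow> 0) at_bot"
    using * unfolding filterlim_at_bot_mirror by (simp add: std_normal_density_def)
qed

lemma expgrowth_density_tendsto_0:
  assumes "expgrowth g"
  shows "((\<lambda>z. std_normal_density z * g z) \<longlongrightarrow> 0) at_top"
    and "((\<lambda>z. std_normal_density z * g z) \<longlongrightarrow> 0) at_bot"
proof -
  from assms obtain C k where g: "0 \<le> C" "0 \<le> k" "\<And>z. \<bar>g z\<bar> \<le> C * exp (k * \<bar>z\<bar>)"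
    by (rule expgrowthE) blast
  have le: "norm (std_normal_density z * g z) \<le> C * (std_normal_density z * exp (k * \<bar>z\<bar>))" for z
    using mult_left_mono[OF g(3)[of z], of "std_normal_density z"] by (simp add: abs_mult ac_simps)
  show "((\<lambda>z. std_normal_density z * g z) \<longlongrightarrow> 0) at_top"
    by (rule Lim_null_comparison[OF always_eventually[rule_format, OF le]])
       (intro tendsto_mult_right_zero std_normal_density_exp_tendsto_0)
  show "((\<lambda>z. std_normal_density z * g z) \<longlongrightarrow> 0) at_bot"
    by (rule Lim_null_comparison[OF always_eventually[rule_format, OF le]])
       (intro tendsto_mult_right_zero std_normal_density_exp_tendsto_0)
qed

lemma std_normal_density_deriv:
  "(std_normal_density has_real_derivative - z * std_normal_density z) (at z)"
  unfolding std_normal_density_def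
  by (auto intro!: derivative_eq_intros simp: field_simps)

text \<open>The function \<open>g' z - z * g z\<close> times the density is the derivative of \<open>g z\<close> times the density, which vanishes
at both ends of the line.\<close>

lemma gaussian_integration_by_parts:
  assumes deriv: "\<And>z. (g has_real_derivative g' z) (at z)"
    and cont: "continuous_on UNIV g'"
    and g: "expgrowth g" and g': "expgrowth g'"
  shows "integral\<^sup>L std_gaussian g' = (\<integral>z. z * g z \<partial>std_gaussian)"
proof -
  let ?f = "\<lambda>z. std_normal_density z * (g' z - z * g z)"
  have eg: "expgrowth (\<lambda>z. g' z - z * g z)"
    using g g' by (intro expgrowth_diff expgrowth_mult expgrowth_ident)
  have int: "integrable lborel ?f"
    using expgrowth_integrable[OF eg] integrable_std_gaussian[OF expgrowth_measurable[OF eg]] by simp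
  have [simp]: "isCont g z" for z using deriv[of z] by (rule DERIV_isCont)
  have [simp]: "isCont g' z" for z using cont by (simp add: continuous_on_eq_continuous_at)
  have [simp]: "isCont std_normal_density z" for z by (rule DERIV_isCont[OF std_normal_density_deriv])
  have "(LBINT z=-\<infinity>..\<infinity>. ?f z) = 0 - 0"
  proof (rule interval_integral_FTC_integrable[where F="\<lambda>z. std_normal_density z * g z"])
    show "((\<lambda>z. std_normal_density z * g z) has_vector_derivative ?f z) (at z)" for z
      unfolding has_real_derivative_iff_has_vector_derivative[symmetric]
      by (auto intro!: derivative_eq_intros std_normal_density_deriv deriv simp: algebra_simps)
    show "set_integrable lborel (einterval (- \<infinity>) \<infinity>) ?f"
      using int by (simp add: set_integrable_def einterval_def)
    show "(((\<lambda>z. std_normal_density z * g z) \<circ> real_of_ereal) \<longlongrightarrow> 0) (at_right (- \<infinity>))"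
      unfolding ereal_tendsto_simps using expgrowth_density_tendsto_0[OF g] by simp
    show "(((\<lambda>z. std_normal_density z * g z) \<circ> real_of_ereal) \<longlongrightarrow> 0) (at_left \<infinity>)"
      unfolding ereal_tendsto_simps using expgrowth_density_tendsto_0[OF g] by simp
  qed auto
  then have "(\<integral>z. ?f z \<partial>lborel) = 0"
    by (simp add: interval_lebesgue_integral_def set_lebesgue_integral_def einterval_def)
  then have "(\<integral>z. g' z - z * g z \<partial>std_gaussian) = 0"
    using integral_std_gaussian[OF expgrowth_measurable[OF eg]] by simp
  moreover have "(\<integral>z. g' z - z * g z \<partial>std_gaussian) = integral\<^sup>L std_gaussian g' - (\<integral>z. z * g z \<partial>std_gaussian)"
    using g g' by (intro Bochner_Integration.integral_diff expgrowth_integrable) auto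
  ultimately show ?thesis by simp
qed

text \<open>The two sides are integrals against laws with the same characteristic function.\<close>

lemma gaussian_convolution:
  fixes f :: "real \<Rightarrow> real"
  assumes [measurable]: "f \<in> borel_measurable borel" and bd: "\<And>x. \<bar>f x\<bar> \<le> C"
  shows "(\<integral>z. (\<integral>w. f (a * z + b * w) \<partial>std_gaussian) \<partial>std_gaussian) =
     (\<integral>z. f (sqrt (a\<^sup>2 + b\<^sup>2) * z) \<partial>std_gaussian)"
proof -
  interpret P: pair_prob_space std_gaussian std_gaussian ..
  let ?P = "std_gaussian \<Otimes>\<^sub>M std_gaussian"
  define A where "A = distr ?P borel (\<lambda>(z, w). a * z + b * w)"
  define B where "B = distr std_gaussian borel (\<lambda>z. sqrt (a\<^sup>2 + b\<^sup>2) * z)"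
  have charN: "(\<integral>z. iexp (t * z) \<partial>std_gaussian) = exp (- (complex_of_real t)\<^sup>2 / 2)" for t
    using fun_cong[OF char_std_normal_distribution, of t] by (simp add: char_def std_gaussian_def ac_simps flip: exp_of_real)
  have "char A t = char B t" for t
  proof -
    have "char A t = (\<integral>p. iexp (t * (case p of (z, w) \<Rightarrow> a * z + b * w)) \<partial>?P)"
      unfolding char_def A_def by (subst integral_distr) (auto simp: ac_simps)
    also have "\<dots> = (\<integral>p. iexp (t * a * fst p) * iexp (t * b * snd p) \<partial>?P)"
      by (intro Bochner_Integration.integral_cong) (auto simp: split_beta' algebra_simps simp flip: exp_add)
    also have "\<dots> = (\<integral>z. (\<integral>w. iexp (t * a * z) * iexp (t * b * w) \<partial>std_gaussian) \<partial>std_gaussian)"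
      by (subst P.integral_fst'[symmetric]) (auto intro!: P.integrable_const_bound[where B=1] simp: norm_mult)
    also have "\<dots> = exp (- (complex_of_real (t * a))\<^sup>2 / 2) * exp (- (complex_of_real (t * b))\<^sup>2 / 2)"
      using charN[of "t * a"] charN[of "t * b"] by simp
    also have "\<dots> = exp (- (complex_of_real (t * sqrt (a\<^sup>2 + b\<^sup>2)))\<^sup>2 / 2)"
      by (simp add: power_mult_distrib field_simps flip: exp_add of_real_power)
    also have "\<dots> = (\<integral>z. iexp (t * sqrt (a\<^sup>2 + b\<^sup>2) * z) \<partial>std_gaussian)"
      using charN[of "t * sqrt (a\<^sup>2 + b\<^sup>2)"] by simp
    also have "\<dots> = char B t"
      unfolding char_def B_def by (subst integral_distr) (auto simp: ac_simps)
    finally show ?thesis .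
  qed
  then have AB: "A = B"
    by (intro Levy_uniqueness) (auto simp: A_def B_def real_distribution_def real_distribution_axioms_def
        intro!: P.prob_space_distr gauss.prob_space_distr)
  have "(\<integral>z. (\<integral>w. f (a * z + b * w) \<partial>std_gaussian) \<partial>std_gaussian) = (\<integral>p. f (a * fst p + b * snd p) \<partial>?P)"
    by (subst P.integral_fst'[symmetric]) (auto intro!: P.integrable_const_bound[where B=C] simp: bd)
  also have "\<dots> = integral\<^sup>L A f"
    unfolding A_def by (subst integral_distr) (auto simp: split_beta')
  also have "\<dots> = (\<integral>z. f (sqrt (a\<^sup>2 + b\<^sup>2) * z) \<partial>std_gaussian)"
    unfolding AB B_def by (subst integral_distr) auto
  finally show ?thesis .
qed

section \<open>Hermite polynomials\<close>

fun hermite :: "nat \<Rightarrow> real \<Rightarrow> real" where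
  "hermite 0 z = 1"
| "hermite (Suc 0) z = z"
| "hermite (Suc (Suc n)) z = z * hermite (Suc n) z - real (Suc n) * hermite n z"

lemma hermite_Suc: "hermite (Suc n) z = z * hermite n z - real n * hermite (n - 1) z"
  by (cases n) auto

lemma hermite_has_derivative:
  "(hermite n has_real_derivative real n * hermite (n - 1) z) (at z)"
proof (induction n rule: less_induct)
  case (less n)
  consider "n = 0" | "n = 1" | m where "n = Suc (Suc m)"
    by (metis One_nat_def not0_implies_Suc)
  then show ?case
  proof cases
    case 1
    then show ?thesis by (simp add: hermite.simps(1)[abs_def])
  next
    case 2
    then show ?thesis by (simp add: hermite.simps(2)[abs_def])
  next
    case 3
    have e: "hermite n = (\<lambda>z. z * hermite (Suc m) z - real (Suc m) * hermite m z)"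
      using 3 by auto
    have D1: "(hermite (Suc m) has_real_derivative real (Suc m) * hermite m z) (at z)"
      and D0: "(hermite m has_real_derivative real m * hermite (m - 1) z) (at z)"
      using less[of "Suc m"] less[of m] 3 by auto
    show ?thesis
      unfolding e
      by (rule DERIV_cong[OF DERIV_diff[OF DERIV_mult[OF DERIV_ident D1] DERIV_cmult[OF D0]]])
         (simp add: 3 algebra_simps hermite_Suc[of m])
  qed
qed

lemma continuous_hermite: "continuous_on A (hermite n)"
  using hermite_has_derivative[of n] DERIV_isCont continuous_at_imp_continuous_on by blast

lemma hermite_measurable [measurable]: "hermite n \<in> borel_measurable borel"
  by (rule borel_measurable_continuous_onI) (rule continuous_hermite)

lemma expgrowth_hermite [intro]: "expgrowth (hermite n)"
proof (induction n rule: less_induct)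
  case (less n)
  consider "n = 0" | "n = 1" | m where "n = Suc (Suc m)"
    by (metis One_nat_def not0_implies_Suc)
  then show ?case
  proof cases
    case 3
    have e: "hermite n = (\<lambda>z. z * hermite (Suc m) z - real (Suc m) * hermite m z)"
      using 3 by auto
    show ?thesis
      unfolding e using less[of "Suc m"] less[of m] 3
      by (intro expgrowth_diff expgrowth_mult expgrowth_ident expgrowth_const) auto
  qed (auto simp: hermite.simps(1,2)[abs_def])
qed

text \<open>Gaussian integration by parts for \<open>g * hermite n\<close>, since \<open>hermite (Suc n)\<close> is \<open>z * hermite n\<close> minus the
derivative of \<open>hermite n\<close>.\<close>

lemma hermite_integration_by_parts:
  assumes deriv: "\<And>z. (g has_real_derivative g' z) (at z)"
    and cont: "continuous_on UNIV g'"
    and g: "expgrowth g" and g': "expgrowth g'"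
  shows "(\<integral>z. g z * hermite (Suc n) z \<partial>std_gaussian) = (\<integral>z. g' z * hermite n z \<partial>std_gaussian)"
proof -
  have contg: "continuous_on UNIV g"
    using deriv DERIV_isCont continuous_at_imp_continuous_on by blast
  have "(\<integral>z. g' z * hermite n z + g z * (real n * hermite (n - 1) z) \<partial>std_gaussian) =
      (\<integral>z. z * (g z * hermite n z) \<partial>std_gaussian)"
    by (rule gaussian_integration_by_parts)
       (use g g' in \<open>auto intro!: derivative_eq_intros deriv hermite_has_derivative continuous_intros
          cont contg continuous_hermite expgrowth_add expgrowth_mult expgrowth_hermite\<close>)
  then have "(\<integral>z. g' z * hermite n z \<partial>std_gaussian) =
      (\<integral>z. z * (g z * hermite n z) \<partial>std_gaussian) - (\<integral>z. g z * (real n * hermite (n - 1) z) \<partial>std_gaussian)"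
    by (subst (asm) Bochner_Integration.integral_add)
       (use g g' in \<open>auto intro!: expgrowth_integrable expgrowth_mult expgrowth_hermite\<close>)
  also have "\<dots> = (\<integral>z. z * (g z * hermite n z) - g z * (real n * hermite (n - 1) z) \<partial>std_gaussian)"
    by (subst Bochner_Integration.integral_diff)
       (use g g' in \<open>auto intro!: expgrowth_integrable expgrowth_mult expgrowth_hermite\<close>)
  also have "\<dots> = (\<integral>z. g z * hermite (Suc n) z \<partial>std_gaussian)"
    by (simp add: hermite_Suc algebra_simps)
  finally show ?thesis by simp
qed

lemma hermite_orthogonal:
  "(\<integral>z. hermite j z * hermite k z \<partial>std_gaussian) = (if j = k then fact k else 0)"
proof (induction k arbitrary: j)
  case 0
  show ?case
  proof (cases j)
    case 0
    then show ?thesis using gauss.prob_space by simp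
  next
    case (Suc i)
    have "(\<integral>z. 1 * hermite (Suc i) z \<partial>std_gaussian) = (\<integral>z. 0 * hermite i z \<partial>std_gaussian)"
      by (rule hermite_integration_by_parts) auto
    then show ?thesis using Suc by simp
  qed
next
  case (Suc k)
  have "(\<integral>z. hermite j z * hermite (Suc k) z \<partial>std_gaussian) =
      (\<integral>z. real j * hermite (j - 1) z * hermite k z \<partial>std_gaussian)"
    by (rule hermite_integration_by_parts)
       (rule hermite_has_derivative continuous_on_mult continuous_on_const continuous_hermite
          expgrowth_mult expgrowth_const expgrowth_hermite)+
  also have "\<dots> = real j * (\<integral>z. hermite (j - 1) z * hermite k z \<partial>std_gaussian)"
    by (simp add: mult.assoc)
  also have "\<dots> = (if j = Suc k then fact (Suc k) else 0)"
    unfolding Suc.IH by (cases j) auto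
  finally show ?case .
qed

lemma integral_mult_hermite_sum:
  assumes "expgrowth g"
  shows "(\<integral>z. g z * (\<Sum>k<n. c k * hermite k z) \<partial>std_gaussian) =
    (\<Sum>k<n. c k * (\<integral>z. g z * hermite k z \<partial>std_gaussian))"
proof -
  have "(\<integral>z. g z * (\<Sum>k<n. c k * hermite k z) \<partial>std_gaussian) =
      (\<integral>z. (\<Sum>k<n. c k * (g z * hermite k z)) \<partial>std_gaussian)"
    by (simp add: sum_distrib_left mult.left_commute)
  also have "\<dots> = (\<Sum>k<n. c k * (\<integral>z. g z * hermite k z \<partial>std_gaussian))"
    using assms by (subst Bochner_Integration.integral_sum)
      (auto intro!: integrable_mult_right expgrowth_integrable expgrowth_mult)
  finally show ?thesis .
qed

lemma hermite_sum_norm: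
  "(\<integral>z. (\<Sum>j<n. b j * hermite j z)\<^sup>2 \<partial>std_gaussian) = (\<Sum>j<n. (b j)\<^sup>2 * fact j)"
proof -
  have "(\<integral>z. (\<Sum>j<n. b j * hermite j z)\<^sup>2 \<partial>std_gaussian) =
      (\<integral>z. (\<Sum>j<n. \<Sum>k<n. b j * b k * (hermite j z * hermite k z)) \<partial>std_gaussian)"
    by (simp add: power2_eq_square sum_product ac_simps)
  also have "\<dots> = (\<Sum>j<n. \<Sum>k<n. b j * b k * (\<integral>z. hermite j z * hermite k z \<partial>std_gaussian))"
    by (subst Bochner_Integration.integral_sum | intro sum.cong refl
        Bochner_Integration.integrable_sum integrable_mult_right expgrowth_integrable expgrowth_mult expgrowth_hermite
        | simp)+
  also have "\<dots> = (\<Sum>j<n. (b j)\<^sup>2 * fact j)"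
    by (simp add: hermite_orthogonal power2_eq_square if_distrib[of "\<lambda>x. _ * x"] cong: if_cong)
  finally show ?thesis .
qed

text \<open>The density of the Gaussian law shifted by \<open>h\<close> with respect to the unshifted one; it is also the
generating function of the Hermite polynomials.\<close>

definition exp_mart :: "real \<Rightarrow> real \<Rightarrow> real" where
  "exp_mart h z = exp (h * z - h\<^sup>2 / 2)"

lemma exp_mart_measurable [measurable]: "exp_mart h \<in> borel_measurable borel"
  unfolding exp_mart_def by measurable

lemma exp_mart_altdef: "exp_mart h z = exp (- h\<^sup>2 / 2) * exp (h * z)"
  by (simp add: exp_mart_def flip: exp_add)

lemma expgrowth_exp_mart [intro]: "expgrowth (exp_mart h)"
  unfolding exp_mart_altdef[abs_def] by (intro expgrowth_mult expgrowth_const expgrowth_exp)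

lemma integral_exp_mart: "integral\<^sup>L std_gaussian (exp_mart h) = 1"
  using integral_std_gaussian_shift[of "\<lambda>_. 1" h] gauss.prob_space by (simp add: exp_mart_def[abs_def])

lemma integral_exp_mart_square: "(\<integral>z. (exp_mart h z)\<^sup>2 \<partial>std_gaussian) = exp (h\<^sup>2)"
proof -
  have "(\<lambda>z. (exp_mart h z)\<^sup>2) = (\<lambda>z. exp (h\<^sup>2) * exp_mart (2 * h) z)"
    by (auto simp: exp_mart_def power2_eq_square algebra_simps simp flip: exp_add)
  then show ?thesis by (simp add: integral_exp_mart)
qed

lemma integral_exp_mart_hermite: "(\<integral>z. exp_mart h z * hermite k z \<partial>std_gaussian) = h ^ k"
proof (induction k)
  case 0
  then show ?case by (simp add: integral_exp_mart)
next
  case (Suc k)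
  have "(\<integral>z. exp_mart h z * hermite (Suc k) z \<partial>std_gaussian) = (\<integral>z. h * exp_mart h z * hermite k z \<partial>std_gaussian)"
  proof (rule hermite_integration_by_parts)
    show "(exp_mart h has_real_derivative h * exp_mart h z) (at z)" for z
      unfolding exp_mart_def by (auto intro!: derivative_eq_intros)
    show "continuous_on UNIV (\<lambda>z. h * exp_mart h z)"
      unfolding exp_mart_def by (intro continuous_intros)
  qed (auto intro!: expgrowth_mult)
  then show ?case using Suc by (simp add: mult.assoc)
qed

definition exp_mart_rest :: "nat \<Rightarrow> real \<Rightarrow> real \<Rightarrow> real" where
  "exp_mart_rest n h z = exp_mart h z - (\<Sum>k<n. h ^ k / fact k * hermite k z)"

lemma expgrowth_exp_mart_rest [intro]: "expgrowth (exp_mart_rest n h)"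
  unfolding exp_mart_rest_def[abs_def]
  by (intro expgrowth_diff expgrowth_sum expgrowth_mult expgrowth_const expgrowth_hermite expgrowth_exp_mart)

text \<open>The Hermite coefficients and the norm of \<open>exp_mart h\<close> are known explicitly, so the norm of the remainder
comes from expanding the square, without any pointwise convergence of the generating series.\<close>

lemma exp_mart_rest_norm:
  "(\<integral>z. (exp_mart_rest n h z)\<^sup>2 \<partial>std_gaussian) = exp (h\<^sup>2) - (\<Sum>k<n. (h\<^sup>2) ^ k / fact k)"
proof -
  let ?S = "\<lambda>z. \<Sum>k<n. h ^ k / fact k * hermite k z"
  have S: "expgrowth ?S"
    by (intro expgrowth_sum expgrowth_mult expgrowth_const expgrowth_hermite)
  have "(\<integral>z. (exp_mart_rest n h z)\<^sup>2 \<partial>std_gaussian) =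
      (\<integral>z. (exp_mart h z)\<^sup>2 - 2 * (exp_mart h z * ?S z) + (?S z)\<^sup>2 \<partial>std_gaussian)"
  proof -
    have "(x - y)\<^sup>2 = x\<^sup>2 - 2 * (x * y) + y\<^sup>2" for x y :: real
      by (simp add: power2_diff)
    then show ?thesis unfolding exp_mart_rest_def by simp
  qed
  also have "\<dots> = (\<integral>z. (exp_mart h z)\<^sup>2 \<partial>std_gaussian) - 2 * (\<integral>z. exp_mart h z * ?S z \<partial>std_gaussian)
      + (\<integral>z. (?S z)\<^sup>2 \<partial>std_gaussian)"
  proof -
    have "integrable std_gaussian (\<lambda>z. (exp_mart h z)\<^sup>2)"
      "integrable std_gaussian (\<lambda>z. exp_mart h z * ?S z)" "integrable std_gaussian (\<lambda>z. (?S z)\<^sup>2)"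
      by (intro expgrowth_integrable expgrowth_power expgrowth_mult expgrowth_exp_mart S)+
    then show ?thesis
      by (simp del: power_divide times_divide_eq_left times_divide_eq_right)
  qed
  also have "(\<integral>z. exp_mart h z * ?S z \<partial>std_gaussian) =
      (\<Sum>k<n. h ^ k / fact k * (\<integral>z. exp_mart h z * hermite k z \<partial>std_gaussian))"
    by (rule integral_mult_hermite_sum[OF expgrowth_exp_mart])
  also have "\<dots> = (\<Sum>k<n. (h\<^sup>2) ^ k / fact k)"
    by (simp add: integral_exp_mart_hermite power2_eq_square power_mult_distrib)
  also have "(\<integral>z. (?S z)\<^sup>2 \<partial>std_gaussian) = (\<Sum>k<n. (h\<^sup>2) ^ k / fact k)"
    unfolding hermite_sum_norm
    by (intro sum.cong refl) (simp add: power_divide power2_eq_square flip: power_mult_distrib)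
  finally show ?thesis by (simp add: integral_exp_mart_square)
qed

lemma (in prob_space) square_expectation_le:
  fixes f :: "'a \<Rightarrow> real"
  assumes "integrable M f" "integrable M (\<lambda>x. (f x)\<^sup>2)"
  shows "(expectation f)\<^sup>2 \<le> expectation (\<lambda>x. (f x)\<^sup>2)"
  using variance_positive[of f] variance_eq[OF assms] by simp

lemma exp_mart_rest_L1:
  "(\<integral>z. \<bar>exp_mart_rest n h z\<bar> \<partial>std_gaussian) \<le> sqrt (exp (h\<^sup>2) - (\<Sum>k<n. (h\<^sup>2) ^ k / fact k))"
proof -
  have eg: "expgrowth (exp_mart_rest n h)" by (rule expgrowth_exp_mart_rest)
  have "(\<integral>z. \<bar>exp_mart_rest n h z\<bar> \<partial>std_gaussian)\<^sup>2 \<le> (\<integral>z. \<bar>exp_mart_rest n h z\<bar>\<^sup>2 \<partial>std_gaussian)"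
    by (rule gauss.square_expectation_le) (use eg in \<open>auto intro!: expgrowth_integrable integrable_abs\<close>)
  then show ?thesis
    by (intro real_le_rsqrt) (simp add: exp_mart_rest_norm)
qed

text \<open>A shift of the argument becomes the factor \<open>exp_mart h\<close>, which is then replaced by its Hermite
expansion: a Taylor formula in \<open>h\<close> that needs no derivative of \<open>f\<close>.\<close>

lemma gaussian_taylor:
  assumes [measurable]: "f \<in> borel_measurable borel" and bd: "\<And>z. \<bar>f z\<bar> \<le> C"
  shows "\<bar>(\<integral>z. f (z + h) \<partial>std_gaussian) - (\<Sum>k<n. h ^ k / fact k * (\<integral>z. f z * hermite k z \<partial>std_gaussian))\<bar>
    \<le> C * sqrt (exp (h\<^sup>2) - (\<Sum>k<n. (h\<^sup>2) ^ k / fact k))"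
proof -
  have f: "expgrowth f" using assms by (intro expgrowth_bounded)
  have C: "0 \<le> C" using bd[of 0] by simp
  have "(\<Sum>k<n. h ^ k / fact k * (\<integral>z. f z * hermite k z \<partial>std_gaussian)) =
      (\<integral>z. f z * (\<Sum>k<n. h ^ k / fact k * hermite k z) \<partial>std_gaussian)"
    by (rule integral_mult_hermite_sum[OF f, symmetric])
  moreover have "(\<integral>z. f (z + h) \<partial>std_gaussian) = (\<integral>z. f z * exp_mart h z \<partial>std_gaussian)"
    unfolding exp_mart_def by (rule integral_std_gaussian_shift) simp
  moreover have "(\<integral>z. f z * exp_mart_rest n h z \<partial>std_gaussian) = (\<integral>z. f z * exp_mart h z \<partial>std_gaussian)
      - (\<integral>z. f z * (\<Sum>k<n. h ^ k / fact k * hermite k z) \<partial>std_gaussian)"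
    unfolding exp_mart_rest_def right_diff_distrib
    by (rule Bochner_Integration.integral_diff)
       (intro expgrowth_integrable expgrowth_mult[OF f] expgrowth_exp_mart expgrowth_sum
          expgrowth_mult[OF expgrowth_const] expgrowth_hermite)+
  ultimately have "(\<integral>z. f (z + h) \<partial>std_gaussian) - (\<Sum>k<n. h ^ k / fact k * (\<integral>z. f z * hermite k z \<partial>std_gaussian))
      = (\<integral>z. f z * exp_mart_rest n h z \<partial>std_gaussian)"
    by simp
  also have "\<bar>\<dots>\<bar> \<le> (\<integral>z. \<bar>f z * exp_mart_rest n h z\<bar> \<partial>std_gaussian)"
    by (rule integral_abs_bound)
  also have "\<dots> \<le> (\<integral>z. C * \<bar>exp_mart_rest n h z\<bar> \<partial>std_gaussian)"
  proof (rule integral_mono)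
    show "\<bar>f z * exp_mart_rest n h z\<bar> \<le> C * \<bar>exp_mart_rest n h z\<bar>" for z
      unfolding abs_mult using bd by (intro mult_right_mono) auto
  qed (intro expgrowth_integrable expgrowth_abs expgrowth_mult[OF f] expgrowth_mult[OF expgrowth_const]
      expgrowth_exp_mart_rest)+
  also have "\<dots> \<le> C * sqrt (exp (h\<^sup>2) - (\<Sum>k<n. (h\<^sup>2) ^ k / fact k))"
    using exp_mart_rest_L1[of n h] C by (simp add: mult_left_mono)
  finally show ?thesis .
qed

text \<open>The operator on the left multiplies \<open>hermite n\<close> by \<open>\<rho> ^ n\<close>.  Induction over the three-term recursion works, as
integration by parts turns the factor \<open>z\<close> into a derivative.\<close>

lemma hermite_mehler:
  assumes "0 \<le> \<rho>" "\<rho> \<le> 1"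
  shows "(\<integral>z. hermite n (\<rho> * x + sqrt (1 - \<rho>\<^sup>2) * z) \<partial>std_gaussian) = \<rho> ^ n * hermite n x"
proof (induction n rule: less_induct)
  case (less n)
  define c where "c = sqrt (1 - \<rho>\<^sup>2)"
  have c2: "c * c = 1 - \<rho>\<^sup>2" using assms by (simp add: c_def power_le_one)
  show ?case
  proof (cases n)
    case 0
    then show ?thesis using gauss.prob_space by simp
  next
    case (Suc m)
    let ?y = "\<lambda>z. \<rho> * x + c * z"
    have eg: "expgrowth (\<lambda>z. hermite k (?y z))" for k
      by (rule expgrowth_affine) auto
    have int [simp]: "integrable std_gaussian (\<lambda>z. hermite k (?y z))" for k
      by (rule expgrowth_integrable) (rule eg)
    have [simp]: "integrable std_gaussian (\<lambda>z. z * hermite k (?y z))" for k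
      by (rule expgrowth_integrable) (intro expgrowth_mult eg expgrowth_ident)
    have ibp: "(\<integral>z. z * hermite m (?y z) \<partial>std_gaussian) = c * real m * (\<integral>z. hermite (m - 1) (?y z) \<partial>std_gaussian)"
    proof -
      have "(\<integral>z. c * (real m * hermite (m - 1) (?y z)) \<partial>std_gaussian) = (\<integral>z. z * hermite m (?y z) \<partial>std_gaussian)"
      proof (rule gaussian_integration_by_parts)
        show "((\<lambda>z. hermite m (?y z)) has_real_derivative c * (real m * hermite (m - 1) (?y z))) (at z)" for z
          by (rule DERIV_cong[OF DERIV_chain2[where f="hermite m", OF hermite_has_derivative]])
             (auto intro!: derivative_eq_intros)
        show "continuous_on UNIV (\<lambda>z. c * (real m * hermite (m - 1) (?y z)))"
          by (intro continuous_intros continuous_on_compose2[OF continuous_hermite[of UNIV]]) auto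
      qed (intro eg expgrowth_mult expgrowth_const)+
      then show ?thesis by simp
    qed
    have "(\<integral>z. hermite n (?y z) \<partial>std_gaussian) =
       (\<integral>z. \<rho> * x * hermite m (?y z) + c * (z * hermite m (?y z)) - real m * hermite (m - 1) (?y z) \<partial>std_gaussian)"
      unfolding Suc hermite_Suc by (simp add: algebra_simps)
    also have "\<dots> = \<rho> * x * (\<integral>z. hermite m (?y z) \<partial>std_gaussian) + c * (\<integral>z. z * hermite m (?y z) \<partial>std_gaussian)
        - real m * (\<integral>z. hermite (m - 1) (?y z) \<partial>std_gaussian)"
      by simp
    also have "\<dots> = \<rho> * x * (\<integral>z. hermite m (?y z) \<partial>std_gaussian)
       + (c * c - 1) * real m * (\<integral>z. hermite (m - 1) (?y z) \<partial>std_gaussian)"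
      unfolding ibp by (simp add: algebra_simps)
    also have "\<dots> = \<rho> * x * (\<rho> ^ m * hermite m x) - \<rho>\<^sup>2 * (real m * (\<rho> ^ (m - 1) * hermite (m - 1) x))"
      using less[of m] less[of "m - 1"] Suc by (simp add: c_def[symmetric] c2)
    also have "\<dots> = \<rho> ^ n * hermite n x"
      unfolding Suc hermite_Suc by (cases m) (simp_all add: power2_eq_square algebra_simps)
    finally show ?thesis by (simp add: c_def)
  qed
qed

section \<open>The Gaussian two-function inequality\<close>

text \<open>Third-order Taylor expansion.  The third derivative is positive, so the remainder is negative for
negative \<open>a\<close>, and this gives a bound up to the singularity at \<open>- 1\<close>.\<close>

lemma powr_taylor_upper:
  fixes \<alpha> a :: real
  assumes \<alpha>: "0 < \<alpha>" "\<alpha> < 1" and a: "- 1 < a"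
  shows "(1 + a) powr \<alpha> \<le> 1 + \<alpha> * a - \<alpha> * (1 - \<alpha>) / 2 * a\<^sup>2 + \<bar>a\<bar> ^ 3"
proof -
  define d where "d m x = (\<Prod>i<m. \<alpha> - real i) * (1 + x) powr (\<alpha> - real m)" for m :: nat and x :: real
  have d0: "d 0 = (\<lambda>x. (1 + x) powr \<alpha>)" by (simp add: d_def fun_eq_iff)
  have dd: "(d m has_real_derivative d (Suc m) x) (at x)" if "- 1 < x" for m x
    unfolding d_def using that
    by (auto intro!: derivative_eq_intros simp: algebra_simps)
  have d3: "d 3 x = \<alpha> * (1 - \<alpha>) * (2 - \<alpha>) * (1 + x) powr (\<alpha> - 3)" for x
    by (simp add: d_def numeral_3_eq_3 algebra_simps)
  have sum: "(\<Sum>m<3. d m 0 / fact m * h ^ m) = 1 + \<alpha> * h - \<alpha> * (1 - \<alpha>) / 2 * h\<^sup>2" for h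
    by (simp add: d_def numeral_3_eq_3 power2_eq_square field_simps)
  consider "a = 0" | "0 < a" | "a < 0" by linarith
  then show ?thesis
  proof cases
    case 2
    from Maclaurin2[of a d "d 0" 3] 2 obtain t where t: "0 < t" "t \<le> a"
        "d 0 a = (\<Sum>m<3. d m 0 / fact m * a ^ m) + d 3 t / fact 3 * a ^ 3"
      using dd by auto
    have "d 3 t \<le> 6"
    proof -
      have "\<alpha> * (1 - \<alpha>) * (2 - \<alpha>) \<le> 1 * 1 * 2"
        using \<alpha> by (intro mult_mono) auto
      moreover have "(1 + t) powr (\<alpha> - 3) \<le> 1"
        using t \<alpha> powr_mono2'[of "\<alpha> - 3" 1 "1 + t"] by simp
      ultimately have "\<alpha> * (1 - \<alpha>) * (2 - \<alpha>) * (1 + t) powr (\<alpha> - 3) \<le> 2 * 1"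
        using \<alpha> by (intro mult_mono) auto
      then show ?thesis by (simp add: d3)
    qed
    then have "d 3 t / fact 3 * a ^ 3 \<le> 1 * a ^ 3"
      using 2 by (intro mult_right_mono) (auto simp: fact_numeral)
    with t(3) have "d 0 a \<le> (\<Sum>m<3. d m 0 / fact m * a ^ m) + a ^ 3" by linarith
    then show ?thesis unfolding sum using 2 by (simp add: d0)
  next
    case 3
    from Maclaurin_minus[of a 3 d "d 0"] 3 a obtain t where t: "a < t" "t < 0"
        "d 0 a = (\<Sum>m<3. d m 0 / fact m * a ^ m) + d 3 t / fact 3 * a ^ 3"
      using dd by auto
    have "0 \<le> d 3 t" using \<alpha> by (simp add: d3)
    then have "d 3 t / fact 3 * a ^ 3 \<le> 0"
      using 3 by (intro mult_nonneg_nonpos) (auto simp: power3_eq_cube mult_nonneg_nonpos mult_le_0_iff)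
    moreover have "0 \<le> \<bar>a\<bar> ^ 3" by simp
    ultimately have "d 0 a \<le> (\<Sum>m<3. d m 0 / fact m * a ^ m) + \<bar>a\<bar> ^ 3" using t(3) by linarith
    then show ?thesis unfolding sum by (simp add: d0)
  qed simp
qed

definition heat :: "real \<Rightarrow> (real \<Rightarrow> real) \<Rightarrow> real \<Rightarrow> real" where
  "heat t f x = (\<integral>z. f (x + sqrt t * z) \<partial>std_gaussian)"

text \<open>Averages \<open>h\<close> over a pair of centred Gaussian variables with variance \<open>t\<close> and correlation \<open>\<rho>\<close>.\<close>

definition heat2 :: "real \<Rightarrow> real \<Rightarrow> (real \<Rightarrow> real \<Rightarrow> real) \<Rightarrow> real \<Rightarrow> real \<Rightarrow> real" where
  "heat2 \<rho> t h x y = (\<integral>z. (\<integral>w. h (x + sqrt t * z) (y + sqrt t * (\<rho> * z + sqrt (1 - \<rho>\<^sup>2) * w))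
     \<partial>std_gaussian) \<partial>std_gaussian)"

lemma integrable_std_gaussian_bounded:
  fixes f :: "real \<Rightarrow> real"
  assumes "f \<in> borel_measurable borel" "\<And>z. \<bar>f z\<bar> \<le> C"
  shows "integrable std_gaussian f"
  using assms by (intro gauss.integrable_const_bound[where B=C]) auto

lemma heat_measurable [measurable (raw)]:
  assumes [measurable]: "f \<in> borel_measurable borel" "g \<in> borel_measurable M"
  shows "(\<lambda>x. heat t f (g x)) \<in> borel_measurable M"
  unfolding heat_def by measurable

lemma gaussian_integral_bounds:
  fixes f :: "real \<Rightarrow> real"
  assumes [measurable]: "f \<in> borel_measurable borel" and bd: "\<And>x. c \<le> f x" "\<And>x. f x \<le> C"
  shows "c \<le> (\<integral>z. f z \<partial>std_gaussian)" "(\<integral>z. f z \<partial>std_gaussian) \<le> C"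
proof -
  have i: "integrable std_gaussian f"
  proof (rule integrable_std_gaussian_bounded)
    show "\<bar>f z\<bar> \<le> \<bar>c\<bar> + \<bar>C\<bar>" for z using bd(1)[of z] bd(2)[of z] by linarith
  qed simp
  show "c \<le> (\<integral>z. f z \<partial>std_gaussian)" "(\<integral>z. f z \<partial>std_gaussian) \<le> C"
    using integral_mono[OF _ i, of "\<lambda>_. c"] integral_mono[OF i, of "\<lambda>_. C"] bd gauss.prob_space by auto
qed

lemma gaussian_integral_abs_le:
  fixes f :: "real \<Rightarrow> real"
  assumes "f \<in> borel_measurable borel" "\<And>x. \<bar>f x\<bar> \<le> C"
  shows "\<bar>\<integral>z. f z \<partial>std_gaussian\<bar> \<le> C"
proof -
  have "- C \<le> f x" "f x \<le> C" for x using assms(2)[of x] by auto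
  from gaussian_integral_bounds[OF assms(1) this] show ?thesis by auto
qed

lemma heat_bounds:
  fixes f :: "real \<Rightarrow> real"
  assumes [measurable]: "f \<in> borel_measurable borel" and bd: "\<And>x. c \<le> f x" "\<And>x. f x \<le> C"
  shows "c \<le> heat t f x" "heat t f x \<le> C"
  unfolding heat_def
  using gaussian_integral_bounds[of "\<lambda>z. f (x + sqrt t * z)" c C] bd by simp_all

lemma heat_semigroup:
  fixes f :: "real \<Rightarrow> real"
  assumes [measurable]: "f \<in> borel_measurable borel" and bd: "\<And>x. \<bar>f x\<bar> \<le> C" and t: "0 \<le> t"
  shows "heat t (heat t f) x = heat (2 * t) f x"
proof -
  have "heat t (heat t f) x = (\<integral>z. (\<integral>w. f (x + (sqrt t * z + sqrt t * w)) \<partial>std_gaussian) \<partial>std_gaussian)"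
    unfolding heat_def by (simp add: add.assoc)
  also have "\<dots> = (\<integral>z. f (x + sqrt ((sqrt t)\<^sup>2 + (sqrt t)\<^sup>2) * z) \<partial>std_gaussian)"
    by (rule gaussian_convolution[where f="\<lambda>q. f (x + q)"]) (use bd in auto)
  also have "\<dots> = heat (2 * t) f x"
    unfolding heat_def using t by simp
  finally show ?thesis .
qed

lemma gaussian_fubini:
  fixes f :: "real \<Rightarrow> real \<Rightarrow> real"
  assumes [measurable]: "(\<lambda>p. f (fst p) (snd p)) \<in> borel_measurable (borel \<Otimes>\<^sub>M borel)" and bd: "\<And>x y. \<bar>f x y\<bar> \<le> C"
  shows "(\<integral>x. (\<integral>y. f x y \<partial>std_gaussian) \<partial>std_gaussian) = (\<integral>y. (\<integral>x. f x y \<partial>std_gaussian) \<partial>std_gaussian)"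
proof -
  interpret P: pair_prob_space std_gaussian std_gaussian ..
  have "integrable (std_gaussian \<Otimes>\<^sub>M std_gaussian) (case_prod f)"
    by (rule P.integrable_const_bound[where B=C]) (auto simp: bd split_beta')
  from P.Fubini_integral[OF this] show ?thesis by simp
qed

text \<open>Only the case of equal times is stated; it is what the doubling of time needs.\<close>

lemma heat2_semigroup:
  fixes h :: "real \<Rightarrow> real \<Rightarrow> real"
  assumes \<rho>: "\<rho>\<^sup>2 \<le> 1" and [measurable]: "(\<lambda>p. h (fst p) (snd p)) \<in> borel_measurable (borel \<Otimes>\<^sub>M borel)"
    and bd: "\<And>x y. \<bar>h x y\<bar> \<le> C" and t: "0 \<le> t"
  shows "heat2 \<rho> t (heat2 \<rho> t h) x y = heat2 \<rho> (2 * t) h x y"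
proof -
  define s where "s = sqrt t"
  define r where "r = sqrt (1 - \<rho>\<^sup>2)"
  have hm [measurable]: "(\<lambda>v. h (f v) (g v)) \<in> borel_measurable N"
    if [measurable]: "f \<in> borel_measurable N" "g \<in> borel_measurable N" for f g and N :: "'b measure"
    using measurable_compose[of "\<lambda>v. (f v, g v)" N "borel \<Otimes>\<^sub>M borel" "\<lambda>p. h (fst p) (snd p)" borel] by simp
  have Cnn: "0 \<le> C" using bd[of 0 0] by simp
  have ibd: "\<bar>\<integral>w. h (f w) (g w) \<partial>std_gaussian\<bar> \<le> C"
    if [measurable]: "f \<in> borel_measurable borel" "g \<in> borel_measurable borel" for f g
    using gaussian_integral_bounds[of "\<lambda>w. h (f w) (g w)" "- C" C] bd by (auto simp: abs_le_iff minus_le_iff)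
  have "heat2 \<rho> t (heat2 \<rho> t h) x y = (\<integral>z. (\<integral>w. (\<integral>z'. (\<integral>w'.
      h (x + (s * z + s * z')) (y + \<rho> * (s * z + s * z') + (s * r * w + s * r * w'))
      \<partial>std_gaussian) \<partial>std_gaussian) \<partial>std_gaussian) \<partial>std_gaussian)"
    unfolding heat2_def s_def r_def by (simp add: algebra_simps)
  also have "\<dots> = (\<integral>z. (\<integral>z'. (\<integral>w. (\<integral>w'.
      h (x + (s * z + s * z')) (y + \<rho> * (s * z + s * z') + (s * r * w + s * r * w'))
      \<partial>std_gaussian) \<partial>std_gaussian) \<partial>std_gaussian) \<partial>std_gaussian)"
    by (intro Bochner_Integration.integral_cong refl gaussian_fubini[where C=C])
       (auto intro!: ibd)
  also have "\<dots> = (\<integral>z. (\<integral>z'. (\<integral>w.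
      h (x + (s * z + s * z')) (y + \<rho> * (s * z + s * z') + sqrt ((s * r)\<^sup>2 + (s * r)\<^sup>2) * w)
      \<partial>std_gaussian) \<partial>std_gaussian) \<partial>std_gaussian)"
    by (intro Bochner_Integration.integral_cong refl
        gaussian_convolution[where C=C and f="\<lambda>q. h (_ z z') (_ z z' + q)" for z z'])
       (auto simp: bd)
  also have "\<dots> = (\<integral>z. (\<integral>w.
      h (x + sqrt (s\<^sup>2 + s\<^sup>2) * z) (y + \<rho> * (sqrt (s\<^sup>2 + s\<^sup>2) * z) + sqrt ((s * r)\<^sup>2 + (s * r)\<^sup>2) * w)
      \<partial>std_gaussian) \<partial>std_gaussian)"
    by (rule gaussian_convolution[where C=C and f="\<lambda>q. (\<integral>w. h (x + q) (y + \<rho> * q + sqrt ((s * r)\<^sup>2 + (s * r)\<^sup>2) * w) \<partial>std_gaussian)"])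
       (auto intro!: ibd)
  also have "\<dots> = heat2 \<rho> (2 * t) h x y"
  proof -
    have "sqrt (s\<^sup>2 + s\<^sup>2) = sqrt (2 * t)" using t by (simp add: s_def)
    moreover have "sqrt ((s * r)\<^sup>2 + (s * r)\<^sup>2) = sqrt (2 * t) * r"
    proof -
      have "(s * r)\<^sup>2 + (s * r)\<^sup>2 = (2 * t) * r\<^sup>2" using t by (simp add: s_def power_mult_distrib)
      moreover have "0 \<le> r" using \<rho> by (simp add: r_def)
      ultimately show ?thesis by (simp add: real_sqrt_mult)
    qed
    ultimately show ?thesis
      unfolding heat2_def r_def by (simp add: algebra_simps)
  qed
  finally show ?thesis .
qed

text \<open>A quantitative form of being continuously differentiable with Lipschitz derivative.  The constants do not
deteriorate under the heat semigroup, which makes the error of one step uniform along the doubling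
argument.\<close>

definition smooth_between :: "real \<Rightarrow> real \<Rightarrow> real \<Rightarrow> (real \<Rightarrow> real) \<Rightarrow> bool" where
  "smooth_between c C L f \<longleftrightarrow> f \<in> borel_measurable borel \<and> (\<forall>x. c \<le> f x \<and> f x \<le> C) \<and>
     (\<exists>f'. f' \<in> borel_measurable borel \<and> (\<forall>x. \<bar>f' x\<bar> \<le> L) \<and>
        (\<forall>x h. \<bar>f (x + h) - f x - f' x * h\<bar> \<le> L * h\<^sup>2))"

lemma smooth_between_heat:
  assumes "smooth_between c C L f"
  shows "smooth_between c C L (heat t f)"
proof -
  from assms obtain f' where [measurable]: "f \<in> borel_measurable borel" "f' \<in> borel_measurable borel"
    and bd: "\<And>x. c \<le> f x" "\<And>x. f x \<le> C" and bd': "\<And>x. \<bar>f' x\<bar> \<le> L"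
    and T: "\<And>x h. \<bar>f (x + h) - f x - f' x * h\<bar> \<le> L * h\<^sup>2"
    unfolding smooth_between_def by blast
  have i: "integrable std_gaussian (\<lambda>z. f (x + sqrt t * z))" for x
  proof (rule integrable_std_gaussian_bounded)
    show "\<bar>f (x + sqrt t * z)\<bar> \<le> \<bar>c\<bar> + \<bar>C\<bar>" for z
      using bd[of "x + sqrt t * z"] by linarith
  qed simp
  have i': "integrable std_gaussian (\<lambda>z. f' (x + sqrt t * z))" for x
    by (rule integrable_std_gaussian_bounded[of _ L]) (use bd' in auto)
  show ?thesis
    unfolding smooth_between_def
  proof (intro conjI allI exI[of _ "heat t f'"])
    show "c \<le> heat t f x" "heat t f x \<le> C" for x using heat_bounds[of f c C] bd by auto
    show "\<bar>heat t f' x\<bar> \<le> L" for x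
      using heat_bounds[of f' "- L" L] bd' by (auto simp: abs_le_iff minus_le_iff)
    show "\<bar>heat t f (x + h) - heat t f x - heat t f' x * h\<bar> \<le> L * h\<^sup>2" for x h
    proof -
      have "heat t f (x + h) - heat t f x - heat t f' x * h =
          (\<integral>z. f ((x + sqrt t * z) + h) - f (x + sqrt t * z) - f' (x + sqrt t * z) * h \<partial>std_gaussian)"
        unfolding heat_def using i[of x] i'[of x] i[of "x + h"] by (simp add: ac_simps)
      also have "\<bar>\<dots>\<bar> \<le> L * h\<^sup>2"
        by (rule gaussian_integral_abs_le) (use T in auto)
      finally show ?thesis .
    qed
  qed measurable
qed

lemma exp_rest_bound:
  fixes y :: real
  assumes "0 \<le> y" "y \<le> 1"
  shows "exp y - 1 - y \<le> y\<^sup>2"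
  using exp_bound[of y] assms by simp

text \<open>The derivative of the heat flow and its Taylor remainder are read off from \<open>gaussian_taylor\<close> with two terms,
so boundedness of \<open>f\<close> suffices.\<close>

lemma smooth_between_mollify:
  fixes f :: "real \<Rightarrow> real"
  assumes [measurable]: "f \<in> borel_measurable borel" and bd: "\<And>x. c \<le> f x" "\<And>x. f x \<le> C"
    and c: "0 < c" and \<eta>: "0 < \<eta>" "\<eta> \<le> 1"
  shows "smooth_between c C (2 * C / \<eta>) (heat \<eta> f)"
proof -
  define s where "s = sqrt \<eta>"
  have s: "0 < s" "s \<le> 1" "s\<^sup>2 = \<eta>" using \<eta> by (auto simp: s_def)
  have abd: "\<bar>f x\<bar> \<le> C" for x using bd[of x] c by simp
  have C: "0 < C" using bd[of 0] c by simp
  define D where "D x = (1 / s) * (\<integral>z. f (x + s * z) * z \<partial>std_gaussian)" for x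
  have [measurable]: "D \<in> borel_measurable borel" unfolding D_def by measurable
  have abs1: "(\<integral>z. \<bar>z\<bar> \<partial>std_gaussian) \<le> 1"
  proof -
    have "(\<integral>z. \<bar>z\<bar> \<partial>std_gaussian)\<^sup>2 \<le> (\<integral>z. \<bar>z\<bar>\<^sup>2 \<partial>std_gaussian)"
      by (rule gauss.square_expectation_le) (auto intro!: expgrowth_integrable expgrowth_power)
    also have "\<dots> = 1" using hermite_orthogonal[of 1 1] by (simp add: power2_eq_square)
    finally show ?thesis by (simp add: abs_square_le_1)
  qed
  have Ib: "\<bar>\<integral>z. f (x + s * z) * z \<partial>std_gaussian\<bar> \<le> C" for x
  proof -
    have e: "expgrowth (\<lambda>z. f (x + s * z))" using abd by (intro expgrowth_bounded[of _ C]) auto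
    have "\<bar>\<integral>z. f (x + s * z) * z \<partial>std_gaussian\<bar> \<le> (\<integral>z. \<bar>f (x + s * z) * z\<bar> \<partial>std_gaussian)"
      by (rule integral_abs_bound)
    also have "\<dots> \<le> (\<integral>z. C * \<bar>z\<bar> \<partial>std_gaussian)"
    proof (rule integral_mono)
      show "\<bar>f (x + s * z) * z\<bar> \<le> C * \<bar>z\<bar>" for z
        unfolding abs_mult using abd by (intro mult_right_mono) auto
    qed (intro expgrowth_integrable expgrowth_abs expgrowth_mult[OF e] expgrowth_mult[OF expgrowth_const] expgrowth_ident)+
    also have "\<dots> \<le> C * 1" using abs1 C by simp
    finally show ?thesis by simp
  qed
  have "\<bar>D x\<bar> \<le> 2 * C / \<eta>" for x
  proof -
    have "\<bar>D x\<bar> \<le> (1 / s) * C" unfolding D_def abs_mult using Ib[of x] s by (intro mult_mono) auto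
    also have "\<dots> \<le> (2 / \<eta>) * C"
    proof (rule mult_right_mono)
      have "s * s \<le> s" using s(1,2) by (simp add: mult_left_le)
      then have "\<eta> \<le> s * 2" using s(1,3) unfolding power2_eq_square by linarith
      then show "1 / s \<le> 2 / \<eta>" using s \<eta> by (simp add: field_simps power2_eq_square)
    qed (use C in simp)
    finally show ?thesis by simp
  qed
  moreover have "\<bar>heat \<eta> f (x + h) - heat \<eta> f x - D x * h\<bar> \<le> 2 * C / \<eta> * h\<^sup>2" for x h
  proof -
    define k where "k = h / s"
    have k: "h = s * k" and k2: "k\<^sup>2 = h\<^sup>2 / \<eta>" using s by (auto simp: k_def power_divide)
    have eq: "heat \<eta> f (x + h) - heat \<eta> f x - D x * h =
       (\<integral>z. f (x + s * (z + k)) \<partial>std_gaussian) -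
       (\<Sum>j<2. k ^ j / fact j * (\<integral>z. f (x + s * z) * hermite j z \<partial>std_gaussian))"
      using s by (simp add: numeral_2_eq_2 heat_def D_def k algebra_simps flip: s_def)
    \<comment> \<open>For small shifts the Taylor remainder is quadratic; for large ones the trivial bound is.\<close>
    have main: "\<bar>heat \<eta> f (x + h) - heat \<eta> f x - D x * h\<bar> \<le> 2 * C * k\<^sup>2"
    proof (cases "k\<^sup>2 \<le> 1")
      case True
      have "\<bar>heat \<eta> f (x + h) - heat \<eta> f x - D x * h\<bar> \<le> C * sqrt (exp (k\<^sup>2) - (\<Sum>j<2. (k\<^sup>2) ^ j / fact j))"
        unfolding eq by (rule gaussian_taylor[where f="\<lambda>z. f (x + s * z)"]) (use abd in auto)
      also have "\<dots> = C * sqrt (exp (k\<^sup>2) - 1 - k\<^sup>2)" by (simp add: numeral_2_eq_2)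
      also have "\<dots> \<le> C * sqrt ((k\<^sup>2)\<^sup>2)"
        using exp_rest_bound[of "k\<^sup>2"] True C by (intro mult_left_mono real_sqrt_le_mono) auto
      also have "\<dots> = C * k\<^sup>2" by (simp only: real_sqrt_abs) simp
      also have "\<dots> \<le> 2 * C * k\<^sup>2" using C by simp
      finally show ?thesis .
    next
      case False
      have "1 \<le> \<bar>k\<bar>" using False by (simp add: abs_square_le_1 not_le less_imp_le)
      then have 1: "1 + \<bar>k\<bar> \<le> 2 * k\<^sup>2" using False mult_left_mono[of 1 "\<bar>k\<bar>" "\<bar>k\<bar>"] by (simp add: power2_eq_square)
      have "\<bar>D x * h\<bar> \<le> \<bar>k\<bar> * C"
        using mult_left_mono[OF Ib[of x], of "\<bar>k\<bar>"] s by (simp add: D_def k abs_mult ac_simps)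
      moreover have "\<bar>heat \<eta> f (x + h) - heat \<eta> f x\<bar> \<le> C"
        using heat_bounds[of f c C \<eta> x] heat_bounds[of f c C \<eta> "x + h"] bd c by auto
      ultimately have "\<bar>heat \<eta> f (x + h) - heat \<eta> f x - D x * h\<bar> \<le> C * (1 + \<bar>k\<bar>)"
        by (simp add: algebra_simps abs_le_iff)
      also have "\<dots> \<le> C * (2 * k\<^sup>2)" using 1 C by (intro mult_left_mono) auto
      finally show ?thesis by simp
    qed
    then show ?thesis by (simp add: k2)
  qed
  ultimately show ?thesis
    unfolding smooth_between_def using heat_bounds[of f c C] bd
    by (intro conjI allI exI[of _ D]) auto
qed

lemma mult_le_of_abs_le:
  fixes c x :: real
  assumes "\<bar>c\<bar> \<le> 1" "\<bar>x\<bar> \<le> M"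
  shows "c * x \<le> M"
proof -
  have "\<bar>c * x\<bar> \<le> 1 * M" unfolding abs_mult using assms by (intro mult_mono) auto
  then show ?thesis by simp
qed

text \<open>All terms of order at least three in the product are collected into the error.\<close>

lemma quadratic_product_bound:
  fixes a b k l \<alpha> \<beta> D e :: real
  assumes c: "\<bar>\<alpha>\<bar> \<le> 1" "\<bar>\<beta>\<bar> \<le> 1" "\<bar>k\<bar> \<le> 1" "\<bar>l\<bar> \<le> 1"
    and D: "\<bar>a\<bar> \<le> D" "\<bar>b\<bar> \<le> D" and e: "\<bar>a\<bar> \<le> e" "\<bar>b\<bar> \<le> e"
  shows "(1 + \<alpha> * a - k * a\<^sup>2 + \<bar>a\<bar> ^ 3) * (1 + \<beta> * b - l * b\<^sup>2 + \<bar>b\<bar> ^ 3) \<le>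
    1 + \<alpha> * a + \<beta> * b - k * a\<^sup>2 + \<alpha> * \<beta> * (a * b) - l * b\<^sup>2 + 4 * (1 + D) ^ 3 * e ^ 3"
proof -
  define A B where "A = \<bar>a\<bar>" and "B = \<bar>b\<bar>"
  have nn: "0 \<le> A" "0 \<le> B" "0 \<le> D" "0 \<le> e" using D e by (auto simp: A_def B_def)
  have AB: "A \<le> D" "B \<le> D" "A \<le> e" "B \<le> e" using D e by (auto simp: A_def B_def)
  have cc: "\<bar>x * y\<bar> \<le> 1" if "\<bar>x\<bar> \<le> 1" "\<bar>y\<bar> \<le> 1" for x y :: real
    unfolding abs_mult using that by (intro mult_le_one) auto
  have e3: "x * y * z \<le> e ^ 3" if "0 \<le> x" "0 \<le> y" "0 \<le> z" "x \<le> e" "y \<le> e" "z \<le> e" for x y z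
    unfolding power3_eq_cube using that by (intro mult_mono mult_nonneg_nonneg) auto
  have Ae: "A * A * A \<le> e ^ 3" "B * B * B \<le> e ^ 3" "A * B * B \<le> e ^ 3" "A * A * B \<le> e ^ 3"
    using nn AB by (intro e3; simp)+
  have DD: "x * y \<le> D * e ^ 3" if "0 \<le> x" "0 \<le> y" "x \<le> D" "y \<le> e ^ 3" for x y
    using that nn by (intro mult_mono) auto
  have D2: "x * (y * z) \<le> D * (D * e ^ 3)" if "0 \<le> x" "0 \<le> y" "0 \<le> z" "x \<le> D" "y \<le> D" "z \<le> e ^ 3" for x y z
    using that nn by (intro mult_mono DD mult_nonneg_nonneg) auto
  have D3: "v * (x * (y * z)) \<le> D * (D * (D * e ^ 3))"
    if "0 \<le> v" "0 \<le> x" "0 \<le> y" "0 \<le> z" "v \<le> D" "x \<le> D" "y \<le> D" "z \<le> e ^ 3" for v x y z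
    using that nn by (intro mult_mono[of v D] D2 mult_nonneg_nonneg) auto
  define R where "R = - (\<alpha> * l) * (a * b * b) + \<alpha> * (a * (B * B * B)) + - (k * \<beta>) * (a * a * b) + (k * l) * (a * (a * b * b))
      + - k * (a * (a * (B * B * B))) + A * A * A + \<beta> * (b * (A * A * A)) + - l * (b * (b * (A * A * A)))
      + B * (B * (B * (A * A * A))) + B * B * B"
  have t1: "- (\<alpha> * l) * (a * b * b) \<le> e ^ 3"
    by (rule mult_le_of_abs_le) (use cc[OF c(1) c(4)] Ae in \<open>auto simp: abs_mult A_def B_def\<close>)
  have t2: "\<alpha> * (a * (B * B * B)) \<le> D * e ^ 3"
    using DD[of A "B * B * B"] nn AB Ae by (intro mult_le_of_abs_le c) (auto simp: abs_mult A_def B_def)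
  have t3: "- (k * \<beta>) * (a * a * b) \<le> e ^ 3"
    by (rule mult_le_of_abs_le) (use cc[OF c(3) c(2)] Ae in \<open>auto simp: abs_mult A_def B_def\<close>)
  have t4: "(k * l) * (a * (a * b * b)) \<le> D * e ^ 3"
    using DD[of A "A * B * B"] nn AB Ae cc[OF c(3) c(4)] by (intro mult_le_of_abs_le) (auto simp: abs_mult A_def B_def)
  have t5: "- k * (a * (a * (B * B * B))) \<le> D * (D * e ^ 3)"
    using D2[of A A "B * B * B"] nn AB Ae c by (intro mult_le_of_abs_le) (auto simp: abs_mult A_def B_def)
  have t6: "\<beta> * (b * (A * A * A)) \<le> D * e ^ 3"
    using DD[of B "A * A * A"] nn AB Ae by (intro mult_le_of_abs_le c) (auto simp: abs_mult A_def B_def)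
  have t7: "- l * (b * (b * (A * A * A))) \<le> D * (D * e ^ 3)"
    using D2[of B B "A * A * A"] nn AB Ae c by (intro mult_le_of_abs_le) (auto simp: abs_mult A_def B_def)
  have t8: "B * (B * (B * (A * A * A))) \<le> D * (D * (D * e ^ 3))"
    using D3[of B B B "A * A * A"] nn AB Ae by auto
  have "R \<le> e ^ 3 + D * e ^ 3 + e ^ 3 + D * e ^ 3 + D * (D * e ^ 3) + e ^ 3 + D * e ^ 3 + D * (D * e ^ 3)
      + D * (D * (D * e ^ 3)) + e ^ 3"
    unfolding R_def by (intro add_mono t1 t2 t3 t4 t5 t6 t7 t8 Ae(1,2))
  also have "\<dots> = (4 + 3 * D + 2 * (D * D) + D * D * D) * e ^ 3" by (simp add: algebra_simps)
  also have "\<dots> \<le> 4 * (1 + D) ^ 3 * e ^ 3"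
    using nn by (intro mult_right_mono) (simp_all add: power3_eq_cube algebra_simps)
  finally have R: "R \<le> 4 * (1 + D) ^ 3 * e ^ 3" .
  have "(1 + \<alpha> * a - k * a\<^sup>2 + \<bar>a\<bar> ^ 3) * (1 + \<beta> * b - l * b\<^sup>2 + \<bar>b\<bar> ^ 3) =
    1 + \<alpha> * a + \<beta> * b - k * a\<^sup>2 + \<alpha> * \<beta> * (a * b) - l * b\<^sup>2 + R"
    unfolding A_def[symmetric] B_def[symmetric] R_def by (simp add: power2_eq_square power3_eq_cube algebra_simps)
  then show ?thesis using R by simp
qed

lemma mult_approx:
  fixes a b x y :: real
  assumes "\<bar>a - x\<bar> \<le> d" "\<bar>b - y\<bar> \<le> d" "\<bar>b\<bar> \<le> 2 * M" "\<bar>x\<bar> \<le> M"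
  shows "\<bar>a * b - x * y\<bar> \<le> 3 * (M * d)"
proof -
  have "a * b - x * y = (a - x) * b + x * (b - y)" by (simp add: algebra_simps)
  then have "\<bar>a * b - x * y\<bar> \<le> \<bar>a - x\<bar> * \<bar>b\<bar> + \<bar>x\<bar> * \<bar>b - y\<bar>"
    using abs_triangle_ineq[of "(a - x) * b" "x * (b - y)"] by (simp add: abs_mult)
  also have "\<dots> \<le> d * (2 * M) + M * d"
    using assms by (intro add_mono mult_mono) auto
  finally show ?thesis by (simp add: algebra_simps)
qed

text \<open>The variables \<open>a\<close> and \<open>b\<close> are relative increments over a heat step of length \<open>s\<^sup>2\<close>, with linear parts
\<open>s * A * z\<close> and \<open>s * B * z'\<close>.  Expanding both powers keeps the linear terms exactly, because their Gaussian
means vanish exactly, and replaces the increments by their linear parts in the quadratic terms at a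
cost of order \<open>s ^ 3\<close>.\<close>

lemma powr_product_taylor_bound:
  fixes a b A B z z' s m R D \<alpha> \<beta> :: real
  assumes \<alpha>: "0 < \<alpha>" "\<alpha> < 1" and \<beta>: "0 < \<beta>" "\<beta> < 1"
    and s: "0 < s" "s \<le> 1" and m: "1 \<le> m" "\<bar>z\<bar> \<le> m" "\<bar>z'\<bar> \<le> m" and R: "0 \<le> R"
    and A: "\<bar>A\<bar> \<le> R" and B: "\<bar>B\<bar> \<le> R"
    and a: "- 1 < a" "\<bar>a\<bar> \<le> D" "\<bar>a\<bar> \<le> 2 * (R * s * m)" "\<bar>a - s * A * z\<bar> \<le> R * s\<^sup>2 * m"
    and b: "- 1 < b" "\<bar>b\<bar> \<le> D" "\<bar>b\<bar> \<le> 2 * (R * s * m)" "\<bar>b - s * B * z'\<bar> \<le> R * s\<^sup>2 * m"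
  shows "(1 + a) powr \<alpha> * (1 + b) powr \<beta> \<le> 1 + \<alpha> * a + \<beta> * b +
    s\<^sup>2 * (\<alpha> * \<beta> * A * B * (z * z') - \<alpha> * (1 - \<alpha>) / 2 * A\<^sup>2 * z\<^sup>2 - \<beta> * (1 - \<beta>) / 2 * B\<^sup>2 * z'\<^sup>2)
    + (32 * (1 + D) ^ 3 * R ^ 3 + 9 * R\<^sup>2) * s ^ 3 * m ^ 3"
proof -
  define k where "k = \<alpha> * (1 - \<alpha>) / 2"
  define l where "l = \<beta> * (1 - \<beta>) / 2"
  have k1: "\<bar>k\<bar> \<le> 1" using \<alpha> mult_le_one[of \<alpha> "1 - \<alpha>"] by (simp add: k_def)
  have l1: "\<bar>l\<bar> \<le> 1" using \<beta> mult_le_one[of \<beta> "1 - \<beta>"] by (simp add: l_def)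
  have ab1: "\<bar>\<alpha> * \<beta>\<bar> \<le> 1" using \<alpha> \<beta> mult_le_one[of \<alpha> \<beta>] by simp
  have pa: "(1 + a) powr \<alpha> \<le> 1 + \<alpha> * a - k * a\<^sup>2 + \<bar>a\<bar> ^ 3"
    unfolding k_def by (rule powr_taylor_upper) (use \<alpha> a in auto)
  have pb: "(1 + b) powr \<beta> \<le> 1 + \<beta> * b - l * b\<^sup>2 + \<bar>b\<bar> ^ 3"
    unfolding l_def by (rule powr_taylor_upper) (use \<beta> b in auto)
  have "(1 + a) powr \<alpha> * (1 + b) powr \<beta> \<le> (1 + \<alpha> * a - k * a\<^sup>2 + \<bar>a\<bar> ^ 3) * (1 + \<beta> * b - l * b\<^sup>2 + \<bar>b\<bar> ^ 3)"
    by (intro mult_mono pa pb powr_ge_zero order_trans[OF powr_ge_zero pa])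
  also have "\<dots> \<le> 1 + \<alpha> * a + \<beta> * b - k * a\<^sup>2 + \<alpha> * \<beta> * (a * b) - l * b\<^sup>2 + 4 * (1 + D) ^ 3 * (2 * (R * s * m)) ^ 3"
    by (rule quadratic_product_bound) (use \<alpha> \<beta> k1 l1 a b in auto)
  finally have 1: "(1 + a) powr \<alpha> * (1 + b) powr \<beta> \<le>
     1 + \<alpha> * a + \<beta> * b - k * a\<^sup>2 + \<alpha> * \<beta> * (a * b) - l * b\<^sup>2 + 4 * (1 + D) ^ 3 * (2 * (R * s * m)) ^ 3" .
  have x: "\<bar>s * A * z\<bar> \<le> R * s * m" "\<bar>s * B * z'\<bar> \<le> R * s * m"
  proof -
    have "s * (\<bar>A\<bar> * \<bar>z\<bar>) \<le> s * (R * m)" "s * (\<bar>B\<bar> * \<bar>z'\<bar>) \<le> s * (R * m)"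
      using s A B m R by (intro mult_left_mono mult_mono; simp)+
    then show "\<bar>s * A * z\<bar> \<le> R * s * m" "\<bar>s * B * z'\<bar> \<le> R * s * m"
      using s by (auto simp: abs_mult ac_simps)
  qed
  define Q where "Q = 3 * (R * s * m * (R * s\<^sup>2 * m))"
  have q: "- k * (a * a - s * A * z * (s * A * z)) \<le> Q" "- l * (b * b - s * B * z' * (s * B * z')) \<le> Q"
     "\<alpha> * \<beta> * (a * b - s * A * z * (s * B * z')) \<le> Q"
    unfolding Q_def
    by (rule mult_le_of_abs_le[OF _ mult_approx[OF a(4) a(4) a(3) x(1)]]
             mult_le_of_abs_le[OF _ mult_approx[OF b(4) b(4) b(3) x(2)]]
             mult_le_of_abs_le[OF _ mult_approx[OF a(4) b(4) b(3) x(1)]],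
        simp add: k1 l1 ab1)+
  have Q: "3 * Q \<le> 9 * R\<^sup>2 * s ^ 3 * m ^ 3"
  proof -
    have "9 * R\<^sup>2 * s ^ 3 * m\<^sup>2 \<le> 9 * R\<^sup>2 * s ^ 3 * m ^ 3"
      using m s by (intro mult_left_mono power_increasing) auto
    then show ?thesis by (simp add: Q_def power2_eq_square power3_eq_cube algebra_simps)
  qed
  define S where "S = s\<^sup>2 * (\<alpha> * \<beta> * A * B * (z * z') - k * A\<^sup>2 * z\<^sup>2 - l * B\<^sup>2 * z'\<^sup>2)"
  have "- k * a\<^sup>2 + \<alpha> * \<beta> * (a * b) - l * b\<^sup>2 = - k * (a * a - s * A * z * (s * A * z))
      + - l * (b * b - s * B * z' * (s * B * z')) + \<alpha> * \<beta> * (a * b - s * A * z * (s * B * z')) + S"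
    unfolding S_def by algebra
  also have "\<dots> \<le> Q + Q + Q + S" by (intro add_mono q order_refl)
  finally have 2: "- k * a\<^sup>2 + \<alpha> * \<beta> * (a * b) - l * b\<^sup>2 \<le> 3 * Q + S" by simp
  have 3: "4 * (1 + D) ^ 3 * (2 * (R * s * m)) ^ 3 + 9 * R\<^sup>2 * s ^ 3 * m ^ 3
    = (32 * (1 + D) ^ 3 * R ^ 3 + 9 * R\<^sup>2) * s ^ 3 * m ^ 3"
    unfolding power_mult_distrib distrib_right by simp
  define V where "V = 4 * (1 + D) ^ 3 * (2 * (R * s * m)) ^ 3"
  define W where "W = 9 * R\<^sup>2 * s ^ 3 * m ^ 3"
  define U where "U = (1 + a) powr \<alpha> * (1 + b) powr \<beta>"
  define a2 b2 ab where "a2 = k * a\<^sup>2" and "b2 = l * b\<^sup>2" and "ab = \<alpha> * \<beta> * (a * b)"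
  define a1 b1 where "a1 = \<alpha> * a" and "b1 = \<beta> * b"
  have "U \<le> 1 + a1 + b1 - a2 + ab - b2 + V" using 1 by (simp only: U_def V_def a1_def b1_def a2_def b2_def ab_def)
  moreover have "- a2 + ab - b2 \<le> 3 * Q + S" using 2 by (simp only: a2_def b2_def ab_def mult_minus_left)
  moreover have "3 * Q \<le> W" using Q by (simp only: W_def)
  ultimately have "U \<le> 1 + a1 + b1 + S + (V + W)" by linarith
  then show ?thesis unfolding 3[symmetric] U_def V_def W_def a1_def b1_def S_def k_def l_def .
qed

abbreviation gauss2 :: "(real \<times> real) measure" where
  "gauss2 \<equiv> std_gaussian \<Otimes>\<^sub>M std_gaussian"

interpretation gauss2: pair_prob_space std_gaussian std_gaussian ..

lemma gauss2_integrable: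
  fixes h :: "real \<times> real \<Rightarrow> real"
  assumes [measurable]: "h \<in> borel_measurable (borel \<Otimes>\<^sub>M borel)"
    and f: "expgrowth f" and g: "expgrowth g"
    and bd: "\<And>z w. \<bar>h (z, w)\<bar> \<le> f z * g w"
  shows "integrable gauss2 h"
proof (rule Bochner_Integration.integrable_bound)
  have [measurable]: "f \<in> borel_measurable borel" "g \<in> borel_measurable borel"
    using f g by (auto simp: expgrowth_measurable)
  show "integrable gauss2 (\<lambda>p. f (fst p) * g (snd p))"
  proof (rule gauss2.Fubini_integrable)
    have "(\<lambda>x. \<integral>y. norm (f (fst (x, y)) * g (snd (x, y))) \<partial>std_gaussian) = (\<lambda>x. \<bar>f x\<bar> * (\<integral>y. \<bar>g y\<bar> \<partial>std_gaussian))"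
      by (simp add: abs_mult)
    then show "integrable std_gaussian (\<lambda>x. \<integral>y. norm (f (fst (x, y)) * g (snd (x, y))) \<partial>std_gaussian)"
      using expgrowth_integrable[OF f] by simp
    show "AE x in std_gaussian. integrable std_gaussian (\<lambda>y. f (fst (x, y)) * g (snd (x, y)))"
      using expgrowth_integrable[OF g] by simp
  qed measurable
  show "AE p in gauss2. norm (h p) \<le> norm (f (fst p) * g (snd p))"
    using bd by (intro AE_I2) (auto simp: abs_le_iff intro: order_trans[OF _ abs_ge_self])
qed simp

lemma gauss2_integrable_product:
  assumes f: "expgrowth f" and g: "expgrowth g"
  shows "integrable gauss2 (\<lambda>p. f (fst p) * g (snd p))"
    and "(\<integral>p. f (fst p) * g (snd p) \<partial>gauss2) = integral\<^sup>L std_gaussian f * integral\<^sup>L std_gaussian g"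
proof -
  have [measurable]: "f \<in> borel_measurable borel" "g \<in> borel_measurable borel"
    using f g by (auto simp: expgrowth_measurable)
  show i: "integrable gauss2 (\<lambda>p. f (fst p) * g (snd p))"
    by (rule gauss2_integrable[OF _ expgrowth_abs[OF f] expgrowth_abs[OF g]]) (auto simp: abs_mult)
  show "(\<integral>p. f (fst p) * g (snd p) \<partial>gauss2) = integral\<^sup>L std_gaussian f * integral\<^sup>L std_gaussian g"
    using gauss2.integral_fst'[OF i] by simp
qed

text \<open>The relative increment \<open>a\<close> of \<open>f\<close> around its average \<open>heat t f x\<close> has mean zero and is linear in the Gaussian
variable up to an error of order \<open>t\<close>.\<close>

lemma heat_increment_expansion:
  assumes f: "smooth_between c C L f" and c: "0 < c" and t: "0 < t" "t \<le> 1"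
  obtains A a where "a \<in> borel_measurable borel" "\<bar>A\<bar> \<le> L / c" "\<And>z. f (x + sqrt t * z) = heat t f x * (1 + a z)"
    "\<And>z. - 1 < a z" "\<And>z. \<bar>a z\<bar> \<le> C / c" "(\<integral>z. a z \<partial>std_gaussian) = 0"
    "\<And>z. \<bar>a z\<bar> \<le> 2 * (L / c * sqrt t * (1 + z\<^sup>2))"
    "\<And>z. \<bar>a z - sqrt t * A * z\<bar> \<le> L / c * (sqrt t)\<^sup>2 * (1 + z\<^sup>2)"
proof -
  from f obtain f' where [measurable]: "f \<in> borel_measurable borel" "f' \<in> borel_measurable borel"
    and bd: "\<And>x. c \<le> f x" "\<And>x. f x \<le> C" and bd': "\<And>x. \<bar>f' x\<bar> \<le> L"
    and T: "\<And>x h. \<bar>f (x + h) - f x - f' x * h\<bar> \<le> L * h\<^sup>2"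
    unfolding smooth_between_def by blast
  define s where "s = sqrt t"
  define u where "u = heat t f x"
  have s: "0 < s" "s \<le> 1" using t by (auto simp: s_def)
  have u: "c \<le> u" "u \<le> C" "0 < u" using heat_bounds[of f c C] bd c by (auto simp: u_def intro: less_le_trans)
  have L: "0 \<le> L" using bd'[of 0] by simp
  have abd: "\<bar>f z\<bar> \<le> C" for z using bd[of z] c by simp
  have i: "expgrowth (\<lambda>z. f (x + s * z))"
    by (rule expgrowth_bounded[of _ C]) (use abd in auto)
  have z2: "(\<integral>z. z\<^sup>2 \<partial>std_gaussian) = 1" using hermite_orthogonal[of 1 1] by (simp add: power2_eq_square)
  have z1: "(\<integral>z. z \<partial>std_gaussian) = 0" using hermite_orthogonal[of 1 0] by simp
  have iz: "integrable std_gaussian (\<lambda>z. z)" by (intro expgrowth_integrable expgrowth_ident)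
  have iz2: "integrable std_gaussian (\<lambda>z. z\<^sup>2)" by (intro expgrowth_integrable expgrowth_power expgrowth_ident)
  have "u - f x = (\<integral>z. f (x + s * z) - f x - f' x * (s * z) \<partial>std_gaussian)"
    using expgrowth_integrable[OF i] iz z1 gauss.prob_space by (simp add: u_def heat_def s_def)
  also have "\<bar>\<dots>\<bar> \<le> (\<integral>z. \<bar>f (x + s * z) - f x - f' x * (s * z)\<bar> \<partial>std_gaussian)"
    by (rule integral_abs_bound)
  also have "\<dots> \<le> (\<integral>z. L * s\<^sup>2 * z\<^sup>2 \<partial>std_gaussian)"
  proof (rule integral_mono)
    show "\<bar>f (x + s * z) - f x - f' x * (s * z)\<bar> \<le> L * s\<^sup>2 * z\<^sup>2" for z
      using T[of x "s * z"] by (simp add: power_mult_distrib ac_simps)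
    show "integrable std_gaussian (\<lambda>z. \<bar>f (x + s * z) - f x - f' x * (s * z)\<bar>)"
      by (intro integrable_abs Bochner_Integration.integrable_diff integrable_mult_right iz
          expgrowth_integrable[OF i]) auto
  qed (use iz2 in simp)
  finally have ux: "\<bar>u - f x\<bar> \<le> L * s\<^sup>2" by (simp add: z2)
  define a where "a z = f (x + s * z) / u - 1" for z
  define A where "A = f' x / u"
  have r1: "\<bar>f (x + s * z) - u - f' x * (s * z)\<bar> \<le> L * s\<^sup>2 * (1 + z\<^sup>2)" for z
    using T[of x "s * z"] ux by (simp add: power_mult_distrib algebra_simps)
  have divle: "\<bar>q / u\<bar> \<le> M / c" if "\<bar>q\<bar> \<le> M" for q M
    using that u c by (simp add: abs_divide) (rule frac_le, auto)
  have d1: "\<bar>a z - s * A * z\<bar> \<le> L / c * s\<^sup>2 * (1 + z\<^sup>2)" for z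
  proof -
    have "a z - s * A * z = (f (x + s * z) - u - f' x * (s * z)) / u"
      using u by (simp add: a_def A_def field_simps)
    with divle[OF r1[of z]] show ?thesis by simp
  qed
  have A: "\<bar>A\<bar> \<le> L / c" unfolding A_def by (rule divle) (rule bd')
  have d2: "\<bar>a z\<bar> \<le> 2 * (L / c * s * (1 + z\<^sup>2))" for z
  proof -
    have "\<bar>z\<bar> \<le> 1 + z\<^sup>2"
      using zero_le_power2[of "\<bar>z\<bar> - 1"] by (simp add: power2_diff)
    then have "s * (\<bar>A\<bar> * \<bar>z\<bar>) \<le> s * (L / c * (1 + z\<^sup>2))"
      using s A c L by (intro mult_left_mono mult_mono) auto
    then have "\<bar>s * A * z\<bar> \<le> L / c * s * (1 + z\<^sup>2)" using s by (simp add: abs_mult ac_simps)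
    moreover have "L / c * (s * s) * (1 + z\<^sup>2) \<le> L / c * (s * 1) * (1 + z\<^sup>2)"
      using s L c by (intro mult_right_mono mult_left_mono) auto
    ultimately show ?thesis using d1[of z] by (simp add: power2_eq_square)
  qed
  show thesis
  proof (rule that[of a A])
    show "a \<in> borel_measurable borel" unfolding a_def by measurable
    show "\<bar>A\<bar> \<le> L / c" by (rule A)
    show "f (x + sqrt t * z) = heat t f x * (1 + a z)" for z
      using u by (simp add: a_def flip: s_def u_def)
    show "- 1 < a z" for z using u bd[of "x + s * z"] c by (simp add: a_def)
    show "\<bar>a z\<bar> \<le> C / c" for z
    proof -
      have "0 \<le> f (x + s * z) / u" "f (x + s * z) / u \<le> C / c" "1 \<le> C / c"
        using u c bd[of "x + s * z"] by (auto intro!: frac_le divide_nonneg_pos)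
      then show ?thesis by (simp add: a_def)
    qed
    show "(\<integral>z. a z \<partial>std_gaussian) = 0"
      using expgrowth_integrable[OF i] gauss.prob_space u
      by (simp add: a_def u_def[unfolded heat_def, folded s_def, symmetric])
  qed (use d1 d2 in \<open>simp_all add: s_def\<close>)
qed

text \<open>Completing the square.\<close>

lemma quadratic_form_nonneg:
  fixes k l \<mu> A B :: real
  assumes "0 < k" "\<mu>\<^sup>2 \<le> 4 * k * l"
  shows "\<mu> * A * B \<le> k * A\<^sup>2 + l * B\<^sup>2"
proof -
  have "4 * k * (k * A\<^sup>2 + l * B\<^sup>2 - \<mu> * A * B) = (2 * k * A - \<mu> * B)\<^sup>2 + (4 * k * l - \<mu>\<^sup>2) * B\<^sup>2"
    by (simp add: power2_eq_square algebra_simps)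
  also have "\<dots> \<ge> 0" using assms by (intro add_nonneg_nonneg mult_nonneg_nonneg) auto
  finally show ?thesis using assms(1) by (simp add: zero_le_mult_iff)
qed

lemma heat2_gauss2:
  fixes h :: "real \<Rightarrow> real \<Rightarrow> real"
  assumes hm: "(\<lambda>p. h (fst p) (snd p)) \<in> borel_measurable (borel \<Otimes>\<^sub>M borel)"
    and bd: "\<And>x y. \<bar>h x y\<bar> \<le> C"
  shows "heat2 \<rho> t h x y =
      (\<integral>p. h (x + sqrt t * fst p) (y + sqrt t * (\<rho> * fst p + sqrt (1 - \<rho>\<^sup>2) * snd p)) \<partial>gauss2)"
    and "integrable gauss2 (\<lambda>p. h (x + sqrt t * fst p) (y + sqrt t * (\<rho> * fst p + sqrt (1 - \<rho>\<^sup>2) * snd p)))"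
proof -
  let ?g = "\<lambda>p. (x + sqrt t * fst p, y + sqrt t * (\<rho> * fst p + sqrt (1 - \<rho>\<^sup>2) * snd p))"
  have "?g \<in> borel \<Otimes>\<^sub>M borel \<rightarrow>\<^sub>M borel \<Otimes>\<^sub>M borel" by measurable
  from measurable_compose[OF this hm]
  have [measurable]: "(\<lambda>p. h (x + sqrt t * fst p) (y + sqrt t * (\<rho> * fst p + sqrt (1 - \<rho>\<^sup>2) * snd p)))
      \<in> borel_measurable (borel \<Otimes>\<^sub>M borel)" by simp
  show i: "integrable gauss2 (\<lambda>p. h (x + sqrt t * fst p) (y + sqrt t * (\<rho> * fst p + sqrt (1 - \<rho>\<^sup>2) * snd p)))"
    by (rule gauss2.integrable_const_bound[where B=C]) (auto simp: bd)
  show "heat2 \<rho> t h x y =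
      (\<integral>p. h (x + sqrt t * fst p) (y + sqrt t * (\<rho> * fst p + sqrt (1 - \<rho>\<^sup>2) * snd p)) \<partial>gauss2)"
    unfolding heat2_def using gauss2.integral_fst'[OF i] by simp
qed

text \<open>The combination has variance one, so it is again a standard Gaussian variable.\<close>

lemma gauss2_rotation:
  fixes b :: "real \<Rightarrow> real"
  assumes [measurable]: "b \<in> borel_measurable borel" and bd: "\<And>z. \<bar>b z\<bar> \<le> D" and \<rho>: "\<rho>\<^sup>2 \<le> 1"
  shows "(\<integral>p. b (\<rho> * fst p + sqrt (1 - \<rho>\<^sup>2) * snd p) \<partial>gauss2) = (\<integral>z. b z \<partial>std_gaussian)"
    and "integrable gauss2 (\<lambda>p. b (\<rho> * fst p + sqrt (1 - \<rho>\<^sup>2) * snd p))"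
proof -
  show i: "integrable gauss2 (\<lambda>p. b (\<rho> * fst p + sqrt (1 - \<rho>\<^sup>2) * snd p))"
    by (rule gauss2.integrable_const_bound[where B=D]) (auto simp: bd)
  have "(\<integral>p. b (\<rho> * fst p + sqrt (1 - \<rho>\<^sup>2) * snd p) \<partial>gauss2) =
      (\<integral>z. (\<integral>w. b (\<rho> * z + sqrt (1 - \<rho>\<^sup>2) * w) \<partial>std_gaussian) \<partial>std_gaussian)"
    using gauss2.integral_fst'[OF i] by simp
  also have "\<dots> = (\<integral>z. b (sqrt (\<rho>\<^sup>2 + (sqrt (1 - \<rho>\<^sup>2))\<^sup>2) * z) \<partial>std_gaussian)"
    by (rule gaussian_convolution[OF _ bd]) simp
  finally show "(\<integral>p. b (\<rho> * fst p + sqrt (1 - \<rho>\<^sup>2) * snd p) \<partial>gauss2) = (\<integral>z. b z \<partial>std_gaussian)"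
    using \<rho> by simp
qed

lemma gauss2_moments:
  assumes \<rho>: "\<rho>\<^sup>2 \<le> 1"
  defines "Z \<equiv> \<lambda>p. \<rho> * fst p + sqrt (1 - \<rho>\<^sup>2) * snd p"
  shows "integrable gauss2 (\<lambda>p. (fst p)\<^sup>2)" "(\<integral>p. (fst p)\<^sup>2 \<partial>gauss2) = 1"
    "integrable gauss2 (\<lambda>p. (Z p)\<^sup>2)" "(\<integral>p. (Z p)\<^sup>2 \<partial>gauss2) = 1"
    "integrable gauss2 (\<lambda>p. fst p * Z p)" "(\<integral>p. fst p * Z p \<partial>gauss2) = \<rho>"
proof -
  have z2: "(\<integral>z. z\<^sup>2 \<partial>std_gaussian) = 1" using hermite_orthogonal[of 1 1] by (simp add: power2_eq_square)
  have z1: "(\<integral>z. z \<partial>std_gaussian) = 0" using hermite_orthogonal[of 1 0] by simp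
  have one: "(\<integral>z. 1 \<partial>std_gaussian) = (1::real)" using gauss.prob_space by simp
  have eg: "expgrowth (\<lambda>z. z\<^sup>2)" "expgrowth (\<lambda>z. z)" "expgrowth (\<lambda>z. 1)" by auto
  note m1 = gauss2_integrable_product[OF eg(1) eg(3), unfolded z2 one, simplified]
  note m2 = gauss2_integrable_product[OF eg(2) eg(2), unfolded z1, simplified]
  note m3 = gauss2_integrable_product[OF eg(3) eg(1), unfolded z2 one, simplified]
  show "integrable gauss2 (\<lambda>p. (fst p)\<^sup>2)" "(\<integral>p. (fst p)\<^sup>2 \<partial>gauss2) = 1" using m1 by auto
  have r2: "(sqrt (1 - \<rho>\<^sup>2))\<^sup>2 = 1 - \<rho>\<^sup>2" using \<rho> by simp
  have e1: "(\<lambda>p. (Z p)\<^sup>2) = (\<lambda>p. \<rho>\<^sup>2 * (fst p)\<^sup>2 + 2 * \<rho> * sqrt (1 - \<rho>\<^sup>2) * (fst p * snd p) + (1 - \<rho>\<^sup>2) * (snd p)\<^sup>2)"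
    unfolding Z_def power2_sum power_mult_distrib r2 by (simp add: fun_eq_iff algebra_simps)
  have e2: "(\<lambda>p. fst p * Z p) = (\<lambda>p. \<rho> * (fst p)\<^sup>2 + sqrt (1 - \<rho>\<^sup>2) * (fst p * snd p))"
    unfolding Z_def by (simp add: fun_eq_iff power2_eq_square algebra_simps)
  show "integrable gauss2 (\<lambda>p. (Z p)\<^sup>2)" "(\<integral>p. (Z p)\<^sup>2 \<partial>gauss2) = 1"
    unfolding e1 using m1 m2 m3 by simp_all
  show "integrable gauss2 (\<lambda>p. fst p * Z p)" "(\<integral>p. fst p * Z p \<partial>gauss2) = \<rho>"
    unfolding e2 using m1 m2 by simp_all
qed

lemma smooth_between_powr_bounded:
  assumes "smooth_between c C L f" "smooth_between c C L g" "0 < c" "0 < \<alpha>" "0 < \<beta>"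
  shows "(\<lambda>p. f (fst p) powr \<alpha> * g (snd p) powr \<beta>) \<in> borel_measurable (borel \<Otimes>\<^sub>M borel)"
    and "\<bar>f x powr \<alpha> * g y powr \<beta>\<bar> \<le> C powr \<alpha> * C powr \<beta>"
proof -
  have [measurable]: "f \<in> borel_measurable borel" "g \<in> borel_measurable borel"
    using assms by (auto simp: smooth_between_def)
  show "(\<lambda>p. f (fst p) powr \<alpha> * g (snd p) powr \<beta>) \<in> borel_measurable (borel \<Otimes>\<^sub>M borel)"
    by measurable
  have "c \<le> f x" "f x \<le> C" "c \<le> g y" "g y \<le> C"
    using assms by (auto simp: smooth_between_def)
  then show "\<bar>f x powr \<alpha> * g y powr \<beta>\<bar> \<le> C powr \<alpha> * C powr \<beta>"
    using assms(3-5) unfolding abs_mult by (intro mult_mono) (auto intro!: powr_mono2)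
qed

text \<open>The quadratic part of the expansion has mean
\<open>\<alpha> * \<beta> * \<rho> * A * B - \<alpha> * (1 - \<alpha>) / 2 * A\<^sup>2 - \<beta> * (1 - \<beta>) / 2 * B\<^sup>2\<close>, and the condition on \<open>\<rho>\<close> says that this
quadratic form is nonpositive.  What remains is the error of order three in \<open>sqrt t\<close>, with a constant
that depends only on the class of functions.\<close>

lemma heat2_short_time_error:
  fixes \<alpha> \<beta> \<rho> c C L :: real
  assumes \<alpha>: "0 < \<alpha>" "\<alpha> < 1" and \<beta>: "0 < \<beta>" "\<beta> < 1" and \<rho>: "\<rho>\<^sup>2 \<le> 1"
    and cond: "\<rho>\<^sup>2 * (\<alpha> * \<beta>) \<le> (1 - \<alpha>) * (1 - \<beta>)" and c: "0 < c"
  shows "\<exists>K. \<forall>f g t x y. smooth_between c C L f \<longrightarrow> smooth_between c C L g \<longrightarrow> 0 < t \<longrightarrow> t \<le> 1 \<longrightarrow>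
    heat2 \<rho> t (\<lambda>x y. f x powr \<alpha> * g y powr \<beta>) x y \<le> heat t f x powr \<alpha> * heat t g y powr \<beta> + K * sqrt t ^ 3"
proof -
  define R where "R = L / c"
  define D where "D = C / c"
  define K0 where "K0 = 32 * (1 + D) ^ 3 * R ^ 3 + 9 * R\<^sup>2"
  define I where "I = (\<integral>z. (3 * (1 + z\<^sup>2)) ^ 3 \<partial>std_gaussian) * (\<integral>w. (1 + w\<^sup>2) ^ 3 \<partial>std_gaussian)"
  define K where "K = C powr \<alpha> * C powr \<beta> * (K0 * I)"
  have eg: "expgrowth (\<lambda>z. (3 * (1 + z\<^sup>2)) ^ 3)" "expgrowth (\<lambda>w. (1 + w\<^sup>2) ^ 3)"
    by (intro expgrowth_power expgrowth_mult expgrowth_add expgrowth_const expgrowth_ident)+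
  show ?thesis
  proof (intro exI[of _ K] allI impI)
    fix f g t x y
    assume f: "smooth_between c C L f" and g: "smooth_between c C L g" and t: "0 < t" "t \<le> (1::real)"
    define s where "s = sqrt t"
    define r where "r = sqrt (1 - \<rho>\<^sup>2)"
    define Z where "Z p = \<rho> * fst p + r * snd p" for p :: "real \<times> real"
    define u where "u = heat t f x"
    define v where "v = heat t g y"
    have s: "0 < s" "s \<le> 1" using t by (auto simp: s_def)
    obtain A a where a: "a \<in> borel_measurable borel" "\<bar>A\<bar> \<le> R" "\<And>z. f (x + s * z) = u * (1 + a z)"
      "\<And>z. - 1 < a z" "\<And>z. \<bar>a z\<bar> \<le> D" "(\<integral>z. a z \<partial>std_gaussian) = 0"
      "\<And>z. \<bar>a z\<bar> \<le> 2 * (R * s * (1 + z\<^sup>2))"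
      "\<And>z. \<bar>a z - s * A * z\<bar> \<le> R * s\<^sup>2 * (1 + z\<^sup>2)"
      by (rule heat_increment_expansion[OF f c t, of x, folded R_def D_def s_def u_def]) (rule that)
    obtain B b where b: "b \<in> borel_measurable borel" "\<bar>B\<bar> \<le> R" "\<And>z. g (y + s * z) = v * (1 + b z)"
      "\<And>z. - 1 < b z" "\<And>z. \<bar>b z\<bar> \<le> D" "(\<integral>z. b z \<partial>std_gaussian) = 0"
      "\<And>z. \<bar>b z\<bar> \<le> 2 * (R * s * (1 + z\<^sup>2))"
      "\<And>z. \<bar>b z - s * B * z\<bar> \<le> R * s\<^sup>2 * (1 + z\<^sup>2)"
      by (rule heat_increment_expansion[OF g c t, of y, folded R_def D_def s_def v_def]) (rule that)
    have R: "0 \<le> R" using a(2) by simp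
    have D: "0 \<le> D" using a(5)[of 0] by simp
    have [measurable]: "a \<in> borel_measurable borel" "b \<in> borel_measurable borel" by fact+
    have "f \<in> borel_measurable borel" "\<And>x. c \<le> f x" "\<And>x. f x \<le> C"
         "g \<in> borel_measurable borel" "\<And>x. c \<le> g x" "\<And>x. g x \<le> C"
      using f g by (auto simp: smooth_between_def)
    then have uv: "c \<le> u" "u \<le> C" "c \<le> v" "v \<le> C"
      unfolding u_def v_def using heat_bounds[of f c C t x] heat_bounds[of g c C t y] by auto
    have U: "0 \<le> u powr \<alpha> * v powr \<beta>" "u powr \<alpha> * v powr \<beta> \<le> C powr \<alpha> * C powr \<beta>"
      using uv c \<alpha> \<beta> by (auto intro!: mult_mono powr_mono2)
    \<comment> \<open>A common bound for both correlated variables, chosen as a product to make its moments factor.\<close>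
    define m where "m p = 3 * (1 + (fst p)\<^sup>2) * (1 + (snd p)\<^sup>2)" for p :: "real \<times> real"
    have m: "1 \<le> m p" "1 + (fst p)\<^sup>2 \<le> m p" "1 + (Z p)\<^sup>2 \<le> m p" for p
    proof -
      obtain z w where p: "p = (z, w)" by (cases p)
      have nn: "0 \<le> z\<^sup>2 * w\<^sup>2" by simp
      show "1 \<le> m p" "1 + (fst p)\<^sup>2 \<le> m p"
        using nn by (auto simp: m_def p algebra_simps add_nonneg_nonneg)
      have "(Z p)\<^sup>2 \<le> 2 * ((\<rho> * z)\<^sup>2 + (r * w)\<^sup>2)"
        using zero_le_power2[of "\<rho> * z - r * w"] by (simp add: Z_def p power2_sum power2_diff)
      also have "(\<rho> * z)\<^sup>2 \<le> 1 * z\<^sup>2" unfolding power_mult_distrib using \<rho> by (intro mult_right_mono) auto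
      also have "(r * w)\<^sup>2 \<le> 1 * w\<^sup>2" unfolding power_mult_distrib using \<rho> by (intro mult_right_mono) (auto simp: r_def)
      finally have "(Z p)\<^sup>2 \<le> 2 * (z\<^sup>2 + w\<^sup>2)" by simp
      also have "\<dots> + 1 \<le> m p"
        using nn zero_le_power2[of z] zero_le_power2[of w] unfolding m_def p fst_conv snd_conv
        by (simp add: algebra_simps)
      finally show "1 + (Z p)\<^sup>2 \<le> m p" by simp
    qed
    have absle: "\<bar>z\<bar> \<le> 1 + z\<^sup>2" for z :: real
      using zero_le_power2[of "\<bar>z\<bar> - 1"] by (simp add: power2_diff)
    define rhs where "rhs p = 1 + \<alpha> * a (fst p) + \<beta> * b (Z p) +
      s\<^sup>2 * (\<alpha> * \<beta> * A * B * (fst p * Z p) - \<alpha> * (1 - \<alpha>) / 2 * A\<^sup>2 * (fst p)\<^sup>2 - \<beta> * (1 - \<beta>) / 2 * B\<^sup>2 * (Z p)\<^sup>2)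
      + K0 * s ^ 3 * m p ^ 3" for p
    have main: "(1 + a (fst p)) powr \<alpha> * (1 + b (Z p)) powr \<beta> \<le> rhs p" for p
    proof -
      have Rm: "2 * (R * s * q) \<le> 2 * (R * s * m p)" "R * s\<^sup>2 * q \<le> R * s\<^sup>2 * m p" if "q \<le> m p" for q
        using that R s by (intro mult_left_mono; simp)+
      show ?thesis
        unfolding rhs_def K0_def
      proof (rule powr_product_taylor_bound[OF \<alpha> \<beta> s m(1) _ _ R a(2) b(2) a(4) a(5) _ _ b(4) b(5)])
        show "\<bar>fst p\<bar> \<le> m p" "\<bar>Z p\<bar> \<le> m p"
          using order_trans[OF absle m(2)] order_trans[OF absle m(3)] by auto
        show "\<bar>a (fst p)\<bar> \<le> 2 * (R * s * m p)" "\<bar>b (Z p)\<bar> \<le> 2 * (R * s * m p)"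
          using order_trans[OF a(7) Rm(1)[OF m(2)]] order_trans[OF b(7) Rm(1)[OF m(3)]] by auto
        show "\<bar>a (fst p) - s * A * fst p\<bar> \<le> R * s\<^sup>2 * m p" "\<bar>b (Z p) - s * B * Z p\<bar> \<le> R * s\<^sup>2 * m p"
          using order_trans[OF a(8) Rm(2)[OF m(2)]] order_trans[OF b(8) Rm(2)[OF m(3)]] by auto
      qed
    qed
    have ia: "integrable gauss2 (\<lambda>p. a (fst p))" "(\<integral>p. a (fst p) \<partial>gauss2) = 0"
      using gauss2_integrable_product[OF expgrowth_bounded[OF a(1) a(5)] expgrowth_const[of 1]] a(6) by auto
    have ib: "integrable gauss2 (\<lambda>p. b (Z p))" "(\<integral>p. b (Z p) \<partial>gauss2) = 0"
      using gauss2_rotation[OF b(1) b(5) \<rho>] b(6) by (auto simp: Z_def r_def)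
    have iz: "integrable gauss2 (\<lambda>p. (fst p)\<^sup>2)" "(\<integral>p. (fst p)\<^sup>2 \<partial>gauss2) = 1"
      "integrable gauss2 (\<lambda>p. (Z p)\<^sup>2)" "(\<integral>p. (Z p)\<^sup>2 \<partial>gauss2) = 1"
      "integrable gauss2 (\<lambda>p. fst p * Z p)" "(\<integral>p. fst p * Z p \<partial>gauss2) = \<rho>"
      using gauss2_moments[OF \<rho>] by (auto simp: Z_def r_def)
    have im: "integrable gauss2 (\<lambda>p. m p ^ 3)" "(\<integral>p. m p ^ 3 \<partial>gauss2) = I"
      using gauss2_integrable_product[OF eg] by (auto simp: m_def I_def power_mult_distrib)
    have irhs: "integrable gauss2 rhs"
      unfolding rhs_def using ia ib iz im by simp
    have rhs_int: "(\<integral>p. rhs p \<partial>gauss2) \<le> 1 + K0 * s ^ 3 * I"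
    proof -
      have "(\<integral>p. rhs p \<partial>gauss2) = 1 + s\<^sup>2 * (\<alpha> * \<beta> * A * B * \<rho> - \<alpha> * (1 - \<alpha>) / 2 * A\<^sup>2 - \<beta> * (1 - \<beta>) / 2 * B\<^sup>2) + K0 * s ^ 3 * I"
        unfolding rhs_def using ia ib iz im gauss2.prob_space by simp
      moreover have "(\<alpha> * \<beta> * \<rho>) * A * B \<le> \<alpha> * (1 - \<alpha>) / 2 * A\<^sup>2 + \<beta> * (1 - \<beta>) / 2 * B\<^sup>2"
      proof (rule quadratic_form_nonneg)
        have "(\<alpha> * \<beta> * \<rho>)\<^sup>2 = (\<alpha> * \<beta>) * (\<rho>\<^sup>2 * (\<alpha> * \<beta>))" by (simp add: power2_eq_square)
        also have "\<dots> \<le> (\<alpha> * \<beta>) * ((1 - \<alpha>) * (1 - \<beta>))" using cond \<alpha> \<beta> by (intro mult_left_mono) auto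
        also have "\<dots> = 4 * (\<alpha> * (1 - \<alpha>) / 2) * (\<beta> * (1 - \<beta>) / 2)" by simp
        finally show "(\<alpha> * \<beta> * \<rho>)\<^sup>2 \<le> 4 * (\<alpha> * (1 - \<alpha>) / 2) * (\<beta> * (1 - \<beta>) / 2)" .
      qed (use \<alpha> in simp)
      then have "s\<^sup>2 * (\<alpha> * \<beta> * A * B * \<rho> - \<alpha> * (1 - \<alpha>) / 2 * A\<^sup>2 - \<beta> * (1 - \<beta>) / 2 * B\<^sup>2) \<le> 0"
        by (intro mult_nonneg_nonpos) (auto simp: ac_simps)
      ultimately show ?thesis by simp
    qed
    note h = smooth_between_powr_bounded[OF f g c \<alpha>(1) \<beta>(1)]
    have "heat2 \<rho> t (\<lambda>x y. f x powr \<alpha> * g y powr \<beta>) x y =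
       (\<integral>p. f (x + s * fst p) powr \<alpha> * g (y + s * Z p) powr \<beta> \<partial>gauss2)"
      unfolding s_def Z_def r_def by (rule heat2_gauss2(1)[OF h])
    also have "\<dots> \<le> (\<integral>p. u powr \<alpha> * v powr \<beta> * rhs p \<partial>gauss2)"
    proof (rule integral_mono)
      show "integrable gauss2 (\<lambda>p. f (x + s * fst p) powr \<alpha> * g (y + s * Z p) powr \<beta>)"
        unfolding s_def Z_def r_def by (rule heat2_gauss2(2)[OF h])
      fix p
      have "0 \<le> 1 + a (fst p)" "0 \<le> 1 + b (Z p)" using a(4)[of "fst p"] b(4)[of "Z p"] by auto
      then have "f (x + s * fst p) powr \<alpha> * g (y + s * Z p) powr \<beta> =
         u powr \<alpha> * v powr \<beta> * ((1 + a (fst p)) powr \<alpha> * (1 + b (Z p)) powr \<beta>)"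
        unfolding a(3) b(3) using uv c by (simp add: powr_mult)
      also have "\<dots> \<le> u powr \<alpha> * v powr \<beta> * rhs p"
        by (rule mult_left_mono[OF main U(1)])
      finally show "f (x + s * fst p) powr \<alpha> * g (y + s * Z p) powr \<beta> \<le> u powr \<alpha> * v powr \<beta> * rhs p" .
    qed (use irhs in simp)
    also have "\<dots> = u powr \<alpha> * v powr \<beta> * (\<integral>p. rhs p \<partial>gauss2)" by simp
    also have "\<dots> \<le> u powr \<alpha> * v powr \<beta> * (1 + K0 * s ^ 3 * I)"
      by (rule mult_left_mono[OF rhs_int U(1)])
    also have "\<dots> = u powr \<alpha> * v powr \<beta> + u powr \<alpha> * v powr \<beta> * (K0 * s ^ 3 * I)" by (simp add: algebra_simps)
    also have "u powr \<alpha> * v powr \<beta> * (K0 * s ^ 3 * I) \<le> C powr \<alpha> * C powr \<beta> * (K0 * s ^ 3 * I)"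
    proof (rule mult_right_mono[OF U(2)])
      have "0 \<le> I" unfolding I_def by (intro mult_nonneg_nonneg integral_nonneg_AE) auto
      then show "0 \<le> K0 * s ^ 3 * I" using R D s by (simp add: K0_def)
    qed
    finally show "heat2 \<rho> t (\<lambda>x y. f x powr \<alpha> * g y powr \<beta>) x y \<le> heat t f x powr \<alpha> * heat t g y powr \<beta> + K * sqrt t ^ 3"
      by (simp add: K_def u_def v_def s_def ac_simps)
  qed
qed

lemma heat2_measurable:
  fixes h :: "real \<Rightarrow> real \<Rightarrow> real"
  assumes h: "(\<lambda>p. h (fst p) (snd p)) \<in> borel_measurable (borel \<Otimes>\<^sub>M borel)" "\<And>x y. \<bar>h x y\<bar> \<le> C"
  shows "(\<lambda>p. heat2 \<rho> t h (fst p) (snd p)) \<in> borel_measurable (borel \<Otimes>\<^sub>M borel)"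
  unfolding heat2_gauss2(1)[OF h]
proof (rule gauss2.borel_measurable_lebesgue_integral)
  let ?g = "\<lambda>r. (fst (fst r) + sqrt t * fst (snd r), snd (fst r) + sqrt t * (\<rho> * fst (snd r) + sqrt (1 - \<rho>\<^sup>2) * snd (snd r)))"
  have "?g \<in> (borel \<Otimes>\<^sub>M borel) \<Otimes>\<^sub>M gauss2 \<rightarrow>\<^sub>M borel \<Otimes>\<^sub>M borel" by measurable
  from measurable_compose[OF this h(1)]
  show "(\<lambda>(x, p). h (fst x + sqrt t * fst p) (snd x + sqrt t * (\<rho> * fst p + sqrt (1 - \<rho>\<^sup>2) * snd p)))
      \<in> borel_measurable ((borel \<Otimes>\<^sub>M borel) \<Otimes>\<^sub>M gauss2)" by (simp add: split_beta')
qed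

lemma heat2_bounded:
  fixes h :: "real \<Rightarrow> real \<Rightarrow> real"
  assumes h: "(\<lambda>p. h (fst p) (snd p)) \<in> borel_measurable (borel \<Otimes>\<^sub>M borel)" "\<And>x y. \<bar>h x y\<bar> \<le> C"
  shows "\<bar>heat2 \<rho> t h x y\<bar> \<le> C"
proof -
  let ?k = "\<lambda>p. h (x + sqrt t * fst p) (y + sqrt t * (\<rho> * fst p + sqrt (1 - \<rho>\<^sup>2) * snd p))"
  have "\<bar>\<integral>p. ?k p \<partial>gauss2\<bar> \<le> (\<integral>p. \<bar>?k p\<bar> \<partial>gauss2)" by (rule integral_abs_bound)
  also have "\<dots> \<le> (\<integral>p. C \<partial>gauss2)"
    using heat2_gauss2(2)[OF h] h(2) by (intro integral_mono) auto
  finally show ?thesis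
    using gauss2.prob_space unfolding heat2_gauss2(1)[OF h] by simp
qed

lemma heat2_le_add:
  fixes h k :: "real \<Rightarrow> real \<Rightarrow> real"
  assumes h: "(\<lambda>p. h (fst p) (snd p)) \<in> borel_measurable (borel \<Otimes>\<^sub>M borel)" "\<And>x y. \<bar>h x y\<bar> \<le> C"
    and k: "(\<lambda>p. k (fst p) (snd p)) \<in> borel_measurable (borel \<Otimes>\<^sub>M borel)" "\<And>x y. \<bar>k x y\<bar> \<le> D"
    and le: "\<And>x y. h x y \<le> k x y + K"
  shows "heat2 \<rho> t h x y \<le> heat2 \<rho> t k x y + K"
proof -
  have "heat2 \<rho> t h x y \<le> (\<integral>p. k (x + sqrt t * fst p) (y + sqrt t * (\<rho> * fst p + sqrt (1 - \<rho>\<^sup>2) * snd p)) + K \<partial>gauss2)"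
    unfolding heat2_gauss2(1)[OF h]
    by (intro integral_mono heat2_gauss2(2)[OF h] Bochner_Integration.integrable_add heat2_gauss2(2)[OF k])
       (auto simp: le)
  also have "\<dots> = heat2 \<rho> t k x y + K"
    unfolding heat2_gauss2(1)[OF k]
    by (subst Bochner_Integration.integral_add[OF heat2_gauss2(2)[OF k]]) (auto simp: gauss2.prob_space)
  finally show ?thesis .
qed

text \<open>The step of length \<open>2 * t\<close> is two steps of length \<open>t\<close>.  The second one is applied to \<open>heat t f\<close> and
\<open>heat t g\<close>, which belong to the same class, so the errors add.\<close>

lemma heat2_double:
  fixes \<alpha> \<beta> \<rho> c C L t K :: real
  assumes \<alpha>: "0 < \<alpha>" and \<beta>: "0 < \<beta>" and \<rho>: "\<rho>\<^sup>2 \<le> 1" and c: "0 < c" and t: "0 \<le> t"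
    and le: "\<And>f g x y. smooth_between c C L f \<Longrightarrow> smooth_between c C L g \<Longrightarrow>
      heat2 \<rho> t (\<lambda>x y. f x powr \<alpha> * g y powr \<beta>) x y \<le> heat t f x powr \<alpha> * heat t g y powr \<beta> + K"
    and f: "smooth_between c C L f" and g: "smooth_between c C L g"
  shows "heat2 \<rho> (2 * t) (\<lambda>x y. f x powr \<alpha> * g y powr \<beta>) x y \<le>
    heat (2 * t) f x powr \<alpha> * heat (2 * t) g y powr \<beta> + 2 * K"
proof -
  note h = smooth_between_powr_bounded[OF f g c \<alpha> \<beta>]
  note f' = smooth_between_heat[OF f, of t] and g' = smooth_between_heat[OF g, of t]
  note h' = smooth_between_powr_bounded[OF f' g' c \<alpha> \<beta>]
  have bd: "\<bar>f x\<bar> \<le> C" "\<bar>g x\<bar> \<le> C" "f \<in> borel_measurable borel" "g \<in> borel_measurable borel" for x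
  proof -
    have "c \<le> f x" "f x \<le> C" "c \<le> g x" "g x \<le> C" using f g by (auto simp: smooth_between_def)
    with c show "\<bar>f x\<bar> \<le> C" "\<bar>g x\<bar> \<le> C" by auto
    show "f \<in> borel_measurable borel" "g \<in> borel_measurable borel" using f g by (auto simp: smooth_between_def)
  qed
  have "heat2 \<rho> (2 * t) (\<lambda>x y. f x powr \<alpha> * g y powr \<beta>) x y =
      heat2 \<rho> t (heat2 \<rho> t (\<lambda>x y. f x powr \<alpha> * g y powr \<beta>)) x y"
    by (rule heat2_semigroup[OF \<rho> h t, symmetric])
  also have "\<dots> \<le> heat2 \<rho> t (\<lambda>x y. heat t f x powr \<alpha> * heat t g y powr \<beta>) x y + K"
    by (rule heat2_le_add[OF heat2_measurable[OF h] heat2_bounded[OF h] h' le[OF f g]])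
  also have "\<dots> \<le> heat t (heat t f) x powr \<alpha> * heat t (heat t g) y powr \<beta> + K + K"
    by (intro add_right_mono le[OF f' g'])
  also have "\<dots> = heat (2 * t) f x powr \<alpha> * heat (2 * t) g y powr \<beta> + 2 * K"
    using heat_semigroup[OF bd(3) bd(1) t] heat_semigroup[OF bd(4) bd(2) t] by simp
  finally show ?thesis .
qed

text \<open>The interval \<open>[0, 1]\<close> consists of \<open>2 ^ n\<close> steps, each with an error of order \<open>sqrt ((1/2) ^ n) ^ 3\<close>.\<close>

lemma two_function_smooth:
  fixes \<alpha> \<beta> \<rho> c C L :: real
  assumes \<alpha>: "0 < \<alpha>" "\<alpha> < 1" and \<beta>: "0 < \<beta>" "\<beta> < 1" and \<rho>: "\<rho>\<^sup>2 \<le> 1"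
    and cond: "\<rho>\<^sup>2 * (\<alpha> * \<beta>) \<le> (1 - \<alpha>) * (1 - \<beta>)" and c: "0 < c"
    and f: "smooth_between c C L f" and g: "smooth_between c C L g"
  shows "heat2 \<rho> 1 (\<lambda>x y. f x powr \<alpha> * g y powr \<beta>) x y \<le> heat 1 f x powr \<alpha> * heat 1 g y powr \<beta>"
proof -
  obtain K where
    "\<forall>f g t x y. smooth_between c C L f \<longrightarrow> smooth_between c C L g \<longrightarrow> 0 < t \<longrightarrow> t \<le> 1 \<longrightarrow>
    heat2 \<rho> t (\<lambda>x y. f x powr \<alpha> * g y powr \<beta>) x y \<le> heat t f x powr \<alpha> * heat t g y powr \<beta> + K * sqrt t ^ 3"
    using heat2_short_time_error[OF \<alpha> \<beta> \<rho> cond c, of C L] by (rule exE)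
  note K = this[rule_format]
  have iter: "smooth_between c C L f \<Longrightarrow> smooth_between c C L g \<Longrightarrow>
      heat2 \<rho> (2 ^ k * t) (\<lambda>x y. f x powr \<alpha> * g y powr \<beta>) x y \<le>
      heat (2 ^ k * t) f x powr \<alpha> * heat (2 ^ k * t) g y powr \<beta> + 2 ^ k * (K * sqrt t ^ 3)"
    if t: "0 < t" "t \<le> 1" for t k f g x y
  proof (induction k arbitrary: f g x y)
    case 0
    from K[OF 0 t, of x y] show ?case by (simp only: power_0 mult_1_left)
  next
    case (Suc k)
    have nn: "0 \<le> 2 ^ k * t" using t by simp
    have "heat2 \<rho> (2 * (2 ^ k * t)) (\<lambda>x y. f x powr \<alpha> * g y powr \<beta>) x y \<le>
      heat (2 * (2 ^ k * t)) f x powr \<alpha> * heat (2 * (2 ^ k * t)) g y powr \<beta> + 2 * (2 ^ k * (K * sqrt t ^ 3))"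
    proof (rule heat2_double[where c=c and C=C and L=L])
      show "smooth_between c C L f" "smooth_between c C L g" by (fact Suc.prems)+
    qed (fact \<alpha>(1) \<beta>(1) \<rho> c nn | erule (1) Suc.IH)+
    then show ?case
      by (simp only: power_Suc mult.assoc)
  qed
  have "heat2 \<rho> 1 (\<lambda>x y. f x powr \<alpha> * g y powr \<beta>) x y \<le>
      heat 1 f x powr \<alpha> * heat 1 g y powr \<beta> + K * sqrt ((1/2) ^ n)" for n
  proof -
    have 1: "(2::real) ^ n * (1/2) ^ n = 1" by (simp flip: power_mult_distrib)
    have q: "0 < (1/2::real) ^ n" "(1/2::real) ^ n \<le> 1" by (auto simp: power_le_one)
    have "sqrt ((1/2) ^ n) ^ 3 = (1/2) ^ n * sqrt ((1/2::real) ^ n)"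
      using q by (simp only: power3_eq_cube) (simp only: real_sqrt_mult_self abs_of_pos)
    then have "(2::real) ^ n * (K * sqrt ((1/2) ^ n) ^ 3) = (2 ^ n * (1/2) ^ n) * (K * sqrt ((1/2) ^ n))"
      by (simp only: mult_ac)
    with iter[OF q f g, where k=n, of x y] show ?thesis by (simp only: 1 mult_1_left)
  qed
  moreover have "(\<lambda>n. heat 1 f x powr \<alpha> * heat 1 g y powr \<beta> + K * sqrt ((1/2) ^ n)) \<longlonglongrightarrow>
      heat 1 f x powr \<alpha> * heat 1 g y powr \<beta> + K * sqrt 0"
    by (intro tendsto_intros LIMSEQ_realpow_zero) auto
  ultimately show ?thesis
    by (intro LIMSEQ_le_const[of _ "heat 1 f x powr \<alpha> * heat 1 g y powr \<beta>"]) auto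
qed

lemma heat_tendsto:
  fixes f :: "real \<Rightarrow> real"
  assumes cont: "continuous_on UNIV f" and bd: "\<And>x. \<bar>f x\<bar> \<le> C" and t: "t \<longlonglongrightarrow> 0"
  shows "(\<lambda>n. heat (t n) f x) \<longlonglongrightarrow> f x"
proof -
  have [measurable]: "f \<in> borel_measurable borel" by (rule borel_measurable_continuous_onI[OF cont])
  have "(\<lambda>n. \<integral>z. f (x + sqrt (t n) * z) \<partial>std_gaussian) \<longlonglongrightarrow> (\<integral>z. f x \<partial>std_gaussian)"
  proof (rule integral_dominated_convergence[where w="\<lambda>_. C"])
    show "AE z in std_gaussian. (\<lambda>n. f (x + sqrt (t n) * z)) \<longlonglongrightarrow> f x"
    proof (rule AE_I2)
      fix z
      have "(\<lambda>n. x + sqrt (t n) * z) \<longlonglongrightarrow> x + sqrt 0 * z" by (intro tendsto_intros t)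
      from continuous_on_tendsto_compose[OF cont this] show "(\<lambda>n. f (x + sqrt (t n) * z)) \<longlonglongrightarrow> f x" by simp
    qed
  qed (auto simp: bd)
  then show ?thesis by (simp add: heat_def gauss.prob_space)
qed

text \<open>Mollification by the heat flow for the time \<open>e n\<close>, which tends to zero.\<close>

lemma two_function_bounded:
  fixes \<alpha> \<beta> \<rho> c C :: real
  assumes \<alpha>: "0 < \<alpha>" "\<alpha> < 1" and \<beta>: "0 < \<beta>" "\<beta> < 1" and \<rho>: "\<rho>\<^sup>2 \<le> 1"
    and cond: "\<rho>\<^sup>2 * (\<alpha> * \<beta>) \<le> (1 - \<alpha>) * (1 - \<beta>)" and c: "0 < c"
    and f: "continuous_on UNIV f" "\<And>x. c \<le> f x" "\<And>x. f x \<le> C"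
    and g: "continuous_on UNIV g" "\<And>x. c \<le> g x" "\<And>x. g x \<le> C"
  shows "(\<integral>p. f (fst p) powr \<alpha> * g (\<rho> * fst p + sqrt (1 - \<rho>\<^sup>2) * snd p) powr \<beta> \<partial>gauss2) \<le>
    integral\<^sup>L std_gaussian f powr \<alpha> * integral\<^sup>L std_gaussian g powr \<beta>"
proof -
  have [measurable]: "f \<in> borel_measurable borel" "g \<in> borel_measurable borel"
    using f(1) g(1) by (auto intro: borel_measurable_continuous_onI)
  define e where "e n = 1 / real (Suc n)" for n
  have e: "0 < e n" "e n \<le> 1" for n by (auto simp: e_def)
  have e0: "e \<longlonglongrightarrow> 0" unfolding e_def[abs_def] by (rule LIMSEQ_Suc[OF lim_1_over_n])
  have abd: "\<bar>f x\<bar> \<le> C" "\<bar>g x\<bar> \<le> C" for x using f(2,3)[of x] g(2,3)[of x] c by auto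
  have C: "0 < C" using f(2,3)[of 0] c by simp
  define F where "F n = heat (e n) f" for n
  define G where "G n = heat (e n) g" for n
  have FG: "F n \<in> borel_measurable borel" "G n \<in> borel_measurable borel"
    "c \<le> F n x" "F n x \<le> C" "c \<le> G n x" "G n x \<le> C" for n x
    unfolding F_def G_def using heat_bounds[of f c C "e n" x] heat_bounds[of g c C "e n" x] f g by auto
  note [measurable] = FG(1,2)
  have Fl: "(\<lambda>n. F n x) \<longlonglongrightarrow> f x" and Gl: "(\<lambda>n. G n x) \<longlonglongrightarrow> g x" for x
    unfolding F_def G_def by (rule heat_tendsto[OF _ abd(1) e0] heat_tendsto[OF _ abd(2) e0], fact)+
  let ?Z = "\<lambda>p. \<rho> * fst p + sqrt (1 - \<rho>\<^sup>2) * snd p"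
  have step: "(\<integral>p. F n (fst p) powr \<alpha> * G n (?Z p) powr \<beta> \<partial>gauss2) \<le>
      (\<integral>z. F n z \<partial>std_gaussian) powr \<alpha> * (\<integral>z. G n z \<partial>std_gaussian) powr \<beta>" for n
  proof -
    have sF: "smooth_between c C (2 * C / e n) (F n)" and sG: "smooth_between c C (2 * C / e n) (G n)"
      unfolding F_def G_def by (intro smooth_between_mollify f g c e; simp)+
    have "heat2 \<rho> 1 (\<lambda>x y. F n x powr \<alpha> * G n y powr \<beta>) 0 0 \<le> heat 1 (F n) 0 powr \<alpha> * heat 1 (G n) 0 powr \<beta>"
      by (rule two_function_smooth[OF \<alpha> \<beta> \<rho> cond c sF sG])
    then show ?thesis
      unfolding heat2_gauss2(1)[OF smooth_between_powr_bounded[OF sF sG c \<alpha>(1) \<beta>(1)]] by (simp add: heat_def)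
  qed
  have L1: "(\<lambda>n. \<integral>p. F n (fst p) powr \<alpha> * G n (?Z p) powr \<beta> \<partial>gauss2) \<longlonglongrightarrow>
      (\<integral>p. f (fst p) powr \<alpha> * g (?Z p) powr \<beta> \<partial>gauss2)"
  proof (rule integral_dominated_convergence[where w="\<lambda>_. C powr \<alpha> * C powr \<beta>"])
    show "AE p in gauss2. (\<lambda>n. F n (fst p) powr \<alpha> * G n (?Z p) powr \<beta>) \<longlonglongrightarrow> f (fst p) powr \<alpha> * g (?Z p) powr \<beta>"
    proof (rule AE_I2)
      fix p
      have "f (fst p) \<noteq> 0" "g (?Z p) \<noteq> 0" using f(2)[of "fst p"] g(2)[of "?Z p"] c by auto
      then show "(\<lambda>n. F n (fst p) powr \<alpha> * G n (?Z p) powr \<beta>) \<longlonglongrightarrow> f (fst p) powr \<alpha> * g (?Z p) powr \<beta>"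
        by (intro tendsto_mult tendsto_powr Fl Gl tendsto_const)
    qed
    show "AE p in gauss2. norm (F n (fst p) powr \<alpha> * G n (?Z p) powr \<beta>) \<le> C powr \<alpha> * C powr \<beta>" for n
    proof (rule AE_I2)
      fix p
      have "F n (fst p) powr \<alpha> \<le> C powr \<alpha>" "G n (?Z p) powr \<beta> \<le> C powr \<beta>"
        using FG(3,4)[of n "fst p"] FG(5,6)[of n "?Z p"] c \<alpha> \<beta> by (auto intro!: powr_mono2)
      then show "norm (F n (fst p) powr \<alpha> * G n (?Z p) powr \<beta>) \<le> C powr \<alpha> * C powr \<beta>"
        by (auto simp: abs_mult intro!: mult_mono)
    qed
  qed auto
  have pos: "c \<le> integral\<^sup>L std_gaussian f" "c \<le> integral\<^sup>L std_gaussian g"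
    using gaussian_integral_bounds[of f c C] gaussian_integral_bounds[of g c C] f g by auto
  have L2: "(\<lambda>n. \<integral>z. F n z \<partial>std_gaussian) \<longlonglongrightarrow> integral\<^sup>L std_gaussian f"
  proof (rule integral_dominated_convergence[where w="\<lambda>_. C"])
    show "AE z in std_gaussian. norm (F n z) \<le> C" for n
    proof (rule AE_I2)
      show "norm (F n z) \<le> C" for z using FG(3,4)[of n z] c by auto
    qed
  qed (auto simp: Fl)
  have L3: "(\<lambda>n. \<integral>z. G n z \<partial>std_gaussian) \<longlonglongrightarrow> integral\<^sup>L std_gaussian g"
  proof (rule integral_dominated_convergence[where w="\<lambda>_. C"])
    show "AE z in std_gaussian. norm (G n z) \<le> C" for n
    proof (rule AE_I2)
      show "norm (G n z) \<le> C" for z using FG(5,6)[of n z] c by auto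
    qed
  qed (auto simp: Gl)
  have "(\<lambda>n. (\<integral>z. F n z \<partial>std_gaussian) powr \<alpha> * (\<integral>z. G n z \<partial>std_gaussian) powr \<beta>) \<longlonglongrightarrow>
     integral\<^sup>L std_gaussian f powr \<alpha> * integral\<^sup>L std_gaussian g powr \<beta>"
    using pos c by (intro tendsto_mult tendsto_powr L2 L3 tendsto_const) auto
  from LIMSEQ_le[OF L1 this] step show ?thesis by auto
qed

lemma expgrowth_exp_abs: "0 \<le> k \<Longrightarrow> expgrowth (\<lambda>z. exp (k * \<bar>z\<bar>))"
  by (rule expgrowthI[of _ 1 k]) auto

text \<open>Since both weights of the combination are at most one in absolute value, the bound
\<open>exp (l * \<bar>\<rho> * z + sqrt (1 - \<rho>\<^sup>2) * w\<bar>)\<close> splits into a product.\<close>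

lemma expgrowth_rotation_integrable:
  assumes f: "expgrowth f" and g: "expgrowth g" and \<rho>: "\<rho>\<^sup>2 \<le> 1"
  shows "integrable gauss2 (\<lambda>p. f (fst p) * g (\<rho> * fst p + sqrt (1 - \<rho>\<^sup>2) * snd p))"
proof -
  from g obtain D l where D: "0 \<le> D" "0 \<le> l" "\<And>z. \<bar>g z\<bar> \<le> D * exp (l * \<bar>z\<bar>)"
    by (rule expgrowthE) blast
  have [measurable]: "f \<in> borel_measurable borel" "g \<in> borel_measurable borel"
    using f g by (auto simp: expgrowth_measurable)
  show ?thesis
  proof (rule gauss2_integrable)
    show "expgrowth (\<lambda>z. \<bar>f z\<bar> * (D * exp (l * \<bar>z\<bar>)))"
      by (intro expgrowth_mult expgrowth_abs f expgrowth_const expgrowth_exp_abs D)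
    show "expgrowth (\<lambda>w. exp (l * \<bar>w\<bar>))" by (intro expgrowth_exp_abs D)
    fix z w
    have "\<bar>\<rho>\<bar> \<le> 1" "\<bar>sqrt (1 - \<rho>\<^sup>2)\<bar> \<le> 1" using \<rho> by (auto simp: abs_square_le_1)
    then have "\<bar>\<rho>\<bar> * \<bar>z\<bar> + \<bar>sqrt (1 - \<rho>\<^sup>2)\<bar> * \<bar>w\<bar> \<le> 1 * \<bar>z\<bar> + 1 * \<bar>w\<bar>"
      by (intro add_mono mult_right_mono) auto
    then have "\<bar>\<rho> * z + sqrt (1 - \<rho>\<^sup>2) * w\<bar> \<le> \<bar>z\<bar> + \<bar>w\<bar>"
      using abs_triangle_ineq[of "\<rho> * z" "sqrt (1 - \<rho>\<^sup>2) * w"] unfolding abs_mult by simp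
    then have "D * exp (l * \<bar>\<rho> * z + sqrt (1 - \<rho>\<^sup>2) * w\<bar>) \<le> D * exp (l * (\<bar>z\<bar> + \<bar>w\<bar>))"
      using D by (auto intro!: mult_left_mono)
    then have "\<bar>g (\<rho> * z + sqrt (1 - \<rho>\<^sup>2) * w)\<bar> \<le> D * exp (l * \<bar>z\<bar>) * exp (l * \<bar>w\<bar>)"
      using D(3)[of "\<rho> * z + sqrt (1 - \<rho>\<^sup>2) * w"] by (simp add: distrib_left exp_add)
    from mult_left_mono[OF this, of "\<bar>f z\<bar>"]
    show "\<bar>f (fst (z, w)) * g (\<rho> * fst (z, w) + sqrt (1 - \<rho>\<^sup>2) * snd (z, w))\<bar> \<le> \<bar>f z\<bar> * (D * exp (l * \<bar>z\<bar>)) * exp (l * \<bar>w\<bar>)"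
      by (simp add: abs_mult mult.assoc)
  qed measurable
qed

lemma powr_le_one_plus:
  fixes x a :: real
  assumes "0 \<le> x" "0 \<le> a" "a \<le> 1"
  shows "x powr a \<le> 1 + x"
proof -
  have "x powr a \<le> (1 + x) powr a" using assms by (intro powr_mono2) auto
  also have "\<dots> \<le> (1 + x) powr 1" using assms by (intro powr_mono) auto
  finally show ?thesis using assms by simp
qed

text \<open>The functions are truncated to the interval from \<open>1 / Suc n\<close> to \<open>Suc n\<close>, where the bounded case applies.\<close>

lemma two_function_hypercontractivity:
  fixes \<alpha> \<beta> \<rho> :: real
  assumes \<alpha>: "0 < \<alpha>" "\<alpha> < 1" and \<beta>: "0 < \<beta>" "\<beta> < 1" and \<rho>: "\<rho>\<^sup>2 \<le> 1"
    and cond: "\<rho>\<^sup>2 * (\<alpha> * \<beta>) \<le> (1 - \<alpha>) * (1 - \<beta>)"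
    and f: "continuous_on UNIV f" "\<And>x. 0 \<le> f x" "expgrowth f"
    and g: "continuous_on UNIV g" "\<And>x. 0 \<le> g x" "expgrowth g"
  shows "(\<integral>p. f (fst p) powr \<alpha> * g (\<rho> * fst p + sqrt (1 - \<rho>\<^sup>2) * snd p) powr \<beta> \<partial>gauss2) \<le>
    integral\<^sup>L std_gaussian f powr \<alpha> * integral\<^sup>L std_gaussian g powr \<beta>"
proof -
  let ?Z = "\<lambda>p. \<rho> * fst p + sqrt (1 - \<rho>\<^sup>2) * snd p"
  have [measurable]: "f \<in> borel_measurable borel" "g \<in> borel_measurable borel"
    using f g by (auto simp: expgrowth_measurable)
  define cut where "cut n x = max (1 / real (Suc n)) (min (real (Suc n)) x)" for n x
  have cut: "1 / real (Suc n) \<le> cut n x" "cut n x \<le> real (Suc n)" for n x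
    by (auto simp: cut_def field_simps)
  have cut_le: "cut n x \<le> 1 + x" "0 < cut n x" if "0 \<le> x" for n x
  proof -
    show "cut n x \<le> 1 + x" using that by (auto simp: cut_def field_simps max_def min_def)
    show "0 < cut n x" by (rule less_le_trans[OF _ cut(1)]) simp
  qed
  have cut_lim: "(\<lambda>n. cut n x) \<longlonglongrightarrow> x" if "0 \<le> x" for x
  proof -
    have "(\<lambda>n. max (1 / real (Suc n)) x) \<longlonglongrightarrow> max 0 x"
      by (intro tendsto_max LIMSEQ_Suc[OF lim_1_over_n] tendsto_const)
    moreover have "eventually (\<lambda>n. max (1 / real (Suc n)) x = cut n x) sequentially"
    proof -
      obtain N where N: "x \<le> real N" using real_arch_simple by blast
      show ?thesis using eventually_ge_at_top[of N]
      proof eventually_elim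
        case (elim n)
        then have "x \<le> real (Suc n)" using N by (simp add: order_trans[OF N])
        then show ?case by (simp add: cut_def min_def)
      qed
    qed
    ultimately show ?thesis using that by (auto intro: Lim_transform_eventually)
  qed
  have cutc: "continuous_on UNIV (\<lambda>x. cut n (f x))" "continuous_on UNIV (\<lambda>x. cut n (g x))" for n
    unfolding cut_def by (intro continuous_intros f g)+
  have [measurable]: "cut n \<in> borel_measurable borel" for n unfolding cut_def by measurable
  have step: "(\<integral>p. cut n (f (fst p)) powr \<alpha> * cut n (g (?Z p)) powr \<beta> \<partial>gauss2) \<le>
      (\<integral>z. cut n (f z) \<partial>std_gaussian) powr \<alpha> * (\<integral>z. cut n (g z) \<partial>std_gaussian) powr \<beta>" for n
    by (rule two_function_bounded[OF \<alpha> \<beta> \<rho> cond _ cutc(1) cut cutc(2) cut]) simp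
  have L1: "(\<lambda>n. \<integral>p. cut n (f (fst p)) powr \<alpha> * cut n (g (?Z p)) powr \<beta> \<partial>gauss2) \<longlonglongrightarrow>
      (\<integral>p. f (fst p) powr \<alpha> * g (?Z p) powr \<beta> \<partial>gauss2)"
  proof (rule integral_dominated_convergence[where w="\<lambda>p. (2 + f (fst p)) * (2 + g (?Z p))"])
    show "integrable gauss2 (\<lambda>p. (2 + f (fst p)) * (2 + g (?Z p)))"
      by (rule expgrowth_rotation_integrable[where f="\<lambda>x. 2 + f x" and g="\<lambda>x. 2 + g x"])
         (intro expgrowth_add expgrowth_const f g \<rho>)+
    show "AE p in gauss2. (\<lambda>n. cut n (f (fst p)) powr \<alpha> * cut n (g (?Z p)) powr \<beta>) \<longlonglongrightarrow> f (fst p) powr \<alpha> * g (?Z p) powr \<beta>"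
    proof (rule AE_I2)
      fix p
      have "(\<lambda>n. cut n x powr a) \<longlonglongrightarrow> x powr a" if "0 \<le> x" "0 < a" for x a
        by (rule tendsto_powr2[OF cut_lim[OF that(1)] tendsto_const]) (use that cut_le(2)[OF that(1)] in \<open>auto intro!: always_eventually less_imp_le\<close>)
      then show "(\<lambda>n. cut n (f (fst p)) powr \<alpha> * cut n (g (?Z p)) powr \<beta>) \<longlonglongrightarrow> f (fst p) powr \<alpha> * g (?Z p) powr \<beta>"
        using f g \<alpha> \<beta> by (intro tendsto_mult) auto
    qed
    show "AE p in gauss2. norm (cut n (f (fst p)) powr \<alpha> * cut n (g (?Z p)) powr \<beta>) \<le> (2 + f (fst p)) * (2 + g (?Z p))" for n
    proof (rule AE_I2)
      fix p
      have "cut n x powr a \<le> 2 + x" if "0 \<le> x" "0 < a" "a < 1" for x a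
        using powr_le_one_plus[of "cut n x" a] cut_le[OF that(1), of n] that by simp
      then show "norm (cut n (f (fst p)) powr \<alpha> * cut n (g (?Z p)) powr \<beta>) \<le> (2 + f (fst p)) * (2 + g (?Z p))"
        using f g \<alpha> \<beta> by (auto simp: abs_mult intro!: mult_mono add_nonneg_nonneg)
    qed
  qed auto
  have L: "(\<lambda>n. \<integral>z. cut n (h z) \<partial>std_gaussian) \<longlonglongrightarrow> integral\<^sup>L std_gaussian h"
    if h: "expgrowth h" "\<And>x. 0 \<le> h x" for h
  proof (rule integral_dominated_convergence[where w="\<lambda>z. 1 + h z"])
    have [measurable]: "h \<in> borel_measurable borel" using h by (simp add: expgrowth_measurable)
    show "h \<in> borel_measurable std_gaussian" "(\<lambda>z. cut n (h z)) \<in> borel_measurable std_gaussian" for n by auto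
    show "AE z in std_gaussian. norm (cut n (h z)) \<le> 1 + h z" for n
      using cut_le[OF h(2)] by (auto intro!: AE_I2 simp: less_imp_le)
  qed (use h cut_lim in \<open>auto intro!: expgrowth_integrable\<close>)
  have nn: "0 \<le> integral\<^sup>L std_gaussian f" "0 \<le> integral\<^sup>L std_gaussian g"
    using f g by (auto intro!: integral_nonneg_AE)
  have nnc: "0 \<le> (\<integral>z. cut n (h z) \<partial>std_gaussian)" if "\<And>x. 0 \<le> h x" for n h
    using cut_le(2)[OF that] by (intro integral_nonneg_AE) (auto intro: less_imp_le)
  have "(\<lambda>n. (\<integral>z. cut n (f z) \<partial>std_gaussian) powr \<alpha> * (\<integral>z. cut n (g z) \<partial>std_gaussian) powr \<beta>) \<longlonglongrightarrow>
     integral\<^sup>L std_gaussian f powr \<alpha> * integral\<^sup>L std_gaussian g powr \<beta>"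
    using f g \<alpha> \<beta> nnc by (intro tendsto_mult tendsto_powr2 L tendsto_const) (auto intro!: always_eventually)
  from LIMSEQ_le[OF L1 this] step show ?thesis by auto
qed

section \<open>Hypercontractivity for Hermite sums\<close>

lemma expgrowth_hermite_sum: "expgrowth (\<lambda>z. \<Sum>j<n. b j * hermite j z)"
  by (intro expgrowth_sum expgrowth_mult expgrowth_const expgrowth_hermite)

lemma continuous_hermite_sum: "continuous_on A (\<lambda>z. \<Sum>j<n. b j * hermite j z)"
  by (intro continuous_intros continuous_hermite)

text \<open>The sum \<open>G\<close> on the left is the Mehler average, with \<open>\<rho> = 1 / sqrt (p - 1)\<close>, of the sum \<open>F\<close> whose coefficients carry
the extra factors \<open>sqrt (p - 1) ^ j\<close>.  Writing \<open>\<bar>G\<bar> powr p\<close> as \<open>\<bar>G\<bar> powr (p - 2) * G\<close> times this average and applying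
the two-function inequality to \<open>\<bar>G\<bar> powr p\<close> and \<open>F\<^sup>2\<close> bounds the integral \<open>I\<close> by
\<open>I powr (1 - 1 / p)\<close> times the \<open>L\<^sup>2\<close> norm of \<open>F\<close>.\<close>

lemma hypercontractivity_gt_2:
  fixes p :: real and b :: "nat \<Rightarrow> real"
  assumes p: "2 < p"
  shows "(\<integral>z. \<bar>\<Sum>j<n. b j * hermite j z\<bar> powr p \<partial>std_gaussian) \<le> (\<Sum>j<n. (p - 1) ^ j * (b j)\<^sup>2 * fact j) powr (p / 2)"
proof -
  define \<rho> where "\<rho> = 1 / sqrt (p - 1)"
  define G where "G z = (\<Sum>j<n. b j * hermite j z)" for z
  define F where "F z = (\<Sum>j<n. (b j * sqrt (p - 1) ^ j) * hermite j z)" for z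
  let ?Z = "\<lambda>q. \<rho> * fst q + sqrt (1 - \<rho>\<^sup>2) * snd q"
  have \<rho>2: "\<rho>\<^sup>2 = 1 / (p - 1)" using p by (simp add: \<rho>_def power_divide)
  have \<rho>: "0 \<le> \<rho>" "\<rho> \<le> 1" "\<rho>\<^sup>2 \<le> 1" using p by (auto simp: \<rho>_def power_divide)
  have egG: "expgrowth G" and egF: "expgrowth F"
    unfolding G_def F_def by (rule expgrowth_hermite_sum)+
  have cG: "continuous_on UNIV G" and cF: "continuous_on UNIV F"
    unfolding G_def F_def by (rule continuous_hermite_sum)+
  have [measurable]: "G \<in> borel_measurable borel" "F \<in> borel_measurable borel"
    using egG egF by (auto simp: expgrowth_measurable)
  have FG: "(\<integral>w. F (\<rho> * z + sqrt (1 - \<rho>\<^sup>2) * w) \<partial>std_gaussian) = G z" for z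
  proof -
    have "integrable std_gaussian (\<lambda>w. hermite j (\<rho> * z + sqrt (1 - \<rho>\<^sup>2) * w))" for j
      by (intro expgrowth_integrable expgrowth_affine expgrowth_hermite)
    then have "(\<integral>w. F (\<rho> * z + sqrt (1 - \<rho>\<^sup>2) * w) \<partial>std_gaussian) =
       (\<Sum>j<n. (b j * sqrt (p - 1) ^ j) * (\<rho> ^ j * hermite j z))"
      unfolding F_def by (simp add: hermite_mehler \<rho>)
    also have "\<dots> = G z" unfolding G_def
    proof (intro sum.cong refl)
      fix j
      have "sqrt (p - 1) ^ j * \<rho> ^ j = 1" using p by (simp add: \<rho>_def flip: power_mult_distrib)
      then show "b j * sqrt (p - 1) ^ j * (\<rho> ^ j * hermite j z) = b j * hermite j z" by simp
    qed
    finally show ?thesis .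
  qed
  define I where "I = (\<integral>z. \<bar>G z\<bar> powr p \<partial>std_gaussian)"
  define J where "J = (\<integral>z. (F z)\<^sup>2 \<partial>std_gaussian)"
  define H where "H z = \<bar>G z\<bar> powr (p - 2) * G z" for z
  have egH: "expgrowth H" unfolding H_def using p by (intro expgrowth_mult expgrowth_abs_powr egG) auto
  have HG: "H z * G z = \<bar>G z\<bar> powr p" for z
  proof (cases "G z = 0")
    case False
    have "H z * G z = \<bar>G z\<bar> powr (p - 2) * \<bar>G z\<bar>\<^sup>2" by (simp add: H_def power2_eq_square mult.assoc)
    also have "\<bar>G z\<bar>\<^sup>2 = \<bar>G z\<bar> powr 2" using False by simp
    also have "\<bar>G z\<bar> powr (p - 2) * \<bar>G z\<bar> powr 2 = \<bar>G z\<bar> powr p" by (simp only: powr_add[symmetric]) simp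
    finally show ?thesis .
  qed (use p in \<open>simp add: H_def\<close>)
  have absH: "\<bar>H z\<bar> = (\<bar>G z\<bar> powr p) powr (1 - 1 / p)" for z
  proof -
    have "\<bar>H z\<bar> = \<bar>G z\<bar> powr (p - 2) * \<bar>G z\<bar> powr 1" by (simp add: H_def abs_mult)
    also have "\<dots> = \<bar>G z\<bar> powr (p - 1)" by (simp only: powr_add[symmetric]) simp
    also have "\<dots> = (\<bar>G z\<bar> powr p) powr (1 - 1 / p)" using p by (simp add: powr_powr right_diff_distrib)
    finally show ?thesis .
  qed
  have iHF: "integrable gauss2 (\<lambda>q. H (fst q) * F (?Z q))"
    by (rule expgrowth_rotation_integrable[OF egH egF \<rho>(3)])
  have "I = (\<integral>z. H z * (\<integral>w. F (\<rho> * z + sqrt (1 - \<rho>\<^sup>2) * w) \<partial>std_gaussian) \<partial>std_gaussian)"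
    unfolding I_def FG HG ..
  also have "\<dots> = (\<integral>q. H (fst q) * F (?Z q) \<partial>gauss2)"
    using gauss2.integral_fst'[OF iHF] by simp
  also have "\<dots> \<le> (\<integral>q. \<bar>H (fst q) * F (?Z q)\<bar> \<partial>gauss2)"
    using iHF by (intro integral_mono) auto
  also have "\<dots> = (\<integral>q. (\<bar>G (fst q)\<bar> powr p) powr (1 - 1 / p) * ((F (?Z q))\<^sup>2) powr (1 / 2) \<partial>gauss2)"
    by (simp add: abs_mult absH powr_half_sqrt)
  also have "\<dots> \<le> I powr (1 - 1 / p) * J powr (1 / 2)"
    unfolding I_def J_def
  proof (rule two_function_hypercontractivity)
    show "\<rho>\<^sup>2 * ((1 - 1 / p) * (1 / 2)) \<le> (1 - (1 - 1 / p)) * (1 - 1 / 2)"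
      using p by (simp add: \<rho>2 field_simps)
    show "continuous_on UNIV (\<lambda>z. \<bar>G z\<bar> powr p)"
      using p by (intro continuous_on_powr' continuous_intros cG) auto
    show "continuous_on UNIV (\<lambda>z. (F z)\<^sup>2)" by (intro continuous_intros cF)
    show "expgrowth (\<lambda>z. \<bar>G z\<bar> powr p)" using p by (intro expgrowth_abs_powr egG) auto
    show "expgrowth (\<lambda>z. (F z)\<^sup>2)" by (intro expgrowth_power egF)
  qed (use p \<rho> in auto)
  finally have le: "I \<le> I powr (1 - 1 / p) * J powr (1 / 2)" .
  have J: "J = (\<Sum>j<n. (p - 1) ^ j * (b j)\<^sup>2 * fact j)"
    unfolding J_def F_def hermite_sum_norm
  proof (intro sum.cong refl)
    fix j
    have "(sqrt (p - 1) ^ j)\<^sup>2 = ((sqrt (p - 1))\<^sup>2) ^ j" by (simp only: power_mult[symmetric] mult.commute)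
    then have "(sqrt (p - 1) ^ j)\<^sup>2 = (p - 1) ^ j" using p by simp
    then show "(b j * sqrt (p - 1) ^ j)\<^sup>2 * fact j = (p - 1) ^ j * (b j)\<^sup>2 * fact j"
      by (simp add: power_mult_distrib ac_simps)
  qed
  have "0 \<le> I" unfolding I_def by (intro integral_nonneg_AE) auto
  have "0 \<le> J" unfolding J_def by (intro integral_nonneg_AE) auto
  have "I \<le> J powr (p / 2)"
  proof (cases "I = 0")
    case False
    with \<open>0 \<le> I\<close> have I: "0 < I" by simp
    then have "I powr (1 / p) * I powr (1 - 1 / p) = I" by (simp flip: powr_add)
    with le I have "I powr (1 / p) \<le> J powr (1 / 2)"
      by (metis mult.commute mult_le_cancel_left_pos powr_gt_zero less_irrefl)
    then have "(I powr (1 / p)) powr p \<le> (J powr (1 / 2)) powr p"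
      using p by (intro powr_mono2) auto
    then show ?thesis using p I by (simp add: powr_powr)
  qed simp
  then show ?thesis unfolding I_def G_def J .
qed

text \<open>For \<open>p \<le> 2\<close> this is the inclusion of \<open>L\<^sup>2\<close> in \<open>L\<^sup>p\<close> together with orthogonality.\<close>

lemma hypercontractivity:
  fixes p :: real and b :: "nat \<Rightarrow> real"
  assumes p: "1 \<le> p"
  shows "(\<integral>z. \<bar>\<Sum>j<n. b j * hermite j z\<bar> powr p \<partial>std_gaussian) \<le>
    (\<Sum>j<n. max 1 (p - 1) ^ j * (b j)\<^sup>2 * fact j) powr (p / 2)"
proof (cases "2 < p")
  case True
  then show ?thesis using hypercontractivity_gt_2[OF True, of b n] by (simp add: max_def)
next
  case False
  define G where "G z = (\<Sum>j<n. b j * hermite j z)" for z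
  have eg: "expgrowth G" unfolding G_def by (rule expgrowth_hermite_sum)
  define J where "J = (\<integral>z. (G z)\<^sup>2 \<partial>std_gaussian)"
  have J: "J = (\<Sum>j<n. max 1 (p - 1) ^ j * (b j)\<^sup>2 * fact j)"
    using False unfolding J_def G_def hermite_sum_norm by (simp add: max_def)
  have iJ: "integrable std_gaussian (\<lambda>z. (G z)\<^sup>2)" by (intro expgrowth_integrable expgrowth_power eg)
  have ip: "integrable std_gaussian (\<lambda>z. \<bar>G z\<bar> powr p)"
    using p by (intro expgrowth_integrable expgrowth_abs_powr eg) auto
  have J0: "0 \<le> J" unfolding J_def by (intro integral_nonneg_AE) auto
  \<comment> \<open>The positive \<open>e\<close> allows division by \<open>J + e\<close>, also when \<open>G\<close> vanishes.\<close>
  have "(\<integral>z. \<bar>G z\<bar> powr p \<partial>std_gaussian) \<le> (J + e) powr (p / 2)" if e: "0 < e" for e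
  proof -
    let ?c = "J + e"
    have c: "0 < ?c" using J0 e by simp
    have "\<bar>G z\<bar> powr p \<le> ?c powr (p / 2) * (1 + p / 2 * ((G z)\<^sup>2 / ?c - 1))" for z
    proof -
      let ?y = "(G z)\<^sup>2 / ?c"
      have y: "0 \<le> ?y" using c by simp
      have "?y powr (p / 2) \<le> 1 + p / 2 * (?y - 1)"
      proof (cases "?y = 0")
        case True
        then show ?thesis unfolding True using False p by simp
      next
        case yn: False
        have y0: "0 < ?y" using y yn by (simp only: order_less_le) auto
        have "?y powr (p / 2) * 1 powr (1 - p / 2) \<le> p / 2 * ?y + (1 - p / 2) * 1"
          by (rule Youngs_inequality_0[OF _ _ _ y0]) (use False p in auto)
        then show ?thesis by (simp add: algebra_simps)
      qed
      moreover have "\<bar>G z\<bar> powr p = ?c powr (p / 2) * ?y powr (p / 2)"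
      proof -
        have "(G z)\<^sup>2 = \<bar>G z\<bar> powr 2" by (cases "G z = 0") auto
        then have "\<bar>G z\<bar> powr p = ((G z)\<^sup>2) powr (p / 2)" by (simp only: powr_powr) simp
        also have "(G z)\<^sup>2 = ?c * ?y" using c by simp
        also have "(?c * ?y) powr (p / 2) = ?c powr (p / 2) * ?y powr (p / 2)"
          by (rule powr_mult)
        finally show ?thesis .
      qed
      ultimately show ?thesis using mult_left_mono by fastforce
    qed
    then have "(\<integral>z. \<bar>G z\<bar> powr p \<partial>std_gaussian) \<le> (\<integral>z. ?c powr (p / 2) * (1 + p / 2 * ((G z)\<^sup>2 / ?c - 1)) \<partial>std_gaussian)"
      using iJ ip by (intro integral_mono) auto
    also have "\<dots> = ?c powr (p / 2) * (1 + p / 2 * (J / ?c - 1))"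
      using iJ gauss.prob_space by (simp add: J_def)
    also have "\<dots> \<le> ?c powr (p / 2) * 1"
      using p J0 e by (intro mult_left_mono) (auto simp: mult_le_0_iff)
    finally show ?thesis by simp
  qed
  moreover have "(\<lambda>k. (J + 1 / real (Suc k)) powr (p / 2)) \<longlonglongrightarrow> (J + 0) powr (p / 2)"
    using p J0 by (intro tendsto_powr2 tendsto_add tendsto_const LIMSEQ_Suc[OF lim_1_over_n])
      (auto intro!: always_eventually add_nonneg_nonneg)
  ultimately have "(\<integral>z. \<bar>G z\<bar> powr p \<partial>std_gaussian) \<le> (J + 0) powr (p / 2)"
    by (rule_tac LIMSEQ_le_const) auto
  then have "(\<integral>z. \<bar>G z\<bar> powr p \<partial>std_gaussian) \<le> J powr (p / 2)" by simp
  then show ?thesis unfolding G_def J .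
qed

section \<open>Minkowski's integral inequality\<close>

lemma ennreal_powr_measurable [measurable (raw)]:
  assumes [measurable]: "f \<in> borel_measurable M"
  shows "(\<lambda>x. ennreal_powr (f x) a) \<in> borel_measurable M"
  unfolding ennreal_powr_def by measurable

lemma ennreal_powr_ennreal: "0 \<le> x \<Longrightarrow> ennreal_powr (ennreal x) a = ennreal (x powr a)"
  by (simp add: ennreal_powr_def)

lemma ennreal_powr_top [simp]: "ennreal_powr \<top> a = \<top>"
  by (simp add: ennreal_powr_def)

lemma ennreal_powr_0 [simp]: "ennreal_powr 0 a = 0"
  by (simp add: ennreal_powr_def)

lemma ennreal_powr_mono:
  assumes "x \<le> y" "0 \<le> a"
  shows "ennreal_powr x a \<le> ennreal_powr y a"
proof (cases y)
  case (real r)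
  with assms obtain s where s: "x = ennreal s" "0 \<le> s" by (cases x) (auto simp: top_unique)
  have "s \<le> r" using assms(1) s real by simp
  then show ?thesis using s real assms(2) by (simp add: ennreal_powr_ennreal ennreal_leI powr_mono2)
qed simp

lemma ennreal_powr_powr:
  assumes "a * b = 1"
  shows "ennreal_powr (ennreal_powr x a) b = x"
proof (cases x)
  case (real r)
  with assms show ?thesis
    by (cases "r = 0") (auto simp: ennreal_powr_ennreal powr_powr)
qed simp

text \<open>Young's inequality for the numbers \<open>y * b powr (1 / p - 1)\<close> and \<open>b powr (1 - 1 / p)\<close>.\<close>

lemma young_powr:
  fixes y b p :: real
  assumes "0 \<le> y" "0 < b" "1 \<le> p"
  shows "y \<le> 1 / p * (y powr p * b powr (1 - p)) + (1 - 1 / p) * b"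
proof (cases "y = 0")
  case False
  with assms have y: "0 < y" by simp
  have "(y powr p * b powr (1 - p)) powr (1 / p) * b powr (1 - 1 / p) \<le> 1 / p * (y powr p * b powr (1 - p)) + (1 - 1 / p) * b"
    using y assms by (intro Youngs_inequality_0) auto
  also have "(y powr p * b powr (1 - p)) powr (1 / p) = y * b powr ((1 - p) / p)"
    using y assms by (simp add: powr_mult powr_powr)
  also have "y * b powr ((1 - p) / p) * b powr (1 - 1 / p) = y * b powr ((1 - p) / p + (1 - 1 / p))"
    by (simp add: powr_add)
  also have "(1 - p) / p + (1 - 1 / p) = 0" using assms by (simp add: field_simps)
  finally show ?thesis using assms by simp
qed (use assms in auto)

text \<open>Jensen's inequality for the probability density \<open>n / \<Lambda>\<close>, applied to \<open>g / n\<close>.  The proof integrates Young's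
inequality with \<open>b = c * n r\<close> and chooses \<open>c\<close> optimally.\<close>

lemma integral_powr_le:
  fixes g n :: "real \<Rightarrow> real" and \<Lambda> p :: real
  assumes p: "1 \<le> p" and [measurable]: "g \<in> borel_measurable borel" "n \<in> borel_measurable borel"
    and g: "\<And>r. 0 \<le> g r" and n: "\<And>r. 0 < n r"
    and \<Lambda>: "(\<integral>\<^sup>+r. ennreal (n r) \<partial>lborel) = ennreal \<Lambda>" "0 < \<Lambda>"
  shows "ennreal_powr (\<integral>\<^sup>+r. ennreal (g r) \<partial>lborel) p \<le>
    ennreal (\<Lambda> powr (p - 1)) * (\<integral>\<^sup>+r. ennreal (g r powr p * n r powr (1 - p)) \<partial>lborel)"
proof (cases "\<integral>\<^sup>+r. ennreal (g r powr p * n r powr (1 - p)) \<partial>lborel")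
  case top
  then show ?thesis using \<Lambda>(2) by (simp add: ennreal_mult_top)
next
  case (real k)
  have *: "ennreal_powr (\<integral>\<^sup>+r. ennreal (g r) \<partial>lborel) p \<le> ennreal (\<Lambda> powr (p - 1) * (k + d))" if d: "0 < d" for d
  proof -
    \<comment> \<open>Minimises the right-hand side of the integrated inequality; \<open>d\<close> keeps \<open>c\<close> positive when \<open>k = 0\<close>.\<close>
    define c where "c = ((k + d) / \<Lambda>) powr (1 / p)"
    have kd: "0 < k + d" using real d by simp
    have c: "0 < c" using kd \<Lambda> by (simp add: c_def)
    have cp: "c powr p = (k + d) / \<Lambda>" using kd \<Lambda> p by (simp add: c_def powr_powr)
    have c1p: "c powr (1 - p) = c * (\<Lambda> / (k + d))"
      using c kd \<Lambda> by (simp add: powr_diff cp)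
    have lin: "ennreal (A * B + C * D) = ennreal A * ennreal B + ennreal C * ennreal D"
      if "0 \<le> A" "0 \<le> B" "0 \<le> C" "0 \<le> D" for A B C D
      using that by (simp add: ennreal_plus ennreal_mult)
    have "(\<integral>\<^sup>+r. ennreal (g r) \<partial>lborel) \<le>
       (\<integral>\<^sup>+r. ennreal (1 / p * c powr (1 - p)) * ennreal (g r powr p * n r powr (1 - p)) + ennreal ((1 - 1 / p) * c) * ennreal (n r) \<partial>lborel)"
    proof (rule nn_integral_mono)
      fix r
      have "g r \<le> 1 / p * (g r powr p * (c * n r) powr (1 - p)) + (1 - 1 / p) * (c * n r)"
        using g n c p by (intro young_powr) auto
      also have "(c * n r) powr (1 - p) = c powr (1 - p) * n r powr (1 - p)" by (rule powr_mult)
      finally have "g r \<le> (1 / p * c powr (1 - p)) * (g r powr p * n r powr (1 - p)) + ((1 - 1 / p) * c) * n r"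
        by (simp add: ac_simps)
      then have "ennreal (g r) \<le> ennreal ((1 / p * c powr (1 - p)) * (g r powr p * n r powr (1 - p)) + ((1 - 1 / p) * c) * n r)"
        by (rule ennreal_leI)
      also have "\<dots> = ennreal (1 / p * c powr (1 - p)) * ennreal (g r powr p * n r powr (1 - p)) + ennreal ((1 - 1 / p) * c) * ennreal (n r)"
        by (rule lin) (use p c n[of r] in \<open>simp_all add: less_imp_le\<close>)
      finally show "ennreal (g r) \<le> \<dots>" .
    qed
    also have "\<dots> = ennreal (1 / p * c powr (1 - p)) * ennreal k + ennreal ((1 - 1 / p) * c) * ennreal \<Lambda>"
      using real by (simp add: nn_integral_add nn_integral_cmult \<Lambda>)
    also have "\<dots> = ennreal (1 / p * c powr (1 - p) * k + (1 - 1 / p) * c * \<Lambda>)"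
      by (rule lin[symmetric]) (use real p c \<Lambda>(2) in \<open>simp_all add: less_imp_le\<close>)
    also have "\<dots> \<le> ennreal (c * \<Lambda>)"
    proof (rule ennreal_leI)
      have "1 / p * c powr (1 - p) * k \<le> 1 / p * c powr (1 - p) * (k + d)"
        using p d by (intro mult_left_mono) auto
      also have "\<dots> = 1 / p * (c * \<Lambda>)" using kd by (simp add: c1p)
      finally show "1 / p * c powr (1 - p) * k + (1 - 1 / p) * c * \<Lambda> \<le> c * \<Lambda>" by (simp add: algebra_simps)
    qed
    finally have "ennreal_powr (\<integral>\<^sup>+r. ennreal (g r) \<partial>lborel) p \<le> ennreal_powr (ennreal (c * \<Lambda>)) p"
      using p by (intro ennreal_powr_mono) auto
    also have "\<dots> = ennreal ((c * \<Lambda>) powr p)"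
      using c \<Lambda> by (simp add: ennreal_powr_ennreal)
    also have "(c * \<Lambda>) powr p = (k + d) / \<Lambda> * \<Lambda> powr p" by (simp add: powr_mult cp)
    also have "\<dots> = \<Lambda> powr (p - 1) * (k + d)" using \<Lambda> by (simp add: powr_diff)
    finally show ?thesis .
  qed
  have "(\<lambda>m. ennreal (\<Lambda> powr (p - 1) * (k + 1 / real (Suc m)))) \<longlonglongrightarrow> ennreal (\<Lambda> powr (p - 1) * (k + 0))"
    by (intro tendsto_ennrealI tendsto_intros LIMSEQ_Suc[OF lim_1_over_n])
  then have "ennreal_powr (\<integral>\<^sup>+r. ennreal (g r) \<partial>lborel) p \<le> ennreal (\<Lambda> powr (p - 1) * (k + 0))"
    by (rule LIMSEQ_le_const) (auto intro!: * exI[of _ 0])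
  then show ?thesis using real by (simp add: ennreal_mult)
qed

text \<open>With \<open>n r\<close> a bound of the norm of \<open>g r\<close>, integrating \<open>integral_powr_le\<close> over \<open>u\<close> cancels the powers of \<open>n\<close>.\<close>

lemma minkowski_integral_bound:
  fixes g :: "real \<Rightarrow> 'a \<Rightarrow> real" and n :: "real \<Rightarrow> real" and \<Lambda> p :: real
  assumes "sigma_finite_measure P" and p: "1 \<le> p"
    and g_meas [measurable]: "(\<lambda>(r, u). g r u) \<in> borel_measurable (borel \<Otimes>\<^sub>M P)"
    and [measurable]: "n \<in> borel_measurable borel"
    and g: "\<And>r u. 0 \<le> g r u" and n: "\<And>r. 0 < n r"
    and \<Lambda>: "(\<integral>\<^sup>+r. ennreal (n r) \<partial>lborel) = ennreal \<Lambda>" "0 < \<Lambda>"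
    and le: "AE r in lborel. (\<integral>\<^sup>+u. ennreal (g r u powr p) \<partial>P) \<le> ennreal (n r powr p)"
  shows "(\<integral>\<^sup>+u. ennreal_powr (\<integral>\<^sup>+r. ennreal (g r u) \<partial>lborel) p \<partial>P) \<le> ennreal (\<Lambda> powr p)"
proof -
  interpret P: sigma_finite_measure P by fact
  interpret LP: pair_sigma_finite lborel P ..
  have gm [measurable]: "(\<lambda>(r, u). g r u) \<in> borel_measurable (lborel \<Otimes>\<^sub>M P)"
    using g_meas by (simp cong: measurable_cong_sets add: sets_pair_measure_cong[OF sets_lborel refl])
  have "(\<integral>\<^sup>+u. ennreal_powr (\<integral>\<^sup>+r. ennreal (g r u) \<partial>lborel) p \<partial>P) \<le>
     (\<integral>\<^sup>+u. ennreal (\<Lambda> powr (p - 1)) * (\<integral>\<^sup>+r. ennreal (g r u powr p * n r powr (1 - p)) \<partial>lborel) \<partial>P)"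
    by (intro nn_integral_mono integral_powr_le p g n \<Lambda>) measurable
  also have "\<dots> = ennreal (\<Lambda> powr (p - 1)) * (\<integral>\<^sup>+u. (\<integral>\<^sup>+r. ennreal (g r u powr p * n r powr (1 - p)) \<partial>lborel) \<partial>P)"
    by (rule nn_integral_cmult) measurable
  also have "(\<integral>\<^sup>+u. (\<integral>\<^sup>+r. ennreal (g r u powr p * n r powr (1 - p)) \<partial>lborel) \<partial>P) =
     (\<integral>\<^sup>+r. (\<integral>\<^sup>+u. ennreal (g r u powr p * n r powr (1 - p)) \<partial>P) \<partial>lborel)"
    by (rule LP.Fubini') measurable
  also have "\<dots> = (\<integral>\<^sup>+r. ennreal (n r powr (1 - p)) * (\<integral>\<^sup>+u. ennreal (g r u powr p) \<partial>P) \<partial>lborel)"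
    by (intro nn_integral_cong) (simp add: ennreal_mult' mult.commute flip: nn_integral_cmult)
  also have "\<dots> \<le> (\<integral>\<^sup>+r. ennreal (n r) \<partial>lborel)"
  proof (rule nn_integral_mono_AE)
    show "AE r in lborel. ennreal (n r powr (1 - p)) * (\<integral>\<^sup>+u. ennreal (g r u powr p) \<partial>P) \<le> ennreal (n r)"
      using le
    proof eventually_elim
      case (elim r)
      have "ennreal (n r powr (1 - p)) * (\<integral>\<^sup>+u. ennreal (g r u powr p) \<partial>P) \<le> ennreal (n r powr (1 - p)) * ennreal (n r powr p)"
        by (rule mult_left_mono[OF elim]) simp
      also have "\<dots> = ennreal (n r)"
        using n[of r] by (simp flip: ennreal_mult powr_add)
      finally show ?case .
    qed
  qed
  finally have "(\<integral>\<^sup>+u. ennreal_powr (\<integral>\<^sup>+r. ennreal (g r u) \<partial>lborel) p \<partial>P) \<le> ennreal (\<Lambda> powr (p - 1)) * ennreal \<Lambda>"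
    by (simp add: \<Lambda> mult_left_mono)
  also have "\<dots> = ennreal (\<Lambda> powr p)"
    using \<Lambda>(2) by (simp add: powr_diff flip: ennreal_mult)
  finally show ?thesis .
qed

text \<open>The norm of \<open>g r\<close> may vanish for some \<open>r\<close>, so it is increased by a small multiple of a positive
integrable function before it is used as a weight.\<close>

lemma minkowski_integral:
  fixes g :: "real \<Rightarrow> 'a \<Rightarrow> real" and p :: real
  assumes "sigma_finite_measure P" and p: "1 \<le> p"
    and g_meas [measurable]: "(\<lambda>(r, u). g r u) \<in> borel_measurable (borel \<Otimes>\<^sub>M P)"
    and g: "\<And>r u. 0 \<le> g r u"
  shows "(\<integral>\<^sup>+u. ennreal_powr (\<integral>\<^sup>+r. ennreal (g r u) \<partial>lborel) p \<partial>P) \<le>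
    ennreal_powr (\<integral>\<^sup>+r. ennreal_powr (\<integral>\<^sup>+u. ennreal (g r u powr p) \<partial>P) (1 / p) \<partial>lborel) p"
proof -
  interpret P: sigma_finite_measure P by fact
  define N where "N r = ennreal_powr (\<integral>\<^sup>+u. ennreal (g r u powr p) \<partial>P) (1 / p)" for r
  have [measurable]: "N \<in> borel_measurable borel" unfolding N_def by measurable
  show ?thesis
  proof (cases "\<integral>\<^sup>+r. N r \<partial>lborel")
    case top
    then show ?thesis by (simp add: N_def)
  next
    case (real \<Lambda>)
    have fin: "AE r in lborel. N r \<noteq> \<top>"
      using nn_integral_PInf_AE[of N lborel] real by simp
    have bound: "(\<integral>\<^sup>+u. ennreal_powr (\<integral>\<^sup>+r. ennreal (g r u) \<partial>lborel) p \<partial>P) \<le> ennreal ((\<Lambda> + e) powr p)" if e: "0 < e" for e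
    proof -
      define n where "n r = enn2real (N r) + e * std_normal_density r" for r
      show ?thesis
      proof (rule minkowski_integral_bound[where n=n])
        show "n \<in> borel_measurable borel" unfolding n_def by measurable
        show "0 < n r" for r using e by (simp add: n_def add_nonneg_pos normal_density_pos)
        have "(\<integral>\<^sup>+r. ennreal (n r) \<partial>lborel) = (\<integral>\<^sup>+r. N r + ennreal e * ennreal (std_normal_density r) \<partial>lborel)"
        proof (rule nn_integral_cong_AE)
          show "AE r in lborel. ennreal (n r) = N r + ennreal e * ennreal (std_normal_density r)"
            using fin by eventually_elim
              (use e in \<open>auto simp: n_def ennreal_plus ennreal_mult ennreal_enn2real_if less_top\<close>)
        qed
        also have "\<dots> = ennreal \<Lambda> + ennreal e * (\<integral>\<^sup>+r. ennreal (std_normal_density r) \<partial>lborel)"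
          using real by (simp add: nn_integral_add nn_integral_cmult)
        also have "(\<integral>\<^sup>+r. ennreal (std_normal_density r) \<partial>lborel) = 1"
          using gauss.emeasure_space_1 by (simp add: std_gaussian_def emeasure_density)
        finally show "(\<integral>\<^sup>+r. ennreal (n r) \<partial>lborel) = ennreal (\<Lambda> + e)"
          using e real by (simp add: ennreal_plus)
        show "0 < \<Lambda> + e" using e real by simp
        show "AE r in lborel. (\<integral>\<^sup>+u. ennreal (g r u powr p) \<partial>P) \<le> ennreal (n r powr p)"
          using fin
        proof eventually_elim
          case (elim r)
          have "(\<integral>\<^sup>+u. ennreal (g r u powr p) \<partial>P) = ennreal_powr (N r) p"
            unfolding N_def using p by (simp add: ennreal_powr_powr)
          also have "\<dots> \<le> ennreal_powr (ennreal (n r)) p"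
            using elim e p by (intro ennreal_powr_mono)
              (auto simp: n_def ennreal_plus ennreal_enn2real_if less_top)
          also have "\<dots> = ennreal (n r powr p)"
            using e by (intro ennreal_powr_ennreal) (simp add: n_def)
          finally show ?case .
        qed
      qed (use assms in auto)
    qed
    have "(\<lambda>m. ennreal ((\<Lambda> + 1 / real (Suc m)) powr p)) \<longlonglongrightarrow> ennreal ((\<Lambda> + 0) powr p)"
      using real p by (intro tendsto_ennrealI tendsto_powr2 tendsto_intros LIMSEQ_Suc[OF lim_1_over_n])
        (auto intro!: always_eventually)
    then have "(\<integral>\<^sup>+u. ennreal_powr (\<integral>\<^sup>+r. ennreal (g r u) \<partial>lborel) p \<partial>P) \<le> ennreal ((\<Lambda> + 0) powr p)"
      by (rule LIMSEQ_le_const) (auto intro!: bound exI[of _ 0])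
    then show ?thesis using real by (simp add: N_def ennreal_powr_ennreal)
  qed
qed

section \<open>The Ornstein-Uhlenbeck flow on the line\<close>

text \<open>Differentiation under the integral sign under a locally uniform integrable bound of the derivative.\<close>

lemma has_field_derivative_integral:
  fixes f f' :: "real \<Rightarrow> 'a \<Rightarrow> real"
  assumes \<delta>: "0 < \<delta>"
    and int: "\<And>x. \<bar>x - x0\<bar> < \<delta> \<Longrightarrow> integrable M (f x)"
    and deriv: "\<And>x \<omega>. \<bar>x - x0\<bar> < \<delta> \<Longrightarrow> \<omega> \<in> space M \<Longrightarrow> ((\<lambda>x. f x \<omega>) has_real_derivative f' x \<omega>) (at x)"
    and bd: "\<And>x \<omega>. \<bar>x - x0\<bar> < \<delta> \<Longrightarrow> \<omega> \<in> space M \<Longrightarrow> \<bar>f' x \<omega>\<bar> \<le> w \<omega>"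
    and w: "integrable M w" and meas: "f' x0 \<in> borel_measurable M"
  shows "((\<lambda>x. \<integral>\<omega>. f x \<omega> \<partial>M) has_real_derivative (\<integral>\<omega>. f' x0 \<omega> \<partial>M)) (at x0)"
  unfolding has_field_derivative_iff
proof (subst tendsto_at_iff_sequentially, intro allI impI)
  fix X :: "nat \<Rightarrow> real"
  assume X: "\<forall>i. X i \<in> UNIV - {x0}" "X \<longlonglongrightarrow> x0"
  from X(2) \<delta> obtain N where N: "\<And>n. N \<le> n \<Longrightarrow> \<bar>X n - x0\<bar> < \<delta>"
    unfolding lim_sequentially dist_real_def by meson
  define Y where "Y n = X (n + N)" for n
  have Y: "\<bar>Y n - x0\<bar> < \<delta>" "Y n \<noteq> x0" for n using N[of "n + N"] X(1) by (auto simp: Y_def)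
  have Yl: "Y \<longlonglongrightarrow> x0" unfolding Y_def[abs_def] by (rule LIMSEQ_ignore_initial_segment[OF X(2)])
  have x0: "\<bar>x0 - x0\<bar> < \<delta>" using \<delta> by simp
  have "(\<lambda>n. \<integral>\<omega>. (f (Y n) \<omega> - f x0 \<omega>) / (Y n - x0) \<partial>M) \<longlonglongrightarrow> (\<integral>\<omega>. f' x0 \<omega> \<partial>M)"
  proof (rule integral_dominated_convergence[where w=w])
    show "(\<lambda>\<omega>. (f (Y n) \<omega> - f x0 \<omega>) / (Y n - x0)) \<in> borel_measurable M" for n
      using int[OF Y(1)[of n]] int[OF x0] by measurable
    show "AE \<omega> in M. (\<lambda>n. (f (Y n) \<omega> - f x0 \<omega>) / (Y n - x0)) \<longlonglongrightarrow> f' x0 \<omega>"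
    proof (rule AE_I2)
      fix \<omega> assume "\<omega> \<in> space M"
      from deriv[OF x0 this] have "((\<lambda>y. (f y \<omega> - f x0 \<omega>) / (y - x0)) \<longlongrightarrow> f' x0 \<omega>) (at x0)"
        unfolding has_field_derivative_iff .
      from this[unfolded tendsto_at_iff_sequentially, rule_format, of Y] Y(2) Yl
      show "(\<lambda>n. (f (Y n) \<omega> - f x0 \<omega>) / (Y n - x0)) \<longlonglongrightarrow> f' x0 \<omega>" by (simp add: o_def)
    qed
    show "AE \<omega> in M. norm ((f (Y n) \<omega> - f x0 \<omega>) / (Y n - x0)) \<le> w \<omega>" for n
    proof (rule AE_I2)
      fix \<omega> assume \<omega>: "\<omega> \<in> space M"
      have "norm (f (Y n) \<omega> - f x0 \<omega>) \<le> w \<omega> * norm (Y n - x0)"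
      proof (rule field_differentiable_bound[of "{x0 - \<delta> <..< x0 + \<delta>}"])
        show "((\<lambda>x. f x \<omega>) has_field_derivative f' z \<omega>) (at z within {x0 - \<delta><..<x0 + \<delta>})"
          if "z \<in> {x0 - \<delta><..<x0 + \<delta>}" for z
          using deriv[of z \<omega>] that \<omega> by (auto simp: abs_less_iff intro: has_field_derivative_at_within)
        show "norm (f' z \<omega>) \<le> w \<omega>" if "z \<in> {x0 - \<delta><..<x0 + \<delta>}" for z
          using bd[of z \<omega>] that \<omega> by (auto simp: abs_less_iff)
      qed (use Y(1)[of n] \<delta> in \<open>auto simp: abs_less_iff\<close>)
      then show "norm ((f (Y n) \<omega> - f x0 \<omega>) / (Y n - x0)) \<le> w \<omega>"
        using Y(2)[of n] by (simp add: divide_le_eq)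
    qed
  qed (fact meas w)+
  then have "(\<lambda>n. ((\<integral>\<omega>. f (Y n) \<omega> \<partial>M) - (\<integral>\<omega>. f x0 \<omega> \<partial>M)) / (Y n - x0)) \<longlonglongrightarrow> (\<integral>\<omega>. f' x0 \<omega> \<partial>M)"
    using int[OF Y(1)] int[OF x0] by simp
  then have "(\<lambda>n. (\<lambda>m. ((\<integral>\<omega>. f (X m) \<omega> \<partial>M) - (\<integral>\<omega>. f x0 \<omega> \<partial>M)) / (X m - x0)) (n + N)) \<longlonglongrightarrow> (\<integral>\<omega>. f' x0 \<omega> \<partial>M)"
    by (simp add: Y_def)
  then show "((\<lambda>y. ((\<integral>\<omega>. f y \<omega> \<partial>M) - (\<integral>\<omega>. f x0 \<omega> \<partial>M)) / (y - x0)) \<circ> X) \<longlonglongrightarrow> (\<integral>\<omega>. f' x0 \<omega> \<partial>M)"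
    unfolding o_def by (rule LIMSEQ_offset)
qed

lemma std_normal_density_le_1: "std_normal_density z \<le> 1"
proof -
  have "1 \<le> sqrt (2 * pi)" using pi_gt3 by simp
  then have "1 / sqrt (2 * pi) * exp (- z\<^sup>2 / 2) \<le> 1 * 1"
    by (intro mult_mono) auto
  then show ?thesis by (simp add: std_normal_density_def)
qed

lemma abs_std_normal_density_le_1: "\<bar>z\<bar> * std_normal_density z \<le> 1"
proof -
  have "\<bar>z\<bar> \<le> 1 + z\<^sup>2 / 2"
    using zero_le_power2[of "\<bar>z\<bar> - 1"] by (simp add: power2_diff)
  also have "\<dots> \<le> exp (z\<^sup>2 / 2)" by (rule exp_ge_add_one_self)
  finally have "\<bar>z\<bar> * exp (- z\<^sup>2 / 2) \<le> 1" by (simp add: exp_minus field_simps)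
  moreover have "1 \<le> sqrt (2 * pi)" using pi_gt3 by simp
  ultimately have "1 / sqrt (2 * pi) * (\<bar>z\<bar> * exp (- z\<^sup>2 / 2)) \<le> 1 * 1"
    by (intro mult_mono) auto
  then show ?thesis by (simp add: std_normal_density_def)
qed

lemma cdf_std_gaussian_deriv: "(cdf std_gaussian has_real_derivative std_normal_density x) (at x)"
proof -
  have cont: "isCont std_normal_density z" for z by (rule DERIV_isCont[OF std_normal_density_deriv])
  have "(- \<infinity>::ereal) < \<infinity>" by simp
  from einterval_antiderivative[OF this, of std_normal_density] cont
  have "\<exists>F. \<forall>x. (F has_vector_derivative std_normal_density x) (at x)" by simp
  then obtain F where "\<forall>x. (F has_vector_derivative std_normal_density x) (at x)" ..
  then have F: "(F has_real_derivative std_normal_density x) (at x)" for x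
    unfolding has_real_derivative_iff_has_vector_derivative by simp
  have le: "cdf std_gaussian y - cdf std_gaussian x = F y - F x" if "x < y" for x y
  proof -
    have mono: "F x \<le> F y"
    proof (rule DERIV_nonneg_imp_nondecreasing[where f=F])
      show "\<exists>d. (F has_real_derivative d) (at z) \<and> 0 \<le> d" if "x \<le> z" "z \<le> y" for z
        using F[of z] normal_density_nonneg by blast
    qed (use that in simp)
    have d: "cdf std_gaussian y - cdf std_gaussian x = measure std_gaussian {x<..y}"
      by (rule gauss.cdf_diff_eq[OF that])
    have "emeasure std_gaussian {x<..y} = (\<integral>\<^sup>+z. ennreal (std_normal_density z) * indicator {x<..y} z \<partial>lborel)"
      unfolding std_gaussian_def by (rule emeasure_density) auto
    also have "\<dots> = (\<integral>\<^sup>+z. ennreal (std_normal_density z) * indicator {x..y} z \<partial>lborel)"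
      using AE_lborel_singleton[of x] by (intro nn_integral_cong_AE) (auto split: split_indicator)
    also have "\<dots> = ennreal (F y - F x)"
      by (rule nn_integral_FTC_Icc) (use that F in auto)
    finally have "emeasure std_gaussian {x<..y} = ennreal (F y - F x)" .
    then have "measure std_gaussian {x<..y} = F y - F x" using mono by (simp add: measure_def)
    with d show ?thesis by simp
  qed
  have "cdf std_gaussian = (\<lambda>y. F y + (cdf std_gaussian 0 - F 0))"
  proof
    fix y show "cdf std_gaussian y = F y + (cdf std_gaussian 0 - F 0)"
      using le[of 0 y] le[of y 0] by (cases "y < 0"; cases "y = 0") auto
  qed
  moreover have "((\<lambda>y. F y + (cdf std_gaussian 0 - F 0)) has_real_derivative std_normal_density x) (at x)"
    using F by (auto intro!: derivative_eq_intros)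
  ultimately show ?thesis by simp
qed

text \<open>The factor \<open>a\<close> in \<open>F\<^sub>t = exp (- t) * (X\<^sub>0 + a * Z)\<close>.\<close>

definition scale :: "real \<Rightarrow> real" where "scale t = sqrt (exp (2 * t) - 1)"

lemma scale_pos: "0 < t \<Longrightarrow> 0 < scale t"
  by (simp add: scale_def)

lemma scale_square: "0 < t \<Longrightarrow> (scale t)\<^sup>2 = exp (2 * t) - 1"
  by (simp add: scale_def)

lemma scale_mono: "s \<le> t \<Longrightarrow> scale s \<le> scale t"
  by (simp add: scale_def)

lemma scale_deriv: "0 < t \<Longrightarrow> (scale has_real_derivative exp (2 * t) / scale t) (at t)"
  unfolding scale_def by (auto intro!: derivative_eq_intros simp: field_simps)

text \<open>The value of \<open>Z\<close> for which \<open>F\<^sub>t = x\<close> when \<open>X\<^sub>0 = \<xi>\<close>.\<close>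

definition zeta :: "real \<Rightarrow> real \<Rightarrow> real \<Rightarrow> real" where
  "zeta t x \<xi> = (exp t * x - \<xi>) / scale t"

lemma zeta_deriv_x: "((\<lambda>x. zeta t x \<xi>) has_real_derivative exp t / scale t) (at x)"
  unfolding zeta_def by (rule DERIV_cdivide) (auto intro!: derivative_eq_intros)

lemma zeta_deriv_t:
  assumes "0 < t"
  shows "((\<lambda>t. zeta t x \<xi>) has_real_derivative (\<xi> - zeta t x \<xi> / scale t) / scale t) (at t)"
proof -
  let ?a = "scale t"
  have a: "0 < ?a" using assms by (rule scale_pos)
  have a2: "exp (2 * t) = ?a * ?a + 1" using scale_square[OF assms] by (simp add: power2_eq_square)
  have "((\<lambda>t. zeta t x \<xi>) has_real_derivative
     ((exp t * x) * ?a - (exp t * x - \<xi>) * (exp (2 * t) / ?a)) / (?a * ?a)) (at t)"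
    unfolding zeta_def using a
    by (auto intro!: derivative_eq_intros scale_deriv[OF assms])
  also have "((exp t * x) * ?a - (exp t * x - \<xi>) * (exp (2 * t) / ?a)) / (?a * ?a) =
      (\<xi> - zeta t x \<xi> / ?a) / ?a"
    unfolding a2 zeta_def using a by (simp add: field_simps)
  finally show ?thesis .
qed

text \<open>The density of \<open>F\<^sub>t\<close> at \<open>x\<close> when \<open>X\<^sub>0 = \<xi>\<close>.\<close>

definition qker :: "real \<Rightarrow> real \<Rightarrow> real \<Rightarrow> real" where
  "qker t x \<xi> = std_normal_density (zeta t x \<xi>) * (exp t / scale t)"

text \<open>The density of \<open>F\<^sub>t\<close> at \<open>x\<close> when \<open>X\<^sub>0 = \<xi>\<close>, weighted by the value of \<open>X\<^sub>0 - Z / a\<close>.\<close>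

definition rker :: "real \<Rightarrow> real \<Rightarrow> real \<Rightarrow> real" where
  "rker t x \<xi> = (\<xi> - zeta t x \<xi> / scale t) * qker t x \<xi>"

lemma qker_bound:
  assumes "0 < \<tau>" "\<tau> \<le> t" "t \<le> B"
  shows "\<bar>qker t x \<xi>\<bar> \<le> exp B / scale \<tau>"
proof -
  have a: "0 < scale \<tau>" "scale \<tau> \<le> scale t" using assms by (auto intro: scale_pos scale_mono)
  have "std_normal_density (zeta t x \<xi>) * (exp t / scale t) \<le> 1 * (exp B / scale \<tau>)"
    using a assms by (intro mult_mono std_normal_density_le_1 frac_le) auto
  then show ?thesis using a by (simp add: qker_def abs_mult)
qed

lemma rker_bound:
  assumes "0 < \<tau>" "\<tau> \<le> t" "t \<le> B"
  shows "\<bar>rker t x \<xi>\<bar> \<le> (\<bar>\<xi>\<bar> + 1 / scale \<tau>) * (exp B / scale \<tau>)"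
proof -
  let ?z = "zeta t x \<xi>"
  have a: "0 < scale \<tau>" "scale \<tau> \<le> scale t" using assms by (auto intro: scale_pos scale_mono)
  have at: "0 < scale t" using a by simp
  have "\<bar>(\<xi> - ?z / scale t) * std_normal_density ?z\<bar> \<le> \<bar>\<xi>\<bar> * std_normal_density ?z + \<bar>?z\<bar> * std_normal_density ?z / scale t"
  proof -
    have "\<bar>\<xi> - ?z / scale t\<bar> \<le> \<bar>\<xi>\<bar> + \<bar>?z\<bar> / scale t"
      using at abs_triangle_ineq4[of \<xi> "?z / scale t"] by simp
    from mult_right_mono[OF this, of "std_normal_density ?z"] show ?thesis
      by (simp add: abs_mult distrib_right)
  qed
  also have "\<dots> \<le> \<bar>\<xi>\<bar> * 1 + 1 / scale \<tau>"
    using a abs_std_normal_density_le_1[of ?z]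
    by (intro add_mono mult_left_mono std_normal_density_le_1 frac_le) auto
  finally have "\<bar>(\<xi> - ?z / scale t) * std_normal_density ?z\<bar> * (exp t / scale t) \<le> (\<bar>\<xi>\<bar> + 1 / scale \<tau>) * (exp B / scale \<tau>)"
    using a assms by (intro mult_mono frac_le) auto
  then show ?thesis using at by (simp add: rker_def qker_def abs_mult ac_simps)
qed

lemma zeta_tendsto:
  assumes "t \<longlonglongrightarrow> t0" "x \<longlonglongrightarrow> x0" "0 < t0"
  shows "(\<lambda>n. zeta (t n) (x n) \<xi>) \<longlonglongrightarrow> zeta t0 x0 \<xi>"
    and "(\<lambda>n. scale (t n)) \<longlonglongrightarrow> scale t0"
proof -
  show s: "(\<lambda>n. scale (t n)) \<longlonglongrightarrow> scale t0"
    unfolding scale_def by (intro tendsto_intros assms)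
  show "(\<lambda>n. zeta (t n) (x n) \<xi>) \<longlonglongrightarrow> zeta t0 x0 \<xi>"
    unfolding zeta_def using scale_pos[OF assms(3)] by (intro tendsto_intros assms s) auto
qed

lemma ker_tendsto:
  assumes "t \<longlonglongrightarrow> t0" "x \<longlonglongrightarrow> x0" "0 < t0"
  shows "(\<lambda>n. qker (t n) (x n) \<xi>) \<longlonglongrightarrow> qker t0 x0 \<xi>"
    and "(\<lambda>n. rker (t n) (x n) \<xi>) \<longlonglongrightarrow> rker t0 x0 \<xi>"
proof -
  note z = zeta_tendsto[OF assms]
  have d: "(\<lambda>n. std_normal_density (zeta (t n) (x n) \<xi>)) \<longlonglongrightarrow> std_normal_density (zeta t0 x0 \<xi>)"
    by (rule isCont_tendsto_compose[OF DERIV_isCont[OF std_normal_density_deriv] z(1)])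
  show q: "(\<lambda>n. qker (t n) (x n) \<xi>) \<longlonglongrightarrow> qker t0 x0 \<xi>"
    unfolding qker_def using scale_pos[OF assms(3)] by (intro tendsto_intros d z assms) auto
  show "(\<lambda>n. rker (t n) (x n) \<xi>) \<longlonglongrightarrow> rker t0 x0 \<xi>"
    unfolding rker_def using scale_pos[OF assms(3)] by (intro tendsto_intros q z assms) auto
qed

lemma zeta_measurable [measurable (raw)]:
  assumes [measurable]: "f \<in> borel_measurable M" "g \<in> borel_measurable M" "h \<in> borel_measurable M"
  shows "(\<lambda>x. zeta (f x) (g x) (h x)) \<in> borel_measurable M"
  unfolding zeta_def scale_def by measurable

lemma qker_measurable [measurable (raw)]:
  assumes [measurable]: "f \<in> borel_measurable M" "g \<in> borel_measurable M" "h \<in> borel_measurable M"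
  shows "(\<lambda>x. qker (f x) (g x) (h x)) \<in> borel_measurable M"
  unfolding qker_def scale_def by measurable

lemma rker_measurable [measurable (raw)]:
  assumes [measurable]: "f \<in> borel_measurable M" "g \<in> borel_measurable M" "h \<in> borel_measurable M"
  shows "(\<lambda>x. rker (f x) (g x) (h x)) \<in> borel_measurable M"
  unfolding rker_def scale_def by measurable

text \<open>The functions \<open>Q t\<close> and \<open>q t\<close> below are the distribution function and the density of \<open>F\<^sub>t\<close>, and \<open>r t x / q t x\<close> is
the conditional expectation of \<open>X\<^sub>0 - Z / a\<close> given \<open>F\<^sub>t = x\<close>.\<close>

locale ou_flow = prob_space \<nu> for \<nu> :: "real measure" +
  assumes sets_nu [measurable_cong, simp]: "sets \<nu> = sets borel"
    and first_moment: "integrable \<nu> (\<lambda>x. x)"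
begin

lemma space_nu [simp]: "space \<nu> = UNIV"
  using sets_eq_imp_space_eq[OF sets_nu] by simp

definition Q :: "real \<Rightarrow> real \<Rightarrow> real" where
  "Q t x = (\<integral>\<xi>. cdf std_gaussian (zeta t x \<xi>) \<partial>\<nu>)"

definition q :: "real \<Rightarrow> real \<Rightarrow> real" where
  "q t x = (\<integral>\<xi>. qker t x \<xi> \<partial>\<nu>)"

definition r :: "real \<Rightarrow> real \<Rightarrow> real" where
  "r t x = (\<integral>\<xi>. rker t x \<xi> \<partial>\<nu>)"

definition velocity :: "real \<Rightarrow> real \<Rightarrow> real" where
  "velocity t x = - exp (- t) * r t x / q t x"

lemma abs_integrable: "integrable \<nu> (\<lambda>\<xi>. (\<bar>\<xi>\<bar> + c) * d)"
  using first_moment by (intro integrable_mult_left Bochner_Integration.integrable_add integrable_abs) auto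

lemma qker_integrable: "0 < t \<Longrightarrow> integrable \<nu> (qker t x)"
  using qker_bound[of t t t x] by (intro integrable_const_bound[where B="exp t / scale t"]) auto

lemma sequence_bounds:
  fixes t :: "nat \<Rightarrow> real"
  assumes "t \<longlonglongrightarrow> t0" "0 < t0"
  obtains N where "\<And>n. N \<le> n \<Longrightarrow> t0 / 2 \<le> t n \<and> t n \<le> 2 * t0"
proof -
  have "t0 / 2 < t0" "t0 < 2 * t0" using assms by auto
  then have "eventually (\<lambda>n. t0 / 2 < t n) sequentially" "eventually (\<lambda>n. t n < 2 * t0) sequentially"
    using order_tendstoD[OF assms(1)] by blast+
  then have "eventually (\<lambda>n. t0 / 2 \<le> t n \<and> t n \<le> 2 * t0) sequentially"
    by eventually_elim auto
  then show thesis using that by (auto simp: eventually_sequentially)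
qed

lemma qr_tendsto:
  assumes t: "t \<longlonglongrightarrow> t0" and x: "x \<longlonglongrightarrow> x0" and t0: "0 < t0"
  shows "(\<lambda>n. q (t n) (x n)) \<longlonglongrightarrow> q t0 x0" and "(\<lambda>n. r (t n) (x n)) \<longlonglongrightarrow> r t0 x0"
proof -
  obtain N where N: "\<And>n. N \<le> n \<Longrightarrow> t0 / 2 \<le> t n \<and> t n \<le> 2 * t0"
    using sequence_bounds[OF t t0] by blast
  have t': "(\<lambda>n. t (n + N)) \<longlonglongrightarrow> t0" and x': "(\<lambda>n. x (n + N)) \<longlonglongrightarrow> x0"
    using t x by (auto intro: LIMSEQ_ignore_initial_segment)
  have b: "0 < t0 / 2" "t0 / 2 \<le> t (n + N)" "t (n + N) \<le> 2 * t0" for n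
    using t0 N[of "n + N"] by auto
  let ?w = "\<lambda>\<xi>. (\<bar>\<xi>\<bar> + 1 / scale (t0 / 2)) * (exp (2 * t0) / scale (t0 / 2))"
  have "(\<lambda>n. q (t (n + N)) (x (n + N))) \<longlonglongrightarrow> q t0 x0"
    unfolding q_def
  proof (rule integral_dominated_convergence[where w="\<lambda>_. exp (2 * t0) / scale (t0 / 2)"])
    show "AE \<xi> in \<nu>. norm (qker (t (n + N)) (x (n + N)) \<xi>) \<le> exp (2 * t0) / scale (t0 / 2)" for n
      using qker_bound[OF b] by auto
  qed (use ker_tendsto(1)[OF t' x' t0] in auto)
  then show "(\<lambda>n. q (t n) (x n)) \<longlonglongrightarrow> q t0 x0" by (rule LIMSEQ_offset)
  have "(\<lambda>n. r (t (n + N)) (x (n + N))) \<longlonglongrightarrow> r t0 x0"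
    unfolding r_def
  proof (rule integral_dominated_convergence[where w="?w"])
    show "AE \<xi> in \<nu>. norm (rker (t (n + N)) (x (n + N)) \<xi>) \<le> ?w \<xi>" for n
      using rker_bound[OF b] by auto
    show "integrable \<nu> ?w" by (rule abs_integrable)
  qed (use ker_tendsto(2)[OF t' x' t0] in auto)
  then show "(\<lambda>n. r (t n) (x n)) \<longlonglongrightarrow> r t0 x0" by (rule LIMSEQ_offset)
qed

lemma q_pos:
  assumes "0 < t"
  shows "0 < q t x"
proof -
  have pos: "0 < qker t x \<xi>" for \<xi>
    using scale_pos[OF assms] by (simp add: qker_def normal_density_pos)
  have "0 \<le> q t x" unfolding q_def using pos by (intro integral_nonneg_AE) (auto intro: less_imp_le)
  moreover have "q t x \<noteq> 0"
  proof
    assume "q t x = 0"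
    then have "AE \<xi> in \<nu>. qker t x \<xi> = 0"
      unfolding q_def using integral_nonneg_eq_0_iff_AE[OF qker_integrable[OF assms, of x]] pos
      by (auto intro: less_imp_le)
    then have "AE \<xi> in \<nu>. False" using pos by (auto simp: less_le)
    then show False by simp
  qed
  ultimately show ?thesis by simp
qed

lemma cdf_integrable: "integrable \<nu> (\<lambda>\<xi>. cdf std_gaussian (zeta t x \<xi>))"
proof (rule integrable_const_bound[where B=1])
  have [measurable]: "cdf std_gaussian \<in> borel_measurable borel"
    by (intro borel_measurable_continuous_onI continuous_at_imp_continuous_on ballI
        DERIV_isCont[OF cdf_std_gaussian_deriv])
  show "(\<lambda>\<xi>. cdf std_gaussian (zeta t x \<xi>)) \<in> borel_measurable \<nu>" by measurable
qed (auto simp: gauss.cdf_nonneg gauss.cdf_bounded_prob)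

lemma Q_deriv_x:
  assumes t: "0 < t"
  shows "((\<lambda>x. Q t x) has_real_derivative q t x) (at x)"
  unfolding Q_def q_def
proof (rule has_field_derivative_integral[where \<delta>=1 and w="\<lambda>_. exp t / scale t" and f'="\<lambda>x. qker t x"
      and f="\<lambda>x \<xi>. cdf std_gaussian (zeta t x \<xi>)" and M=\<nu>])
  show "((\<lambda>x. cdf std_gaussian (zeta t x \<xi>)) has_real_derivative qker t x \<xi>) (at x)" for x \<xi>
    unfolding qker_def by (rule DERIV_chain2[OF cdf_std_gaussian_deriv zeta_deriv_x])
  show "\<bar>qker t x \<xi>\<bar> \<le> exp t / scale t" for x \<xi> by (rule qker_bound) (use t in auto)
qed (auto intro: cdf_integrable)

text \<open>Together with \<open>Q_deriv_x\<close> this is the continuity equation in integrated form: the derivative equals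
\<open>- velocity t x * q t x\<close>.\<close>

lemma Q_deriv_t:
  assumes t: "0 < t"
  shows "((\<lambda>t. Q t x) has_real_derivative exp (- t) * r t x) (at t)"
proof -
  have "((\<lambda>t. \<integral>\<xi>. cdf std_gaussian (zeta t x \<xi>) \<partial>\<nu>) has_real_derivative (\<integral>\<xi>. exp (- t) * rker t x \<xi> \<partial>\<nu>)) (at t)"
  proof (rule has_field_derivative_integral[where \<delta>="t / 2" and f'="\<lambda>t \<xi>. exp (- t) * rker t x \<xi>"
        and w="\<lambda>\<xi>. (\<bar>\<xi>\<bar> + 1 / scale (t / 2)) * (exp (2 * t) / scale (t / 2))"
        and f="\<lambda>t \<xi>. cdf std_gaussian (zeta t x \<xi>)" and M=\<nu>])
    show "((\<lambda>t. cdf std_gaussian (zeta t x \<xi>)) has_real_derivative exp (- s) * rker s x \<xi>) (at s)"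
      if "\<bar>s - t\<bar> < t / 2" for s \<xi>
    proof -
      have s: "0 < s" using that t unfolding abs_less_iff by linarith
      have "exp (- s) * rker s x \<xi> = std_normal_density (zeta s x \<xi>) * ((\<xi> - zeta s x \<xi> / scale s) / scale s)"
        by (simp add: rker_def qker_def exp_minus)
      then show ?thesis
        using DERIV_chain2[OF cdf_std_gaussian_deriv zeta_deriv_t[OF s]] by simp
    qed
    show "\<bar>exp (- s) * rker s x \<xi>\<bar> \<le> (\<bar>\<xi>\<bar> + 1 / scale (t / 2)) * (exp (2 * t) / scale (t / 2))"
      if "\<bar>s - t\<bar> < t / 2" for s \<xi>
    proof -
      have s: "t / 2 \<le> s" "s \<le> 2 * t" "0 < s" using that t unfolding abs_less_iff by linarith+
      have "\<bar>exp (- s) * rker s x \<xi>\<bar> \<le> 1 * \<bar>rker s x \<xi>\<bar>"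
        unfolding abs_mult using s by (intro mult_right_mono) auto
      also have "\<dots> \<le> (\<bar>\<xi>\<bar> + 1 / scale (t / 2)) * (exp (2 * t) / scale (t / 2))"
        using rker_bound[of "t / 2" s "2 * t"] s t by simp
      finally show ?thesis .
    qed
    show "integrable \<nu> (\<lambda>\<xi>. (\<bar>\<xi>\<bar> + 1 / scale (t / 2)) * (exp (2 * t) / scale (t / 2)))"
      by (rule abs_integrable)
  qed (use t in \<open>auto intro: cdf_integrable\<close>)
  then show ?thesis by (simp add: Q_def r_def)
qed

lemma Q_strict_mono: "0 < t \<Longrightarrow> x < y \<Longrightarrow> Q t x < Q t y"
  using Q_deriv_x q_pos by (rule_tac DERIV_pos_imp_increasing[where f="Q t"]) blast+

lemma Q_less_iff: "0 < t \<Longrightarrow> Q t x < Q t y \<longleftrightarrow> x < y"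
  using Q_strict_mono[of t x y] Q_strict_mono[of t y x] by (cases x y rule: linorder_cases) auto

lemma Q_isCont_x: "0 < t \<Longrightarrow> isCont (Q t) x"
  using DERIV_isCont[OF Q_deriv_x] by simp

definition joint :: "(real \<times> real) measure" where
  "joint = \<nu> \<Otimes>\<^sub>M std_gaussian"

sublocale joint: pair_prob_space \<nu> std_gaussian ..

definition ou :: "real \<Rightarrow> real \<times> real \<Rightarrow> real" where
  "ou t p = exp (- t) * (fst p + scale t * snd p)"

lemma ou_measurable [measurable (raw)]:
  assumes [measurable]: "f \<in> borel_measurable M" "g \<in> M \<rightarrow>\<^sub>M borel \<Otimes>\<^sub>M borel"
  shows "(\<lambda>x. ou (f x) (g x)) \<in> borel_measurable M"
  unfolding ou_def scale_def by measurable

lemma sets_joint [measurable_cong]: "sets joint = sets (borel \<Otimes>\<^sub>M borel)"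
  unfolding joint_def by (intro sets_pair_measure_cong) auto

lemma prob_space_joint: "prob_space joint"
  unfolding joint_def by (rule joint.prob_space_axioms)

lemma space_joint [simp]: "space joint = UNIV"
  unfolding joint_def by (simp add: space_pair_measure)

lemma real_distribution_law: "real_distribution (distr joint borel (ou t))"
proof -
  interpret J: prob_space joint by (rule prob_space_joint)
  have [measurable]: "ou t \<in> borel_measurable joint" by measurable
  show ?thesis by (rule J.real_distribution_distr) measurable
qed

lemma Q_eq_cdf:
  assumes t: "0 < t"
  shows "cdf (distr joint borel (ou t)) x = Q t x"
proof -
  interpret J: prob_space joint by (rule prob_space_joint)
  have a: "0 < scale t" using t by (rule scale_pos)
  have "cdf (distr joint borel (ou t)) x = measure joint {p. ou t p \<le> x}"
    unfolding cdf_def by (subst measure_distr) (auto intro!: arg_cong2[where f=measure])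
  also have "\<dots> = (\<integral>p. indicator {p. ou t p \<le> x} p \<partial>joint)" by simp
  also have "\<dots> = (\<integral>\<xi>. (\<integral>z. indicator {p. ou t p \<le> x} (\<xi>, z) \<partial>std_gaussian) \<partial>\<nu>)"
    unfolding joint_def
    by (rule joint.integral_fst'[symmetric])
       (auto intro!: joint.integrable_const_bound[where B=1] simp: indicator_def)
  also have "\<dots> = Q t x"
    unfolding Q_def
  proof (intro Bochner_Integration.integral_cong refl)
    fix \<xi>
    have "(ou t (\<xi>, z) \<le> x) = (z \<le> zeta t x \<xi>)" for z
      using a by (simp add: ou_def zeta_def field_simps exp_minus)
    then have "(\<lambda>z. indicator {p. ou t p \<le> x} (\<xi>, z)) = (indicator {..zeta t x \<xi>} :: real \<Rightarrow> real)"
      by (auto simp: indicator_def fun_eq_iff)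
    then show "(\<integral>z. indicator {p. ou t p \<le> x} (\<xi>, z) \<partial>std_gaussian) = cdf std_gaussian (zeta t x \<xi>)"
      by (simp add: cdf_def)
  qed
  finally show ?thesis .
qed

lemma Q_surj:
  assumes t: "0 < t" and u: "0 < u" "u < 1"
  shows "\<exists>!x. Q t x = u"
proof -
  interpret L: real_distribution "distr joint borel (ou t)" by (rule real_distribution_law)
  have top: "(Q t \<longlongrightarrow> 1) at_top" and bot: "(Q t \<longlongrightarrow> 0) at_bot"
  proof -
    have "cdf (distr joint borel (ou t)) = Q t" using Q_eq_cdf[OF t] by auto
    then show "(Q t \<longlongrightarrow> 1) at_top" "(Q t \<longlongrightarrow> 0) at_bot"
      using L.cdf_lim_at_top_prob L.cdf_lim_at_bot by auto
  qed
  have "eventually (\<lambda>x. u < Q t x) at_top" "eventually (\<lambda>x. Q t x < u) at_bot"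
    using order_tendstoD(1)[OF top u(2)] order_tendstoD(2)[OF bot u(1)] by auto
  then obtain A B where A: "u < Q t A" and B: "Q t B < u"
    unfolding eventually_at_top_linorder eventually_at_bot_linorder by blast
  then have "B \<le> A" using Q_less_iff[OF t, of B A] by simp
  then have "\<exists>x\<ge>B. x \<le> A \<and> Q t x = u"
    using A B Q_isCont_x[OF t] by (intro IVT) auto
  then show ?thesis
    by (metis Q_less_iff[OF t] less_irrefl linorder_neqE)
qed

text \<open>The quantile function of \<open>F\<^sub>t\<close>; the value zero outside the relevant range makes it a total measurable
function of both arguments.\<close>

definition T :: "real \<Rightarrow> real \<Rightarrow> real" where
  "T t u = (if 0 < t \<and> 0 < u \<and> u < 1 then THE x. Q t x = u else 0)"

lemma Q_T: "0 < t \<Longrightarrow> 0 < u \<Longrightarrow> u < 1 \<Longrightarrow> Q t (T t u) = u"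
  using theI'[OF Q_surj[of t u]] by (simp add: T_def)

lemma T_le_iff: "0 < t \<Longrightarrow> 0 < u \<Longrightarrow> u < 1 \<Longrightarrow> T t u \<le> x \<longleftrightarrow> u \<le> Q t x"
  using Q_less_iff[of t x "T t u"] Q_T[of t u] by (auto simp flip: not_less)

end

section \<open>The coupling by quantile functions\<close>

text \<open>Almost sure limits of variables with equal laws have equal characteristic functions.\<close>

lemma distr_eq_of_limits:
  fixes X :: "nat \<Rightarrow> 'a \<Rightarrow> real" and Y :: "nat \<Rightarrow> 'b \<Rightarrow> real"
  assumes "prob_space M" "prob_space N"
    and [measurable]: "\<And>n. X n \<in> borel_measurable M" "X' \<in> borel_measurable M"
      "\<And>n. Y n \<in> borel_measurable N" "Y' \<in> borel_measurable N"
    and law: "\<And>n. distr M borel (X n) = distr N borel (Y n)"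
    and X: "AE x in M. (\<lambda>n. X n x) \<longlonglongrightarrow> X' x" and Y: "AE y in N. (\<lambda>n. Y n y) \<longlonglongrightarrow> Y' y"
  shows "distr M borel X' = distr N borel Y'"
proof -
  interpret M: prob_space M by fact
  interpret N: prob_space N by fact
  show ?thesis
  proof (rule Levy_uniqueness)
    show "real_distribution (distr M borel X')" by (rule M.real_distribution_distr) measurable
    show "real_distribution (distr N borel Y')" by (rule N.real_distribution_distr) measurable
    show "char (distr M borel X') = char (distr N borel Y')"
    proof
      fix s
      have "(\<lambda>n. \<integral>x. iexp (s * X n x) \<partial>M) \<longlonglongrightarrow> (\<integral>x. iexp (s * X' x) \<partial>M)"
      proof (rule integral_dominated_convergence[where w="\<lambda>_. 1"])
        show "AE x in M. (\<lambda>n. iexp (s * X n x)) \<longlonglongrightarrow> iexp (s * X' x)"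
          using X by eventually_elim (intro tendsto_intros)
      qed auto
      moreover have "(\<lambda>n. \<integral>y. iexp (s * Y n y) \<partial>N) \<longlonglongrightarrow> (\<integral>y. iexp (s * Y' y) \<partial>N)"
      proof (rule integral_dominated_convergence[where w="\<lambda>_. 1"])
        show "AE y in N. (\<lambda>n. iexp (s * Y n y)) \<longlonglongrightarrow> iexp (s * Y' y)"
          using Y by eventually_elim (intro tendsto_intros)
      qed auto
      moreover have "(\<integral>x. iexp (s * X n x) \<partial>M) = (\<integral>y. iexp (s * Y n y) \<partial>N)" for n
      proof -
        have "char (distr M borel (X n)) s = char (distr N borel (Y n)) s" by (simp add: law)
        moreover have "char (distr M borel (X n)) s = (\<integral>x. iexp (s * X n x) \<partial>M)"
          unfolding char_def by (subst integral_distr) auto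
        moreover have "char (distr N borel (Y n)) s = (\<integral>y. iexp (s * Y n y) \<partial>N)"
          unfolding char_def by (subst integral_distr) auto
        ultimately show ?thesis by simp
      qed
      ultimately have "(\<integral>x. iexp (s * X' x) \<partial>M) = (\<integral>y. iexp (s * Y' y) \<partial>N)"
        by (simp add: LIMSEQ_unique)
      moreover have "char (distr M borel X') s = (\<integral>x. iexp (s * X' x) \<partial>M)"
        unfolding char_def by (subst integral_distr) auto
      moreover have "char (distr N borel Y') s = (\<integral>y. iexp (s * Y' y) \<partial>N)"
        unfolding char_def by (subst integral_distr) auto
      ultimately show "char (distr M borel X') s = char (distr N borel Y') s" by simp
    qed
  qed
qed

definition unif :: "real measure" where "unif = uniform_measure lborel {0<..<1}"

lemma prob_space_unif: "prob_space unif"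
  unfolding unif_def by (rule prob_space_uniform_measure) auto

lemma sets_unif [measurable_cong, simp]: "sets unif = sets borel"
  by (simp add: unif_def)

lemma space_unif [simp]: "space unif = UNIV"
  by (simp add: unif_def)

lemma AE_unif: "AE u in unif. 0 < u \<and> u < 1"
  unfolding unif_def by (subst AE_uniform_measure) auto

context ou_flow
begin

lemma qr_measurable [measurable (raw)]:
  assumes [measurable]: "f \<in> borel_measurable M" "g \<in> borel_measurable M"
  shows "(\<lambda>x. q (f x) (g x)) \<in> borel_measurable M" "(\<lambda>x. r (f x) (g x)) \<in> borel_measurable M"
  unfolding q_def r_def by measurable

lemma velocity_measurable [measurable (raw)]:
  assumes [measurable]: "f \<in> borel_measurable M" "g \<in> borel_measurable M"
  shows "(\<lambda>x. velocity (f x) (g x)) \<in> borel_measurable M"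
  unfolding velocity_def by measurable

lemma Q_measurable [measurable (raw)]:
  assumes [measurable]: "f \<in> borel_measurable M" "g \<in> borel_measurable M"
  shows "(\<lambda>x. Q (f x) (g x)) \<in> borel_measurable M"
proof -
  have [measurable]: "cdf std_gaussian \<in> borel_measurable borel"
    by (intro borel_measurable_continuous_onI continuous_at_imp_continuous_on ballI
        DERIV_isCont[OF cdf_std_gaussian_deriv])
  show ?thesis unfolding Q_def by measurable
qed

lemma T_measurable [measurable (raw)]:
  assumes [measurable]: "f \<in> borel_measurable M" "g \<in> borel_measurable M"
  shows "(\<lambda>x. T (f x) (g x)) \<in> borel_measurable M"
proof (rule borel_measurable_iff_le[THEN iffD2, rule_format])
  fix a
  have "{w \<in> space M. T (f w) (g w) \<le> a} =
    {w \<in> space M. if 0 < f w \<and> 0 < g w \<and> g w < 1 then g w \<le> Q (f w) a else 0 \<le> a}"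
    using T_le_iff by (auto simp: T_def)
  also have "\<dots> \<in> sets M" by measurable
  finally show "{w \<in> space M. T (f w) (g w) \<le> a} \<in> sets M" .
qed

lemma T_law:
  assumes t: "0 < t"
  shows "distr unif borel (T t) = distr joint borel (ou t)"
proof -
  interpret U: prob_space unif by (rule prob_space_unif)
  have Tm [measurable]: "T t \<in> borel_measurable borel" by measurable
  interpret L: real_distribution "distr joint borel (ou t)" by (rule real_distribution_law)
  show ?thesis
  proof (rule cdf_unique)
    show "real_distribution (distr unif borel (T t))" by (rule U.real_distribution_distr) measurable
    show "real_distribution (distr joint borel (ou t))" by (rule real_distribution_law)
    show "cdf (distr unif borel (T t)) = cdf (distr joint borel (ou t))"
    proof
      fix x
      have Q: "0 \<le> Q t x" "Q t x \<le> 1"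
        using L.cdf_nonneg[of x] L.cdf_bounded_prob[of x] Q_eq_cdf[OF t] by auto
      have "cdf (distr unif borel (T t)) x = measure unif {u. T t u \<le> x}"
        unfolding cdf_def by (subst measure_distr) (auto simp: vimage_def)
      also have "emeasure unif {u. T t u \<le> x} = emeasure lborel ({0<..<1} \<inter> {u. T t u \<le> x}) / emeasure lborel {0<..<1::real}"
        unfolding unif_def by (rule emeasure_uniform_measure) auto
      then have "measure unif {u. T t u \<le> x} = measure lborel ({0<..<1} \<inter> {u. T t u \<le> x})"
        by (simp add: measure_def divide_ennreal_def)
      also have "{0<..<1} \<inter> {u. T t u \<le> x} = {0<..<1} \<inter> {..Q t x}"
        using T_le_iff[OF t] by auto
      also have "measure lborel \<dots> = Q t x"
      proof (cases "Q t x = 1")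
        case True
        then have "{0<..<1} \<inter> {..Q t x} = {0<..<1}" by auto
        then show ?thesis using True by simp
      next
        case False
        then have "{0<..<1} \<inter> {..Q t x} = {0<..Q t x}" using Q by auto
        then show ?thesis using Q by simp
      qed
      also have "Q t x = cdf (distr joint borel (ou t)) x" by (simp add: Q_eq_cdf[OF t])
      finally show "cdf (distr unif borel (T t)) x = cdf (distr joint borel (ou t)) x" .
    qed
  qed
qed

text \<open>The level sets of \<open>T\<close> are described by \<open>Q\<close>, which is continuous in time.\<close>

lemma T_isCont:
  assumes t: "0 < t" and u: "0 < u" "u < 1"
  shows "isCont (\<lambda>t. T t u) t"
  unfolding isCont_def
proof (rule order_tendstoI)
  have pos: "eventually (\<lambda>s. 0 < s) (at t)"
    using order_tendstoD(1)[OF tendsto_ident_at t] .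
  have Qc: "((\<lambda>s. Q s a) \<longlongrightarrow> Q t a) (at t)" for a
    using DERIV_isCont[OF Q_deriv_t[OF t, of a]] by (simp add: isCont_def)
  show "eventually (\<lambda>s. a < T s u) (at t)" if "a < T t u" for a
  proof -
    have "Q t a < u" using that T_le_iff[OF t u, of a] by simp
    with Qc[of a] have "eventually (\<lambda>s. Q s a < u) (at t)" by (rule order_tendstoD(2))
    with pos show ?thesis by eventually_elim (use T_le_iff u in \<open>simp flip: not_le\<close>)
  qed
  show "eventually (\<lambda>s. T s u < a) (at t)" if "T t u < a" for a
  proof -
    define b where "b = (T t u + a) / 2"
    have b: "T t u < b" "b < a" using that by (auto simp: b_def)
    have "u < Q t b" using b(1) Q_less_iff[OF t, of "T t u" b] Q_T[OF t u] by simp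
    with Qc[of b] have "eventually (\<lambda>s. u < Q s b) (at t)" by (rule order_tendstoD(1))
    with pos show ?thesis
    proof eventually_elim
      case (elim s)
      then have "T s u \<le> b" using T_le_iff[of s u b] u by simp
      then show ?case using b by simp
    qed
  qed
qed

lemma Q_mvt:
  assumes t: "0 < t"
  shows "\<exists>\<eta>. \<bar>\<eta> - y\<bar> \<le> \<bar>x - y\<bar> \<and> Q t x - Q t y = q t \<eta> * (x - y)"
proof (cases x y rule: linorder_cases)
  case less
  from MVT2[OF this, of "Q t" "q t"] Q_deriv_x[OF t] obtain z where
    "x < z" "z < y" "Q t y - Q t x = (y - x) * q t z" by blast
  then show ?thesis by (intro exI[of _ z]) (auto simp: algebra_simps)
next
  case equal
  then show ?thesis by auto
next
  case greater
  from MVT2[OF this, of "Q t" "q t"] Q_deriv_x[OF t] obtain z where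
    "y < z" "z < x" "Q t x - Q t y = (x - y) * q t z" by blast
  then show ?thesis by (intro exI[of _ z]) (auto simp: algebra_simps)
qed

lemma velocity_tendsto:
  assumes "t \<longlonglongrightarrow> t0" "x \<longlonglongrightarrow> x0" "0 < t0"
  shows "(\<lambda>n. velocity (t n) (x n)) \<longlonglongrightarrow> velocity t0 x0"
  unfolding velocity_def using q_pos[OF assms(3), of x0]
  by (intro tendsto_intros qr_tendsto assms) auto

text \<open>Implicit differentiation of \<open>Q t (T t u) = u\<close>.  The difference quotient is computed along a sequence, with
the mean value theorem in \<open>x\<close> supplying points \<open>\<eta> n\<close> that converge to \<open>T t u\<close>.\<close>

lemma T_deriv:
  assumes t: "0 < t" and u: "0 < u" "u < 1"
  shows "((\<lambda>t. T t u) has_real_derivative velocity t (T t u)) (at t)"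
  unfolding has_field_derivative_iff
proof (subst tendsto_at_iff_sequentially, intro allI impI)
  fix X :: "nat \<Rightarrow> real"
  assume X: "\<forall>i. X i \<in> UNIV - {t}" "X \<longlonglongrightarrow> t"
  obtain N where N: "\<And>n. N \<le> n \<Longrightarrow> t / 2 \<le> X n \<and> X n \<le> 2 * t"
    using sequence_bounds[OF X(2) t] by blast
  define Y where "Y n = X (n + N)" for n
  have Y: "0 < Y n" "Y n \<noteq> t" for n
    using N[of "n + N"] X(1) t by (auto simp: Y_def)
  have Yl: "Y \<longlonglongrightarrow> t" unfolding Y_def[abs_def] by (rule LIMSEQ_ignore_initial_segment[OF X(2)])
  define x where "x n = T (Y n) u" for n
  have xl: "x \<longlonglongrightarrow> T t u" unfolding x_def by (rule isCont_tendsto_compose[OF T_isCont[OF t u] Yl])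
  have "\<exists>\<eta>. \<bar>\<eta> - T t u\<bar> \<le> \<bar>x n - T t u\<bar> \<and> Q (Y n) (x n) - Q (Y n) (T t u) = q (Y n) \<eta> * (x n - T t u)" for n
    by (rule Q_mvt) (rule Y)
  then obtain \<eta> where \<eta>: "\<And>n. \<bar>\<eta> n - T t u\<bar> \<le> \<bar>x n - T t u\<bar>"
    "\<And>n. Q (Y n) (x n) - Q (Y n) (T t u) = q (Y n) (\<eta> n) * (x n - T t u)"
    by metis
  have "(\<lambda>n. x n - T t u) \<longlonglongrightarrow> 0" using xl by (simp add: LIM_zero)
  then have "(\<lambda>n. \<eta> n - T t u) \<longlonglongrightarrow> 0"
    by (rule Lim_null_comparison[OF _ tendsto_rabs_zero, rotated]) (auto simp: \<eta>(1))
  then have \<eta>l: "\<eta> \<longlonglongrightarrow> T t u" by (simp add: LIM_zero_iff)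
  have ql: "(\<lambda>n. q (Y n) (\<eta> n)) \<longlonglongrightarrow> q t (T t u)" by (rule qr_tendsto(1)[OF Yl \<eta>l t])
  have "((\<lambda>s. (Q s (T t u) - Q t (T t u)) / (s - t)) \<longlongrightarrow> exp (- t) * r t (T t u)) (at t)"
    using Q_deriv_t[OF t, of "T t u"] unfolding has_field_derivative_iff .
  from this[unfolded tendsto_at_iff_sequentially, rule_format, of Y] Y Yl
  have dl: "(\<lambda>n. (Q (Y n) (T t u) - Q t (T t u)) / (Y n - t)) \<longlonglongrightarrow> exp (- t) * r t (T t u)"
    by (simp add: o_def)
  have "(T (Y n) u - T t u) / (Y n - t) = - ((Q (Y n) (T t u) - Q t (T t u)) / (Y n - t)) / q (Y n) (\<eta> n)" for n
  proof -
    have "u - Q (Y n) (T t u) = q (Y n) (\<eta> n) * (T (Y n) u - T t u)"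
      using \<eta>(2)[of n] Q_T[OF Y(1) u] by (simp add: x_def)
    moreover have "0 < q (Y n) (\<eta> n)" by (rule q_pos[OF Y(1)])
    ultimately have d: "T (Y n) u - T t u = (u - Q (Y n) (T t u)) / q (Y n) (\<eta> n)" by (simp add: field_simps)
    have "(u - a) / c / b = - ((a - u) / b) / c" for a b c :: real by (simp add: minus_divide_left)
    then show ?thesis unfolding d Q_T[OF t u] .
  qed
  moreover have "(\<lambda>n. - ((Q (Y n) (T t u) - Q t (T t u)) / (Y n - t)) / q (Y n) (\<eta> n)) \<longlonglongrightarrow>
      - (exp (- t) * r t (T t u)) / q t (T t u)"
    using q_pos[OF t, of "T t u"] by (intro tendsto_intros dl ql) auto
  ultimately have "(\<lambda>n. (T (Y n) u - T t u) / (Y n - t)) \<longlonglongrightarrow> velocity t (T t u)"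
    by (simp add: velocity_def)
  then have "(\<lambda>n. (\<lambda>m. (T (X m) u - T t u) / (X m - t)) (n + N)) \<longlonglongrightarrow> velocity t (T t u)"
    by (simp add: Y_def)
  then show "((\<lambda>y. (T y u - T t u) / (y - t)) \<circ> X) \<longlonglongrightarrow> velocity t (T t u)"
    unfolding o_def by (rule LIMSEQ_offset)
qed

lemma T_FTC:
  assumes a: "0 < a" "a \<le> b" and u: "0 < u" "u < 1"
  shows "(\<integral>t. velocity t (T t u) * indicator {a..b} t \<partial>lborel) = T b u - T a u"
proof (rule integral_FTC_Icc_real)
  show "((\<lambda>t. T t u) has_real_derivative velocity t (T t u)) (at t)" if "a \<le> t" "t \<le> b" for t
    using that a by (intro T_deriv u) auto
  show "isCont (\<lambda>t. velocity t (T t u)) t" if "a \<le> t" "t \<le> b" for t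
  proof (rule continuous_at_sequentiallyI)
    fix s assume s: "s \<longlonglongrightarrow> t"
    have t: "0 < t" using that a by simp
    show "(\<lambda>n. velocity (s n) (T (s n) u)) \<longlonglongrightarrow> velocity t (T t u)"
      by (intro velocity_tendsto s isCont_tendsto_compose[OF T_isCont[OF t u] s] t)
  qed
qed (rule a)

lemma distr_joint_fst: "distr joint borel fst = \<nu>"
proof (rule measure_eqI)
  fix A assume "A \<in> sets (distr joint borel fst)"
  then have A [measurable]: "A \<in> sets borel" by simp
  have "emeasure (distr joint borel fst) A = emeasure (\<nu> \<Otimes>\<^sub>M std_gaussian) (A \<times> UNIV)"
    by (subst emeasure_distr) (auto simp: joint_def[symmetric] intro!: arg_cong2[where f=emeasure])
  also have "\<dots> = emeasure \<nu> A"
    using gauss.emeasure_space_1 by (subst gauss.emeasure_pair_measure_Times) auto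
  finally show "emeasure (distr joint borel fst) A = emeasure \<nu> A" .
qed simp

lemma distr_joint_snd: "distr joint borel snd = std_gaussian"
proof (rule measure_eqI)
  fix A assume "A \<in> sets (distr joint borel snd)"
  then have A [measurable]: "A \<in> sets borel" by simp
  have "emeasure (distr joint borel snd) A = emeasure (\<nu> \<Otimes>\<^sub>M std_gaussian) (UNIV \<times> A)"
    by (subst emeasure_distr) (auto simp: joint_def[symmetric] intro!: arg_cong2[where f=emeasure])
  also have "\<dots> = emeasure std_gaussian A"
    using emeasure_space_1 by (subst gauss.emeasure_pair_measure_Times) auto
  finally show "emeasure (distr joint borel snd) A = emeasure std_gaussian A" .
qed simp

lemma ou_limit_0: "(\<lambda>n. ou (1 / real (Suc n)) p) \<longlonglongrightarrow> fst p"
proof -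
  have "(\<lambda>n. ou (1 / real (Suc n)) p) \<longlonglongrightarrow> exp (- 0) * (fst p + sqrt (exp (2 * 0) - 1) * snd p)"
    unfolding ou_def scale_def by (intro tendsto_intros LIMSEQ_Suc[OF lim_1_over_n])
  then show ?thesis by simp
qed

lemma ou_limit_infinity: "(\<lambda>n. ou (real (Suc n)) p) \<longlonglongrightarrow> snd p"
proof -
  have e: "(\<lambda>n. exp (- real (Suc n))) \<longlonglongrightarrow> 0"
    by (intro filterlim_compose[OF exp_at_bot] filterlim_compose[OF filterlim_uminus_at_bot_at_top]
        filterlim_compose[OF filterlim_real_sequentially] filterlim_Suc)
  have "ou t p = exp (- t) * fst p + sqrt (1 - (exp (- t))\<^sup>2) * snd p" if "0 < t" for t
  proof -
    have "exp (- t) * scale t = sqrt ((exp (- t))\<^sup>2 * (exp (2 * t) - 1))"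
      by (simp add: scale_def real_sqrt_mult)
    also have "(exp (- t))\<^sup>2 * (exp (2 * t) - 1) = 1 - (exp (- t))\<^sup>2"
      by (simp add: right_diff_distrib power2_eq_square flip: exp_add)
    finally have "exp (- t) * scale t = sqrt (1 - (exp (- t))\<^sup>2)" .
    then show ?thesis by (simp add: ou_def distrib_left flip: mult.assoc)
  qed
  then have "(\<lambda>n. ou (real (Suc n)) p) = (\<lambda>n. exp (- real (Suc n)) * fst p + sqrt (1 - (exp (- real (Suc n)))\<^sup>2) * snd p)"
    by auto
  also have "\<dots> \<longlonglongrightarrow> 0 * fst p + sqrt (1 - 0\<^sup>2) * snd p"
    by (intro tendsto_intros e)
  finally show ?thesis by simp
qed

text \<open>When the right-hand side is finite, Minkowski's inequality shows that almost every trajectory \<open>t \<mapsto> T t u\<close> has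
finite length.  Such trajectories converge at both ends of time, and the limits \<open>T0\<close> and \<open>T1\<close> have the
two prescribed laws and differ by at most the length of the trajectory.\<close>

lemma wasserstein_le_velocity:
  assumes p: "1 \<le> p"
  shows "wasserstein p \<nu> std_gaussian \<le>
    (\<integral>\<^sup>+t\<in>{0<..}. ennreal_powr (\<integral>\<^sup>+\<omega>. ennreal (\<bar>velocity t (ou t \<omega>)\<bar> powr p) \<partial>joint) (1 / p) \<partial>lborel)"
proof -
  interpret U: prob_space unif by (rule prob_space_unif)
  define N where "N t = ennreal_powr (\<integral>\<^sup>+\<omega>. ennreal (\<bar>velocity t (ou t \<omega>)\<bar> powr p) \<partial>joint) (1 / p) * indicator {0<..} t" for t
  define V where "V t u = indicator {0<..} t * velocity t (T t u)" for t u
  have Vm [measurable]: "(\<lambda>(t, u). V t u) \<in> borel_measurable (borel \<Otimes>\<^sub>M borel)"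
    unfolding V_def by measurable
  have Vm2 [measurable (raw)]: "(\<lambda>x. V (f x) (g x)) \<in> borel_measurable L"
    if "f \<in> borel_measurable L" "g \<in> borel_measurable L" for f g and L :: "(real \<times> real) measure"
    using that unfolding V_def by measurable
  have mink: "(\<integral>\<^sup>+u. ennreal_powr (\<integral>\<^sup>+t. ennreal \<bar>V t u\<bar> \<partial>lborel) p \<partial>unif) \<le> ennreal_powr (\<integral>\<^sup>+t. N t \<partial>lborel) p"
  proof -
    have "(\<integral>\<^sup>+u. ennreal_powr (\<integral>\<^sup>+t. ennreal \<bar>V t u\<bar> \<partial>lborel) p \<partial>unif) \<le>
      ennreal_powr (\<integral>\<^sup>+t. ennreal_powr (\<integral>\<^sup>+u. ennreal (\<bar>V t u\<bar> powr p) \<partial>unif) (1 / p) \<partial>lborel) p"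
      by (rule minkowski_integral[OF U.sigma_finite_measure_axioms p]) (auto simp: split_beta')
    also have "(\<integral>\<^sup>+t. ennreal_powr (\<integral>\<^sup>+u. ennreal (\<bar>V t u\<bar> powr p) \<partial>unif) (1 / p) \<partial>lborel) = (\<integral>\<^sup>+t. N t \<partial>lborel)"
    proof (rule nn_integral_cong)
      fix t :: real
      show "ennreal_powr (\<integral>\<^sup>+u. ennreal (\<bar>V t u\<bar> powr p) \<partial>unif) (1 / p) = N t"
      proof (cases "0 < t")
        case True
        have "(\<integral>\<^sup>+u. ennreal (\<bar>V t u\<bar> powr p) \<partial>unif) = (\<integral>\<^sup>+x. ennreal (\<bar>velocity t x\<bar> powr p) \<partial>distr unif borel (T t))"
          using True by (subst nn_integral_distr) (auto simp: V_def)
        also have "\<dots> = (\<integral>\<^sup>+\<omega>. ennreal (\<bar>velocity t (ou t \<omega>)\<bar> powr p) \<partial>joint)"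
          unfolding T_law[OF True] by (subst nn_integral_distr) auto
        finally show ?thesis using True by (simp add: N_def)
      next
        case False
        then show ?thesis by (simp add: N_def V_def)
      qed
    qed
    finally show ?thesis .
  qed
  show ?thesis
  proof (cases "(\<integral>\<^sup>+t. N t \<partial>lborel) = \<top>")
    case True
    then show ?thesis by (simp add: N_def)
  next
    case False
    then obtain \<Lambda> where \<Lambda>: "0 \<le> \<Lambda>" "(\<integral>\<^sup>+t. N t \<partial>lborel) = ennreal \<Lambda>"
      by (cases "\<integral>\<^sup>+t. N t \<partial>lborel") auto
    have "AE u in unif. ennreal_powr (\<integral>\<^sup>+t. ennreal \<bar>V t u\<bar> \<partial>lborel) p \<noteq> \<infinity>"
    proof (rule nn_integral_PInf_AE)
      show "(\<integral>\<^sup>+u. ennreal_powr (\<integral>\<^sup>+t. ennreal \<bar>V t u\<bar> \<partial>lborel) p \<partial>unif) \<noteq> \<infinity>"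
        using mink \<Lambda> by (auto simp: ennreal_powr_ennreal top_unique)
    qed measurable
    then have int: "AE u in unif. integrable lborel (\<lambda>t. V t u)"
    proof eventually_elim
      case (elim u)
      then have "(\<integral>\<^sup>+t. ennreal \<bar>V t u\<bar> \<partial>lborel) \<noteq> \<top>" by (auto simp: ennreal_powr_def)
      then show ?case by (intro integrableI_bounded) (auto simp: less_top)
    qed
    \<comment> \<open>The limits are defined through integrals of the velocity, which makes them measurable in \<open>u\<close>.\<close>
    define T0 where "T0 u = T 1 u - (\<integral>t. V t u * indicator {..1} t \<partial>lborel)" for u
    define T1 where "T1 u = T0 u + (\<integral>t. V t u \<partial>lborel)" for u
    have [measurable]: "T0 \<in> borel_measurable borel" "T1 \<in> borel_measurable borel"
      unfolding T0_def T1_def by measurable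
    have ftc: "(\<integral>t. V t u * indicator {a..b} t \<partial>lborel) = T b u - T a u" if "0 < a" "a \<le> b" "0 < u" "u < 1" for a b u
    proof -
      have "(\<integral>t. V t u * indicator {a..b} t \<partial>lborel) = (\<integral>t. velocity t (T t u) * indicator {a..b} t \<partial>lborel)"
        using that by (intro Bochner_Integration.integral_cong) (auto simp: V_def split: split_indicator)
      then show ?thesis using T_FTC[OF that] by simp
    qed
    have l0: "AE u in unif. (\<lambda>n. T (1 / real (Suc n)) u) \<longlonglongrightarrow> T0 u"
      using int AE_unif
    proof eventually_elim
      case (elim u)
      have "(\<lambda>n. \<integral>t. V t u * indicator {1 / real (Suc n)..1} t \<partial>lborel) \<longlonglongrightarrow> (\<integral>t. V t u * indicator {..1} t \<partial>lborel)"
      proof (rule integral_dominated_convergence[where w="\<lambda>t. \<bar>V t u\<bar>"])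
        show "AE t in lborel. (\<lambda>n. V t u * indicator {1 / real (Suc n)..1} t) \<longlonglongrightarrow> V t u * indicator {..1} t"
        proof (rule AE_I2)
          fix t :: real
          show "(\<lambda>n. V t u * indicator {1 / real (Suc n)..1} t) \<longlonglongrightarrow> V t u * indicator {..1} t"
          proof (cases "0 < t")
            case True
            have "eventually (\<lambda>n. 1 / real (Suc n) < t) sequentially"
              by (rule order_tendstoD(2)[OF LIMSEQ_Suc[OF lim_1_over_n] True])
            then have "eventually (\<lambda>n. V t u * indicator {1 / real (Suc n)..1} t = V t u * indicator {..1} t) sequentially"
              by eventually_elim (auto split: split_indicator)
            then show ?thesis by (rule tendsto_eventually)
          qed (simp add: V_def)
        qed
      qed (use elim in \<open>auto simp: abs_mult split: split_indicator\<close>)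
      then have "(\<lambda>n. T 1 u - (\<integral>t. V t u * indicator {1 / real (Suc n)..1} t \<partial>lborel)) \<longlonglongrightarrow> T0 u"
        unfolding T0_def by (intro tendsto_intros)
      moreover have "T 1 u - (\<integral>t. V t u * indicator {1 / real (Suc n)..1} t \<partial>lborel) = T (1 / real (Suc n)) u" for n
        using elim by (subst ftc) auto
      ultimately show ?case by simp
    qed
    have l1: "AE u in unif. (\<lambda>n. T (real (Suc n)) u) \<longlonglongrightarrow> T1 u"
      using int AE_unif l0
    proof eventually_elim
      case (elim u)
      have "(\<lambda>n. \<integral>t. V t u * indicator {1 / real (Suc n)..real (Suc n)} t \<partial>lborel) \<longlonglongrightarrow> (\<integral>t. V t u \<partial>lborel)"
      proof (rule integral_dominated_convergence[where w="\<lambda>t. \<bar>V t u\<bar>"])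
        show "AE t in lborel. (\<lambda>n. V t u * indicator {1 / real (Suc n)..real (Suc n)} t) \<longlonglongrightarrow> V t u"
        proof (rule AE_I2)
          fix t :: real
          show "(\<lambda>n. V t u * indicator {1 / real (Suc n)..real (Suc n)} t) \<longlonglongrightarrow> V t u"
          proof (cases "0 < t")
            case True
            have "eventually (\<lambda>n. 1 / real (Suc n) < t) sequentially"
              by (rule order_tendstoD(2)[OF LIMSEQ_Suc[OF lim_1_over_n] True])
            moreover obtain M where M: "t \<le> real M" using real_arch_simple by blast
            have "eventually (\<lambda>n. t \<le> real (Suc n)) sequentially"
              using eventually_ge_at_top[of M] by eventually_elim (use M in auto)
            ultimately have "eventually (\<lambda>n. V t u * indicator {1 / real (Suc n)..real (Suc n)} t = V t u) sequentially"
              by eventually_elim (auto split: split_indicator)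
            then show ?thesis by (rule tendsto_eventually)
          qed (simp add: V_def)
        qed
      qed (use elim in \<open>auto simp: abs_mult split: split_indicator\<close>)
      then have "(\<lambda>n. T (1 / real (Suc n)) u + (\<integral>t. V t u * indicator {1 / real (Suc n)..real (Suc n)} t \<partial>lborel)) \<longlonglongrightarrow> T1 u"
        unfolding T1_def using elim by (intro tendsto_intros) auto
      moreover have "T (1 / real (Suc n)) u + (\<integral>t. V t u * indicator {1 / real (Suc n)..real (Suc n)} t \<partial>lborel) = T (real (Suc n)) u" for n
        using elim by (subst ftc) (auto simp: field_simps)
      ultimately show ?case by simp
    qed
    have law0: "distr unif borel T0 = \<nu>"
    proof -
      have "distr unif borel T0 = distr joint borel fst"
      proof (rule distr_eq_of_limits[OF prob_space_unif prob_space_joint _ _ _ _ _ l0])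
        show "distr unif borel (T (1 / real (Suc n))) = distr joint borel (ou (1 / real (Suc n)))" for n
          by (rule T_law) simp
        show "AE p in joint. (\<lambda>n. ou (1 / real (Suc n)) p) \<longlonglongrightarrow> fst p"
          by (intro AE_I2 ou_limit_0)
      qed measurable
      then show ?thesis by (simp add: distr_joint_fst)
    qed
    have law1: "distr unif borel T1 = std_gaussian"
    proof -
      have "distr unif borel T1 = distr joint borel snd"
      proof (rule distr_eq_of_limits[OF prob_space_unif prob_space_joint _ _ _ _ _ l1])
        show "distr unif borel (T (real (Suc n))) = distr joint borel (ou (real (Suc n)))" for n
          by (rule T_law) simp
        show "AE p in joint. (\<lambda>n. ou (real (Suc n)) p) \<longlonglongrightarrow> snd p"
          by (intro AE_I2 ou_limit_infinity)
      qed measurable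
      then show ?thesis by (simp add: distr_joint_snd)
    qed
    define \<pi> where "\<pi> = distr unif (borel \<Otimes>\<^sub>M borel) (\<lambda>u. (T0 u, T1 u))"
    have \<pi>: "\<pi> \<in> couplings \<nu> std_gaussian"
      unfolding couplings_def \<pi>_def using law0 law1 by (auto simp: distr_distr o_def)
    have "(\<integral>\<^sup>+(x, y). ennreal (\<bar>y - x\<bar> powr p) \<partial>\<pi>) = (\<integral>\<^sup>+u. ennreal (\<bar>T1 u - T0 u\<bar> powr p) \<partial>unif)"
      unfolding \<pi>_def by (subst nn_integral_distr) auto
    also have "\<dots> \<le> (\<integral>\<^sup>+u. ennreal_powr (\<integral>\<^sup>+t. ennreal \<bar>V t u\<bar> \<partial>lborel) p \<partial>unif)"
    proof (rule nn_integral_mono_AE)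
      show "AE u in unif. ennreal (\<bar>T1 u - T0 u\<bar> powr p) \<le> ennreal_powr (\<integral>\<^sup>+t. ennreal \<bar>V t u\<bar> \<partial>lborel) p"
        using int
      proof eventually_elim
        case (elim u)
        have "\<bar>T1 u - T0 u\<bar> \<le> (\<integral>t. \<bar>V t u\<bar> \<partial>lborel)"
          unfolding T1_def using integral_abs_bound[of lborel "\<lambda>t. V t u"] by simp
        then have "ennreal \<bar>T1 u - T0 u\<bar> \<le> (\<integral>\<^sup>+t. ennreal \<bar>V t u\<bar> \<partial>lborel)"
          using elim by (subst nn_integral_eq_integral) (auto intro: ennreal_leI)
        then have "ennreal_powr (ennreal \<bar>T1 u - T0 u\<bar>) p \<le> ennreal_powr (\<integral>\<^sup>+t. ennreal \<bar>V t u\<bar> \<partial>lborel) p"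
          using p by (intro ennreal_powr_mono) auto
        then show ?case by (simp add: ennreal_powr_ennreal)
      qed
    qed
    also note mink
    finally have cost: "(\<integral>\<^sup>+(x, y). ennreal (\<bar>y - x\<bar> powr p) \<partial>\<pi>) \<le> ennreal_powr (\<integral>\<^sup>+t. N t \<partial>lborel) p" .
    have "(INF \<pi>\<in>couplings \<nu> std_gaussian. \<integral>\<^sup>+ (x, y). ennreal (\<bar>y - x\<bar> powr p) \<partial>\<pi>) \<le>
        ennreal_powr (\<integral>\<^sup>+t. N t \<partial>lborel) p"
      by (rule INF_lower2[OF \<pi>]) (rule cost)
    then have "wasserstein p \<nu> std_gaussian \<le> ennreal_powr (ennreal_powr (\<integral>\<^sup>+t. N t \<partial>lborel) p) (1 / p)"
      unfolding wasserstein_def using p by (intro ennreal_powr_mono) auto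
    also have "\<dots> = (\<integral>\<^sup>+t. N t \<partial>lborel)" using p by (intro ennreal_powr_powr) auto
    finally show ?thesis by (simp add: N_def)
  qed
qed

end

section \<open>Hermite expansion of an increment between equal laws\<close>

text \<open>One term of the exponential series of \<open>h\<^sup>2\<close>.\<close>

lemma power_le_exp_half_square: "\<bar>h\<bar> ^ k \<le> sqrt (fact k) * exp (h\<^sup>2 / 2)"
proof -
  have "0 \<le> (\<integral>z. (exp_mart_rest (Suc k) h z)\<^sup>2 \<partial>std_gaussian)" by (intro integral_nonneg_AE) auto
  then have "(\<Sum>j<Suc k. (h\<^sup>2) ^ j / fact j) \<le> exp (h\<^sup>2)" unfolding exp_mart_rest_norm by simp
  moreover have "(h\<^sup>2) ^ k / fact k \<le> (\<Sum>j<Suc k. (h\<^sup>2) ^ j / fact j)"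
    by (simp add: sum_nonneg)
  ultimately have "(h\<^sup>2) ^ k \<le> fact k * exp (h\<^sup>2)"
    by (simp add: field_simps)
  then have "sqrt ((h\<^sup>2) ^ k) \<le> sqrt (fact k * exp (h\<^sup>2))" by (rule real_sqrt_le_mono)
  moreover have "sqrt ((h\<^sup>2) ^ k) = \<bar>h\<bar> ^ k"
  proof (rule real_sqrt_unique)
    have "(\<bar>h\<bar> ^ k)\<^sup>2 = (\<bar>h\<bar>\<^sup>2) ^ k" by (simp only: power_mult[symmetric] mult.commute)
    then show "(\<bar>h\<bar> ^ k)\<^sup>2 = (h\<^sup>2) ^ k" by simp
  qed simp
  moreover have "sqrt (exp (h\<^sup>2)) = exp (h\<^sup>2 / 2)"
    by (rule real_sqrt_unique) (simp_all add: power2_eq_square flip: exp_add)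
  ultimately show ?thesis by (simp add: real_sqrt_mult)
qed

text \<open>The norm of \<open>exp_mart_rest n h\<close>.\<close>

definition taylor_error :: "nat \<Rightarrow> real \<Rightarrow> real" where
  "taylor_error n h = sqrt (exp (h\<^sup>2) - (\<Sum>k<n. (h\<^sup>2) ^ k / fact k))"

lemma taylor_error_measurable [measurable]: "taylor_error n \<in> borel_measurable borel"
  unfolding taylor_error_def by measurable

lemma taylor_error_tendsto: "(\<lambda>n. taylor_error n h) \<longlonglongrightarrow> 0"
proof -
  have "(\<lambda>k. (h\<^sup>2) ^ k /\<^sub>R fact k) sums exp (h\<^sup>2)" by (rule exp_converges)
  then have "(\<lambda>n. \<Sum>k<n. (h\<^sup>2) ^ k / fact k) \<longlonglongrightarrow> exp (h\<^sup>2)"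
    by (simp add: sums_def divide_inverse_commute)
  then have "(\<lambda>n. sqrt (exp (h\<^sup>2) - (\<Sum>k<n. (h\<^sup>2) ^ k / fact k))) \<longlonglongrightarrow> sqrt (exp (h\<^sup>2) - exp (h\<^sup>2))"
    by (intro tendsto_intros)
  then show ?thesis by (simp add: taylor_error_def)
qed

lemma taylor_error_bounds: "0 \<le> taylor_error n h" "taylor_error n h \<le> exp (h\<^sup>2 / 2)"
proof -
  have "0 \<le> (\<integral>z. (exp_mart_rest n h z)\<^sup>2 \<partial>std_gaussian)" by (intro integral_nonneg_AE) auto
  then show "0 \<le> taylor_error n h" unfolding exp_mart_rest_norm taylor_error_def by simp
  have "taylor_error n h \<le> sqrt (exp (h\<^sup>2))"
    unfolding taylor_error_def by (intro real_sqrt_le_mono) (simp add: sum_nonneg)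
  also have "\<dots> = exp (h\<^sup>2 / 2)"
    by (rule real_sqrt_unique) (simp_all add: power2_eq_square flip: exp_add)
  finally show "taylor_error n h \<le> exp (h\<^sup>2 / 2)" .
qed

lemma compact_support_antiderivative:
  fixes w :: "real \<Rightarrow> real"
  assumes cont: "continuous_on UNIV w" and supp: "\<And>x. R \<le> \<bar>x\<bar> \<Longrightarrow> w x = 0"
  obtains f C where "\<And>x. (f has_real_derivative w x) (at x)" "\<And>x. \<bar>f x\<bar> \<le> C"
proof -
  have "(- \<infinity>::ereal) < \<infinity>" by simp
  from einterval_antiderivative[OF this, of w] cont
  have "\<exists>F. \<forall>x. (F has_vector_derivative w x) (at x)" by (simp add: continuous_on_eq_continuous_at)
  then obtain f where "\<forall>x. (f has_vector_derivative w x) (at x)" ..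
  then have f: "(f has_real_derivative w x) (at x)" for x
    unfolding has_real_derivative_iff_has_vector_derivative by simp
  define B where "B = \<bar>R\<bar>"
  have cf: "continuous_on {- B..B} f"
    using f DERIV_isCont continuous_at_imp_continuous_on by blast
  have "bounded (f ` {- B..B})"
    by (intro compact_imp_bounded compact_continuous_image cf) simp
  then obtain C where "\<forall>y\<in>f ` {- B..B}. norm y \<le> C"
    unfolding bounded_iff ..
  then have C: "\<bar>f x\<bar> \<le> C" if "x \<in> {- B..B}" for x
    using that by simp
  have "\<bar>f x\<bar> \<le> C" for x
  proof -
    have const: "f x = f y" if "\<And>z. min x y \<le> z \<Longrightarrow> z \<le> max x y \<Longrightarrow> R \<le> \<bar>z\<bar>" for y
    proof (cases x y rule: linorder_cases)
      case less
      have "f y = f x"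
      proof (rule DERIV_isconst_end[OF less])
        show "continuous_on {x..y} f" using f DERIV_isCont continuous_at_imp_continuous_on by blast
        show "(f has_real_derivative 0) (at z)" if "x < z" "z < y" for z
          using f[of z] supp[of z] \<open>\<And>z. min x y \<le> z \<Longrightarrow> z \<le> max x y \<Longrightarrow> R \<le> \<bar>z\<bar>\<close>[of z] that less by auto
      qed
      then show ?thesis by simp
    next
      case greater
      show ?thesis
      proof (rule DERIV_isconst_end[OF greater])
        show "continuous_on {y..x} f" using f DERIV_isCont continuous_at_imp_continuous_on by blast
        show "(f has_real_derivative 0) (at z)" if "y < z" "z < x" for z
          using f[of z] supp[of z] \<open>\<And>z. min x y \<le> z \<Longrightarrow> z \<le> max x y \<Longrightarrow> R \<le> \<bar>z\<bar>\<close>[of z] that greater by auto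
      qed
    qed simp
    consider "x \<in> {- B..B}" | "B < x" | "x < - B" by force
    then show ?thesis
    proof cases
      case 1 then show ?thesis by (rule C)
    next
      case 2
      have "f x = f B" by (rule const) (use 2 in \<open>auto simp: B_def\<close>)
      then show ?thesis using C[of B] by (simp add: B_def)
    next
      case 3
      have "f x = f (- B)" by (rule const) (use 3 in \<open>auto simp: B_def\<close>)
      then show ?thesis using C[of "- B"] by (simp add: B_def)
    qed
  qed
  with f that show thesis by blast
qed

lemma compact_support_bounded:
  fixes w :: "real \<Rightarrow> real"
  assumes cont: "continuous_on UNIV w" and supp: "\<And>x. R \<le> \<bar>x\<bar> \<Longrightarrow> w x = 0"
  obtains C where "\<And>x. \<bar>w x\<bar> \<le> C"
proof -
  have "bounded (w ` {- R..R})"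
    by (intro compact_imp_bounded compact_continuous_image continuous_on_subset[OF cont]) auto
  then obtain C where "\<forall>y\<in>w ` {- R..R}. norm y \<le> C"
    unfolding bounded_iff ..
  then have C: "\<bar>w x\<bar> \<le> C" if "x \<in> {- R..R}" for x
    using that by simp
  have "\<bar>w x\<bar> \<le> max C 0" for x
  proof (cases "R \<le> \<bar>x\<bar>")
    case False
    then have "x \<in> {- R..R}" by (auto simp: abs_if split: if_splits)
    then show ?thesis using C by fastforce
  qed (simp add: supp)
  then show thesis by (rule that)
qed

text \<open>The coefficient at \<open>hermite k\<close>, up to the factor \<open>fact k\<close>, of \<open>w (F\<^sub>t)\<close> as a function of \<open>Z\<close> when \<open>X\<^sub>0 = x\<close>; here \<open>b\<close>
stands for \<open>exp (- t)\<close>.\<close>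

definition hermite_coeff :: "(real \<Rightarrow> real) \<Rightarrow> real \<Rightarrow> real \<Rightarrow> nat \<Rightarrow> real \<Rightarrow> real" where
  "hermite_coeff w b a k x = (\<integral>z. w (b * (x + a * z)) * hermite k z \<partial>std_gaussian)"

lemma hermite_coeff_measurable [measurable (raw)]:
  assumes [measurable]: "w \<in> borel_measurable borel" "f \<in> borel_measurable M"
  shows "(\<lambda>x. hermite_coeff w b a k (f x)) \<in> borel_measurable M"
  unfolding hermite_coeff_def by measurable

lemma hermite_coeff_bound:
  assumes [measurable]: "w \<in> borel_measurable borel" and bd: "\<And>x. \<bar>w x\<bar> \<le> C"
  shows "\<bar>hermite_coeff w b a k x\<bar> \<le> C * (\<integral>z. \<bar>hermite k z\<bar> \<partial>std_gaussian)"
proof -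
  have e: "expgrowth (\<lambda>z. w (b * (x + a * z)))" by (rule expgrowth_bounded[of _ C]) (use bd in auto)
  have "\<bar>hermite_coeff w b a k x\<bar> \<le> (\<integral>z. \<bar>w (b * (x + a * z)) * hermite k z\<bar> \<partial>std_gaussian)"
    unfolding hermite_coeff_def by (rule integral_abs_bound)
  also have "\<dots> \<le> (\<integral>z. C * \<bar>hermite k z\<bar> \<partial>std_gaussian)"
  proof (rule integral_mono)
    show "\<bar>w (b * (x + a * z)) * hermite k z\<bar> \<le> C * \<bar>hermite k z\<bar>" for z
      unfolding abs_mult using bd by (intro mult_right_mono) auto
  qed (intro expgrowth_integrable expgrowth_abs expgrowth_mult[OF e] expgrowth_mult[OF expgrowth_const] expgrowth_hermite)+
  finally show ?thesis by simp
qed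

text \<open>Let \<open>f\<close> be a primitive of \<open>w\<close>, bounded since \<open>w\<close> has compact support.  Replacing \<open>X\<close> by \<open>Y\<close> shifts the Gaussian
variable in \<open>f (b * (X + a * Z))\<close> by \<open>h = (Y - X) / a\<close>, so \<open>gaussian_taylor\<close> expands the difference of the conditional
means.  Its expectation is zero since the laws agree, integration by parts turns \<open>f\<close> and
\<open>hermite (Suc k)\<close> into \<open>w\<close> and \<open>hermite k\<close>, and the error is dominated by \<open>exp (h\<^sup>2 / 2)\<close>.\<close>

lemma (in prob_space) stein_expansion_tendsto_0:
  fixes X Y :: "'a \<Rightarrow> real"
  assumes [measurable]: "X \<in> borel_measurable M" "Y \<in> borel_measurable M"
    and law: "distr M borel X = distr M borel Y"
    and a: "0 < a" and b: "0 < b"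
    and cont: "continuous_on UNIV w" and supp: "\<And>x. R \<le> \<bar>x\<bar> \<Longrightarrow> w x = 0"
    and int: "integrable M (\<lambda>\<omega>. exp (((Y \<omega> - X \<omega>) / a)\<^sup>2 / 2))"
  shows "(\<lambda>n. \<Sum>k<n. expectation (\<lambda>\<omega>. ((Y \<omega> - X \<omega>) / a) ^ Suc k / fact (Suc k) * hermite_coeff w b a k (X \<omega>))) \<longlonglongrightarrow> 0"
    and "integrable M (\<lambda>\<omega>. ((Y \<omega> - X \<omega>) / a) ^ k)"
proof -
  define h where "h \<omega> = (Y \<omega> - X \<omega>) / a" for \<omega>
  have [measurable]: "h \<in> borel_measurable M" unfolding h_def by measurable
  have hint: "integrable M (\<lambda>\<omega>. exp ((h \<omega>)\<^sup>2 / 2))" using int by (simp add: h_def)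
  have hpow: "integrable M (\<lambda>\<omega>. h \<omega> ^ k)" for k
  proof (rule Bochner_Integration.integrable_bound)
    show "integrable M (\<lambda>\<omega>. sqrt (fact k) * exp ((h \<omega>)\<^sup>2 / 2))" using hint by simp
    show "AE \<omega> in M. norm (h \<omega> ^ k) \<le> norm (sqrt (fact k) * exp ((h \<omega>)\<^sup>2 / 2))"
      using power_le_exp_half_square by (intro AE_I2) (simp add: power_abs)
  qed simp
  then show "integrable M (\<lambda>\<omega>. ((Y \<omega> - X \<omega>) / a) ^ k)" by (simp add: h_def)
  obtain f C where f: "\<And>x. (f has_real_derivative w x) (at x)" "\<And>x. \<bar>f x\<bar> \<le> C"
    using compact_support_antiderivative[OF cont supp] by metis
  obtain Cw where Cw: "\<And>x. \<bar>w x\<bar> \<le> Cw" using compact_support_bounded[OF cont supp] by metis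
  have C: "0 \<le> C" using f(2)[of 0] by simp
  have [measurable]: "w \<in> borel_measurable borel" by (rule borel_measurable_continuous_onI[OF cont])
  have contf: "continuous_on UNIV f" using f(1) DERIV_isCont continuous_at_imp_continuous_on by blast
  have [measurable]: "f \<in> borel_measurable borel" by (rule borel_measurable_continuous_onI[OF contf])
  define W where "W = hermite_coeff w b a"
  have [measurable]: "W k \<in> borel_measurable borel" for k unfolding W_def by measurable
  have Wint: "integrable M (\<lambda>\<omega>. h \<omega> ^ j / fact i * W k (X \<omega>))" for i j k
  proof (rule Bochner_Integration.integrable_bound)
    let ?K = "Cw * (\<integral>z. \<bar>hermite k z\<bar> \<partial>std_gaussian)"
    show "integrable M (\<lambda>\<omega>. \<bar>h \<omega> ^ j / fact i\<bar> * ?K)" using hpow by simp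
    show "AE \<omega> in M. norm (h \<omega> ^ j / fact i * W k (X \<omega>)) \<le> norm (\<bar>h \<omega> ^ j / fact i\<bar> * ?K)"
    proof (rule AE_I2)
      fix \<omega>
      have "\<bar>h \<omega> ^ j / fact i\<bar> * \<bar>W k (X \<omega>)\<bar> \<le> \<bar>h \<omega> ^ j / fact i\<bar> * ?K"
        unfolding W_def by (intro mult_left_mono hermite_coeff_bound Cw) auto
      then show "norm (h \<omega> ^ j / fact i * W k (X \<omega>)) \<le> norm (\<bar>h \<omega> ^ j / fact i\<bar> * ?K)"
        unfolding real_norm_def abs_mult[of "h \<omega> ^ j / fact i"] by linarith
    qed
  qed measurable
  define G where "G x = (\<integral>z. f (b * (x + a * z)) \<partial>std_gaussian)" for x
  have [measurable]: "G \<in> borel_measurable borel" unfolding G_def by measurable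
  have Gb: "\<bar>G x\<bar> \<le> C" for x unfolding G_def by (rule gaussian_integral_abs_le) (use f in auto)
  have Gi: "integrable M (\<lambda>\<omega>. G (X \<omega>))" "integrable M (\<lambda>\<omega>. G (Y \<omega>))"
    by (rule integrable_const_bound[where B=C]; use Gb in auto)+
  have GG: "expectation (\<lambda>\<omega>. G (X \<omega>)) = expectation (\<lambda>\<omega>. G (Y \<omega>))"
  proof -
    have "expectation (\<lambda>\<omega>. G (X \<omega>)) = integral\<^sup>L (distr M borel X) G" by (subst integral_distr) auto
    also have "\<dots> = expectation (\<lambda>\<omega>. G (Y \<omega>))" unfolding law by (subst integral_distr) auto
    finally show ?thesis .
  qed
  have ibp: "(\<integral>z. f (b * (x + a * z)) * hermite (Suc k) z \<partial>std_gaussian) = a * b * W k x" for x k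
  proof -
    have "(\<integral>z. f (b * (x + a * z)) * hermite (Suc k) z \<partial>std_gaussian) =
       (\<integral>z. (w (b * (x + a * z)) * (b * a)) * hermite k z \<partial>std_gaussian)"
    proof (rule hermite_integration_by_parts)
      show "((\<lambda>z. f (b * (x + a * z))) has_real_derivative w (b * (x + a * z)) * (b * a)) (at z)" for z
        by (rule DERIV_chain2[OF f(1)]) (auto intro!: derivative_eq_intros)
      show "continuous_on UNIV (\<lambda>z. w (b * (x + a * z)) * (b * a))"
        by (intro continuous_intros continuous_on_compose2[OF cont]) auto
      show "expgrowth (\<lambda>z. f (b * (x + a * z)))" by (rule expgrowth_bounded[of _ C]) (use f in auto)
      have "expgrowth (\<lambda>z. w (b * (x + a * z)))" by (rule expgrowth_bounded[of _ Cw]) (use Cw in auto)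
      then show "expgrowth (\<lambda>z. w (b * (x + a * z)) * (b * a))" by (intro expgrowth_mult expgrowth_const)
    qed
    also have "\<dots> = (\<integral>z. a * b * (w (b * (x + a * z)) * hermite k z) \<partial>std_gaussian)"
      by (simp add: ac_simps)
    also have "\<dots> = a * b * W k x" by (simp add: W_def hermite_coeff_def)
    finally show ?thesis .
  qed
  have pointwise: "\<bar>G (Y \<omega>) - G (X \<omega>) - a * b * (\<Sum>k<n. h \<omega> ^ Suc k / fact (Suc k) * W k (X \<omega>))\<bar>
      \<le> C * taylor_error (Suc n) (h \<omega>)" for n \<omega>
  proof -
    have "G (Y \<omega>) = (\<integral>z. f (b * (X \<omega> + a * (z + h \<omega>))) \<partial>std_gaussian)"
    proof -
      have ah: "a * h \<omega> = Y \<omega> - X \<omega>" using a by (simp add: h_def)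
      have "X \<omega> + a * (z + h \<omega>) = Y \<omega> + a * z" for z
        unfolding distrib_left ah by linarith
      then show ?thesis unfolding G_def by (simp only:)
    qed
    moreover have "G (X \<omega>) + a * b * (\<Sum>k<n. h \<omega> ^ Suc k / fact (Suc k) * W k (X \<omega>)) =
      (\<Sum>k<Suc n. h \<omega> ^ k / fact k * (\<integral>z. f (b * (X \<omega> + a * z)) * hermite k z \<partial>std_gaussian))"
      unfolding sum.lessThan_Suc_shift ibp by (simp add: G_def sum_distrib_left ac_simps del: fact_Suc power_Suc)
    moreover have "\<bar>(\<integral>z. f (b * (X \<omega> + a * (z + h \<omega>))) \<partial>std_gaussian) -
      (\<Sum>k<Suc n. h \<omega> ^ k / fact k * (\<integral>z. f (b * (X \<omega> + a * z)) * hermite k z \<partial>std_gaussian))\<bar>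
      \<le> C * taylor_error (Suc n) (h \<omega>)"
      unfolding taylor_error_def
      by (rule gaussian_taylor[where f="\<lambda>z. f (b * (X \<omega> + a * z))"]) (use f in auto)
    ultimately show ?thesis by (simp add: diff_diff_eq)
  qed
  define E where "E n = (\<Sum>k<n. expectation (\<lambda>\<omega>. h \<omega> ^ Suc k / fact (Suc k) * W k (X \<omega>)))" for n
  have tint: "integrable M (\<lambda>\<omega>. taylor_error n (h \<omega>))" for n
    using taylor_error_bounds by (intro Bochner_Integration.integrable_bound[OF hint]) auto
  have lef: "\<bar>a * b * E n\<bar> \<le> C * expectation (\<lambda>\<omega>. taylor_error (Suc n) (h \<omega>))" for n
  proof -
    let ?S = "\<lambda>\<omega>. \<Sum>k<n. h \<omega> ^ Suc k / fact (Suc k) * W k (X \<omega>)"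
    have Si: "integrable M ?S" by (intro Bochner_Integration.integrable_sum Wint)
    have "expectation ?S = E n" unfolding E_def by (intro Bochner_Integration.integral_sum Wint)
    then have "expectation (\<lambda>\<omega>. G (Y \<omega>) - G (X \<omega>) - a * b * ?S \<omega>) = - (a * b * E n)"
      using Gi Si GG by (simp del: fact_Suc power_Suc)
    then have "\<bar>a * b * E n\<bar> = \<bar>expectation (\<lambda>\<omega>. G (Y \<omega>) - G (X \<omega>) - a * b * ?S \<omega>)\<bar>" by simp
    also have "\<dots> \<le> expectation (\<lambda>\<omega>. \<bar>G (Y \<omega>) - G (X \<omega>) - a * b * ?S \<omega>\<bar>)"
      by (rule integral_abs_bound)
    also have "\<dots> \<le> expectation (\<lambda>\<omega>. C * taylor_error (Suc n) (h \<omega>))"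
      by (intro integral_mono pointwise integrable_abs Bochner_Integration.integrable_diff Gi
          integrable_mult_right Si tint)
    finally show ?thesis by simp
  qed
  have limf: "(\<lambda>n. C * expectation (\<lambda>\<omega>. taylor_error (Suc n) (h \<omega>))) \<longlonglongrightarrow> C * expectation (\<lambda>\<omega>. 0)"
  proof (intro tendsto_mult tendsto_const integral_dominated_convergence[where w="\<lambda>\<omega>. exp ((h \<omega>)\<^sup>2 / 2)"])
    show "AE \<omega> in M. (\<lambda>n. taylor_error (Suc n) (h \<omega>)) \<longlonglongrightarrow> 0"
      by (intro AE_I2 LIMSEQ_Suc taylor_error_tendsto)
    show "AE \<omega> in M. norm (taylor_error (Suc n) (h \<omega>)) \<le> exp ((h \<omega>)\<^sup>2 / 2)" for n
      using taylor_error_bounds by auto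
  qed (use hint in auto)
  have "(\<lambda>n. a * b * E n) \<longlonglongrightarrow> 0"
  proof (rule Lim_null_comparison[OF always_eventually])
    show "\<forall>n. norm (a * b * E n) \<le> C * expectation (\<lambda>\<omega>. taylor_error (Suc n) (h \<omega>))"
      unfolding real_norm_def by (intro allI lef)
    show "(\<lambda>n. C * expectation (\<lambda>\<omega>. taylor_error (Suc n) (h \<omega>))) \<longlonglongrightarrow> 0"
      using limf by simp
  qed
  then have "(\<lambda>n. inverse (a * b) * (a * b * E n)) \<longlonglongrightarrow> inverse (a * b) * 0" by (intro tendsto_intros)
  then have "E \<longlonglongrightarrow> 0" using a b by simp
  then show "(\<lambda>n. \<Sum>k<n. expectation (\<lambda>\<omega>. ((Y \<omega> - X \<omega>) / a) ^ Suc k / fact (Suc k) * hermite_coeff w b a k (X \<omega>))) \<longlonglongrightarrow> 0"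
    by (simp add: E_def[abs_def] W_def h_def)
qed

context ou_flow
begin

lemma change_of_variables_zeta:
  fixes f :: "real \<Rightarrow> real \<Rightarrow> real"
  assumes [measurable]: "(\<lambda>p. f (fst p) (snd p)) \<in> borel_measurable (borel \<Otimes>\<^sub>M borel)" and t: "0 < t"
  shows "(\<integral>z. f (ou t (\<xi>, z)) z \<partial>std_gaussian) = (\<integral>x. f x (zeta t x \<xi>) * qker t x \<xi> \<partial>lborel)"
proof -
  have a: "0 < scale t" using t by (rule scale_pos)
  have fm [measurable]: "(\<lambda>z. f (g z) (h z)) \<in> borel_measurable borel"
    if [measurable]: "g \<in> borel_measurable borel" "h \<in> borel_measurable borel" for g h
    using measurable_compose[of "\<lambda>v. (g v, h v)" borel "borel \<Otimes>\<^sub>M borel" "\<lambda>p. f (fst p) (snd p)" borel] assms(1) by simp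
  have "(\<integral>z. f (ou t (\<xi>, z)) z \<partial>std_gaussian) = (\<integral>z. std_normal_density z * f (ou t (\<xi>, z)) z \<partial>lborel)"
    by (rule integral_std_gaussian) (rule fm, auto simp: ou_def)
  also have "\<dots> = \<bar>exp t / scale t\<bar> *\<^sub>R (\<integral>x. std_normal_density (- \<xi> / scale t + exp t / scale t * x) *
      f (ou t (\<xi>, - \<xi> / scale t + exp t / scale t * x)) (- \<xi> / scale t + exp t / scale t * x) \<partial>lborel)"
    by (rule lborel_integral_real_affine) (use a in auto)
  also have "\<dots> = (\<integral>x. f x (zeta t x \<xi>) * qker t x \<xi> \<partial>lborel)"
  proof -
    have z: "- \<xi> / scale t + exp t / scale t * x = zeta t x \<xi>" for x by (simp add: zeta_def diff_divide_distrib)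
    have o: "ou t (\<xi>, zeta t x \<xi>) = x" for x
      using a by (simp add: ou_def zeta_def exp_minus)
    show ?thesis unfolding z o using a by (simp add: qker_def ac_simps)
  qed
  finally show ?thesis .
qed

text \<open>Substituting \<open>x = F\<^sub>t\<close> for the Gaussian variable; compact support of \<open>g\<close> justifies the exchange of the integrals.\<close>

lemma integral_ou_compact:
  fixes g :: "real \<Rightarrow> real"
  assumes cont: "continuous_on UNIV g" and supp: "\<And>x. R \<le> \<bar>x\<bar> \<Longrightarrow> g x = 0" and t: "0 < t"
  shows "(\<integral>\<xi>. (\<integral>z. g (ou t (\<xi>, z)) \<partial>std_gaussian) \<partial>\<nu>) = (\<integral>x. g x * q t x \<partial>lborel)"
    and "(\<integral>\<xi>. (\<integral>z. g (ou t (\<xi>, z)) * (\<xi> - z / scale t) \<partial>std_gaussian) \<partial>\<nu>) = (\<integral>x. g x * r t x \<partial>lborel)"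
proof -
  interpret PS: pair_sigma_finite lborel \<nu> ..
  have [measurable]: "g \<in> borel_measurable borel" by (rule borel_measurable_continuous_onI[OF cont])
  obtain C where C: "\<And>x. \<bar>g x\<bar> \<le> C" using compact_support_bounded[OF cont supp] by metis
  have gi: "integrable lborel g"
  proof (rule Bochner_Integration.integrable_bound)
    show "integrable lborel (\<lambda>x. C * indicator {- R..R} x)"
      by (intro integrable_mult_right integrable_real_indicator) (auto simp: emeasure_lborel_Icc_eq)
    show "AE x in lborel. norm (g x) \<le> norm (C * indicator {- R..R} x)"
    proof (rule AE_I2)
      fix x :: real
      show "norm (g x) \<le> norm (C * indicator {- R..R} x)"
      proof (cases "R \<le> \<bar>x\<bar>")
        case False
        then have "x \<in> {- R..R}" by (auto simp: abs_if split: if_splits)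
        then show ?thesis using C[of x] by simp
      qed (simp add: supp)
    qed
  qed simp
  have bounds: "\<bar>qker t x \<xi>\<bar> \<le> exp t / scale t" "\<bar>rker t x \<xi>\<bar> \<le> (\<bar>\<xi>\<bar> + 1 / scale t) * (exp t / scale t)" for x \<xi>
    using qker_bound[of t t t x \<xi>] rker_bound[of t t t x \<xi>] t by auto
  have prod: "integrable (lborel \<Otimes>\<^sub>M \<nu>) (\<lambda>(x, \<xi>). \<bar>g x\<bar> * k \<xi>)" if k: "integrable \<nu> k" for k
  proof (rule PS.Fubini_integrable)
    have [measurable]: "k \<in> borel_measurable borel" using borel_measurable_integrable[OF k] by simp
    show "(\<lambda>(x, \<xi>). \<bar>g x\<bar> * k \<xi>) \<in> borel_measurable (lborel \<Otimes>\<^sub>M \<nu>)" by measurable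
    show "integrable lborel (\<lambda>x. \<integral>\<xi>. norm (case (x, \<xi>) of (x, \<xi>) \<Rightarrow> \<bar>g x\<bar> * k \<xi>) \<partial>\<nu>)"
      using gi by (simp add: abs_mult)
    show "AE x in lborel. integrable \<nu> (\<lambda>\<xi>. case (x, \<xi>) of (x, \<xi>) \<Rightarrow> \<bar>g x\<bar> * k \<xi>)"
      using k by simp
  qed
  have i1: "integrable (lborel \<Otimes>\<^sub>M \<nu>) (\<lambda>(x, \<xi>). g x * qker t x \<xi>)"
  proof (rule Bochner_Integration.integrable_bound[OF prod[of "\<lambda>_. exp t / scale t"]])
    show "AE p in lborel \<Otimes>\<^sub>M \<nu>. norm (case p of (x, \<xi>) \<Rightarrow> g x * qker t x \<xi>) \<le> norm (case p of (x, \<xi>) \<Rightarrow> \<bar>g x\<bar> * (exp t / scale t))"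
    proof (intro AE_I2, unfold split_paired_all prod.case)
      fix x \<xi> :: real
      have "\<bar>g x\<bar> * \<bar>qker t x \<xi>\<bar> \<le> \<bar>g x\<bar> * (exp t / scale t)" by (intro mult_left_mono bounds) simp
      then show "norm (g x * qker t x \<xi>) \<le> norm (\<bar>g x\<bar> * (exp t / scale t))"
        unfolding real_norm_def abs_mult[of "g x"] by linarith
    qed
  qed auto
  have i2: "integrable (lborel \<Otimes>\<^sub>M \<nu>) (\<lambda>(x, \<xi>). g x * rker t x \<xi>)"
  proof (rule Bochner_Integration.integrable_bound[OF prod[OF abs_integrable[of "1 / scale t" "exp t / scale t"]]])
    show "AE p in lborel \<Otimes>\<^sub>M \<nu>. norm (case p of (x, \<xi>) \<Rightarrow> g x * rker t x \<xi>) \<le>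
        norm (case p of (x, \<xi>) \<Rightarrow> \<bar>g x\<bar> * ((\<bar>\<xi>\<bar> + 1 / scale t) * (exp t / scale t)))"
    proof (intro AE_I2, unfold split_paired_all prod.case)
      fix x \<xi> :: real
      have "\<bar>g x\<bar> * \<bar>rker t x \<xi>\<bar> \<le> \<bar>g x\<bar> * ((\<bar>\<xi>\<bar> + 1 / scale t) * (exp t / scale t))" by (intro mult_left_mono bounds) simp
      then show "norm (g x * rker t x \<xi>) \<le> norm (\<bar>g x\<bar> * ((\<bar>\<xi>\<bar> + 1 / scale t) * (exp t / scale t)))"
        unfolding real_norm_def abs_mult[of "g x"] by linarith
    qed
  qed auto
  have "(\<integral>\<xi>. (\<integral>z. g (ou t (\<xi>, z)) \<partial>std_gaussian) \<partial>\<nu>) = (\<integral>\<xi>. (\<integral>x. g x * qker t x \<xi> \<partial>lborel) \<partial>\<nu>)"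
    by (subst change_of_variables_zeta[OF _ t, of "\<lambda>x z. g x"]) auto
  also have "\<dots> = (\<integral>x. (\<integral>\<xi>. g x * qker t x \<xi> \<partial>\<nu>) \<partial>lborel)" by (rule PS.Fubini_integral[OF i1])
  also have "\<dots> = (\<integral>x. g x * q t x \<partial>lborel)" by (simp add: q_def)
  finally show "(\<integral>\<xi>. (\<integral>z. g (ou t (\<xi>, z)) \<partial>std_gaussian) \<partial>\<nu>) = (\<integral>x. g x * q t x \<partial>lborel)" .
  have "(\<integral>\<xi>. (\<integral>z. g (ou t (\<xi>, z)) * (\<xi> - z / scale t) \<partial>std_gaussian) \<partial>\<nu>) = (\<integral>\<xi>. (\<integral>x. g x * rker t x \<xi> \<partial>lborel) \<partial>\<nu>)"
  proof (rule Bochner_Integration.integral_cong[OF refl])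
    fix \<xi>
    show "(\<integral>z. g (ou t (\<xi>, z)) * (\<xi> - z / scale t) \<partial>std_gaussian) = (\<integral>x. g x * rker t x \<xi> \<partial>lborel)"
      by (subst change_of_variables_zeta[OF _ t, of "\<lambda>x z. g x * (\<xi> - z / scale t)"]) (auto simp: rker_def mult.assoc)
  qed
  also have "\<dots> = (\<integral>x. (\<integral>\<xi>. g x * rker t x \<xi> \<partial>\<nu>) \<partial>lborel)" by (rule PS.Fubini_integral[OF i2])
  also have "\<dots> = (\<integral>x. g x * r t x \<partial>lborel)" by (simp add: r_def)
  finally show "(\<integral>\<xi>. (\<integral>z. g (ou t (\<xi>, z)) * (\<xi> - z / scale t) \<partial>std_gaussian) \<partial>\<nu>) = (\<integral>x. g x * r t x \<partial>lborel)" .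
qed

end

section \<open>Bound of the velocity and conclusion\<close>

text \<open>Test functions of \<open>Z\<close> cannot distinguish \<open>Y\<close> from its conditional expectation given \<open>Z\<close>.\<close>

lemma (in prob_space) cond_exp_given_integral:
  fixes Z Y :: "'a \<Rightarrow> real" and \<phi> :: "real \<Rightarrow> real"
  assumes [measurable]: "Z \<in> borel_measurable M" and Y: "integrable M Y"
    and [measurable]: "\<phi> \<in> borel_measurable borel" and bd: "\<And>x. \<bar>\<phi> x\<bar> \<le> C"
  shows "integrable M (\<lambda>\<omega>. cond_exp_given M Z Y \<omega> * \<phi> (Z \<omega>))"
    and "expectation (\<lambda>\<omega>. cond_exp_given M Z Y \<omega> * \<phi> (Z \<omega>)) = expectation (\<lambda>\<omega>. Y \<omega> * \<phi> (Z \<omega>))"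
    and "integrable M (\<lambda>\<omega>. Y \<omega> * \<phi> (Z \<omega>))"
proof -
  let ?F = "vimage_algebra (space M) Z borel"
  have sub: "subalgebra M ?F"
    unfolding subalgebra_def
  proof
    show "sets ?F \<subseteq> sets M"
      using measurable_sets[OF assms(1)] by (auto simp: sets_vimage_algebra2)
  qed simp
  interpret F: finite_measure_subalgebra M ?F by unfold_locales (rule sub)
  have [measurable]: "Y \<in> borel_measurable M" using Y by simp
  have ZF: "Z \<in> ?F \<rightarrow>\<^sub>M borel" by (rule measurable_vimage_algebra1) simp
  have \<phi>F: "(\<lambda>\<omega>. \<phi> (Z \<omega>)) \<in> borel_measurable ?F" by (rule measurable_compose[OF ZF assms(3)])
  have i: "integrable M (\<lambda>\<omega>. \<phi> (Z \<omega>) * Y \<omega>)"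
  proof (rule Bochner_Integration.integrable_bound)
    show "integrable M (\<lambda>\<omega>. C * \<bar>Y \<omega>\<bar>)" using Y by simp
    show "AE \<omega> in M. norm (\<phi> (Z \<omega>) * Y \<omega>) \<le> norm (C * \<bar>Y \<omega>\<bar>)"
    proof (rule AE_I2)
      fix \<omega>
      have "\<bar>\<phi> (Z \<omega>)\<bar> * \<bar>Y \<omega>\<bar> \<le> C * \<bar>Y \<omega>\<bar>" by (intro mult_right_mono bd) simp
      then show "norm (\<phi> (Z \<omega>) * Y \<omega>) \<le> norm (C * \<bar>Y \<omega>\<bar>)"
        unfolding real_norm_def abs_mult[of "\<phi> (Z \<omega>)"] by linarith
    qed
  qed measurable
  then show "integrable M (\<lambda>\<omega>. Y \<omega> * \<phi> (Z \<omega>))" by (simp add: mult.commute)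
  show "integrable M (\<lambda>\<omega>. cond_exp_given M Z Y \<omega> * \<phi> (Z \<omega>))"
    and "expectation (\<lambda>\<omega>. cond_exp_given M Z Y \<omega> * \<phi> (Z \<omega>)) = expectation (\<lambda>\<omega>. Y \<omega> * \<phi> (Z \<omega>))"
    using F.real_cond_exp_intg[OF i \<phi>F] by (simp_all add: cond_exp_given_def mult.commute)
qed

text \<open>The graph of \<open>\<bar>y\<bar> powr p\<close> lies above its tangent at \<open>x\<close>; this is Young's inequality.\<close>

lemma powr_tangent_le:
  fixes x y p :: real
  assumes p: "1 < p"
  shows "\<bar>x\<bar> powr p + p * (sgn x * \<bar>x\<bar> powr (p - 1)) * (y - x) \<le> \<bar>y\<bar> powr p"
proof (cases "x = 0")
  case True
  then show ?thesis using p by simp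
next
  case False
  then have x: "0 < \<bar>x\<bar>" by simp
  have "\<bar>y\<bar> \<le> 1 / p * (\<bar>y\<bar> powr p * \<bar>x\<bar> powr (1 - p)) + (1 - 1 / p) * \<bar>x\<bar>"
    using x p by (intro young_powr) auto
  then have "(p * \<bar>x\<bar> powr (p - 1)) * \<bar>y\<bar> \<le> (p * \<bar>x\<bar> powr (p - 1)) * (1 / p * (\<bar>y\<bar> powr p * \<bar>x\<bar> powr (1 - p)) + (1 - 1 / p) * \<bar>x\<bar>)"
    using p by (intro mult_left_mono) auto
  also have "\<dots> = \<bar>y\<bar> powr p * (\<bar>x\<bar> powr (p - 1) * \<bar>x\<bar> powr (1 - p)) + (p - 1) * (\<bar>x\<bar> powr (p - 1) * \<bar>x\<bar>)"
    using p by (simp add: field_simps)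
  also have "\<bar>x\<bar> powr (p - 1) * \<bar>x\<bar> powr (1 - p) = 1" using x by (simp flip: powr_add)
  also have xp: "\<bar>x\<bar> powr (p - 1) * \<bar>x\<bar> = \<bar>x\<bar> powr p"
    using x powr_add[of "\<bar>x\<bar>" "p - 1" 1] by simp
  finally have 1: "(p * \<bar>x\<bar> powr (p - 1)) * \<bar>y\<bar> \<le> \<bar>y\<bar> powr p + (p - 1) * \<bar>x\<bar> powr p" by simp
  have "sgn x * y \<le> \<bar>y\<bar>" by (auto simp: sgn_if abs_if)
  then have "(p * \<bar>x\<bar> powr (p - 1)) * (sgn x * y) \<le> (p * \<bar>x\<bar> powr (p - 1)) * \<bar>y\<bar>"
    using p by (intro mult_left_mono) auto
  with 1 have 2: "(p * \<bar>x\<bar> powr (p - 1)) * (sgn x * y) \<le> \<bar>y\<bar> powr p + (p - 1) * \<bar>x\<bar> powr p" by linarith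
  have 3: "p * (sgn x * \<bar>x\<bar> powr (p - 1)) * (y - x) =
      (p * \<bar>x\<bar> powr (p - 1)) * (sgn x * y) - p * (\<bar>x\<bar> powr (p - 1) * (sgn x * x))"
    by (simp add: algebra_simps)
  have "sgn x * x = \<bar>x\<bar>" by (simp add: sgn_if abs_if)
  then have 4: "p * (\<bar>x\<bar> powr (p - 1) * (sgn x * x)) = p * \<bar>x\<bar> powr p" using xp by simp
  show ?thesis unfolding 3 4 using 2 by (simp add: left_diff_distrib)
qed

lemma continuous_sgn_powr:
  fixes r :: real
  assumes "0 < r"
  shows "continuous_on UNIV (\<lambda>x::real. sgn x * \<bar>x\<bar> powr r)"
proof -
  have "(\<lambda>x::real. sgn x * \<bar>x\<bar> powr r) = (\<lambda>x. (max x 0) powr r - (max (- x) 0) powr r)"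
    using assms by (auto simp: fun_eq_iff sgn_if abs_if)
  moreover have "continuous_on UNIV (\<lambda>x::real. (max x 0) powr r - (max (- x) 0) powr r)"
    using assms by (intro continuous_intros continuous_on_powr') auto
  ultimately show ?thesis by (simp only:)
qed

definition cutoff :: "nat \<Rightarrow> real \<Rightarrow> real" where
  "cutoff n x = max 0 (min 1 (real n + 1 - \<bar>x\<bar>))"

lemma cutoff: "0 \<le> cutoff n x" "cutoff n x \<le> 1" "real n + 1 \<le> \<bar>x\<bar> \<Longrightarrow> cutoff n x = 0"
  "\<bar>x\<bar> \<le> real n \<Longrightarrow> cutoff n x = 1"
  by (auto simp: cutoff_def)

lemma continuous_cutoff: "continuous_on A (cutoff n)"
  unfolding cutoff_def by (intro continuous_intros)

lemma cutoff_tendsto: "(\<lambda>n. cutoff n x) \<longlonglongrightarrow> 1"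
proof -
  obtain N where N: "\<bar>x\<bar> \<le> real N" using real_arch_simple by blast
  have "eventually (\<lambda>n. cutoff n x = 1) sequentially"
    using eventually_ge_at_top[of N] by eventually_elim (use N in \<open>auto intro!: cutoff(4)\<close>)
  then show ?thesis by (rule tendsto_eventually)
qed

lemma ennreal_powr_mult_left:
  assumes "0 < c"
  shows "ennreal_powr (ennreal c * x) a = ennreal (c powr a) * ennreal_powr x a"
proof (cases x)
  case (real r)
  then show ?thesis using assms
    by (simp add: ennreal_powr_ennreal powr_mult flip: ennreal_mult)
qed (use assms in \<open>simp add: ennreal_mult_top\<close>)

text \<open>The squared and weighted Hermite coefficients are the first terms of \<open>S_series\<close>, whose summation index is
one larger than the degree of the Hermite polynomial.\<close>

lemma S_series_ge:
  assumes t: "0 < t" and n: "2 \<le> n" and s: "0 < s"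
    and b0: "b 0 = cond_exp_given M (X 0) (\<lambda>w. (X t w - X 0 w) / s + X 0 w) \<omega>"
    and b1: "b (Suc 0) = cond_exp_given M (X 0) (\<lambda>w. (X t w - X 0 w)\<^sup>2 / (2 * s) - 1) \<omega> / scale t"
    and bk: "\<And>k. 2 \<le> k \<Longrightarrow> b k = cond_exp_given M (X 0) (\<lambda>w. (X t w - X 0 w) ^ Suc k) \<omega> / (s * fact (Suc k) * scale t ^ k)"
  shows "ennreal (\<Sum>k<n. max 1 (p - 1) ^ k * (b k)\<^sup>2 * fact k) \<le> S_series M X s p t \<omega>"
proof -
  define m where "m = max 1 (p - 1)"
  have m: "1 \<le> m" by (simp add: m_def)
  have a: "0 < scale t" using t by (rule scale_pos)
  have a2: "exp (2 * t) - 1 = (scale t)\<^sup>2" using scale_square[OF t] by simp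
  define T where "T k = (if k > 2 then
        ennreal (m ^ (k - 1) / (s\<^sup>2 * real k * fact k * (exp (2 * t) - 1) ^ (k - 1))
          * (cond_exp_given M (X 0) (\<lambda>w. (X t w - X 0 w) ^ k) \<omega>)\<^sup>2)
      else 0)" for k :: nat
  have Tk: "T (Suc k) = ennreal (m ^ k * (b k)\<^sup>2 * fact k)" if "2 \<le> k" for k
  proof -
    have "(exp (2 * t) - 1) ^ k = (scale t ^ k)\<^sup>2"
      unfolding a2 by (simp add: power_mult[symmetric] mult.commute)
    moreover define c where "c = cond_exp_given M (X 0) (\<lambda>w. (X t w - X 0 w) ^ Suc k) \<omega>"
    moreover have "m' / (s2 * K * (K * f) * A) * c2 = m' * (c2 / (s2 * (K * f)\<^sup>2 * A)) * f"
      if "f \<noteq> 0" for m' s2 K f A c2 :: real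
      using that by (simp add: power2_eq_square)
    ultimately show ?thesis
      using that unfolding T_def bk[OF that] c_def[symmetric] power_divide power_mult_distrib
      by (simp add: c_def power_mult_distrib)
  qed
  have "(\<Sum>k<n. m ^ k * (b k)\<^sup>2 * fact k) = (b 0)\<^sup>2 + m * (b (Suc 0))\<^sup>2 + (\<Sum>k\<in>{2..<n}. m ^ k * (b k)\<^sup>2 * fact k)"
  proof -
    have "{..<n} = {0, Suc 0} \<union> {2..<n}" using n by (auto simp: numeral_2_eq_2 not_less_eq_eq less_Suc_eq)
    then show ?thesis by (simp add: sum.union_disjoint)
  qed
  also have "ennreal \<dots> = ennreal ((b 0)\<^sup>2) + ennreal (m * (b (Suc 0))\<^sup>2) + (\<Sum>k\<in>{2..<n}. T (Suc k))"
    using m by (simp add: Tk ennreal_plus sum_nonneg sum_ennreal)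
  also have "\<dots> \<le> ennreal ((b 0)\<^sup>2) + ennreal (m * (b (Suc 0))\<^sup>2) + (\<Sum>k. T k)"
  proof (rule add_left_mono)
    have "(\<Sum>k\<in>{2..<n}. T (Suc k)) = (\<Sum>k\<in>Suc ` {2..<n}. T k)" by (subst sum.reindex) (auto simp: o_def)
    also have "\<dots> \<le> (\<Sum>k. T k)" by (rule sum_le_suminf) auto
    finally show "(\<Sum>k\<in>{2..<n}. T (Suc k)) \<le> (\<Sum>k. T k)" .
  qed
  also have "m * (b (Suc 0))\<^sup>2 = m / (exp (2 * t) - 1) * (cond_exp_given M (X 0) (\<lambda>w. (X t w - X 0 w)\<^sup>2 / (2 * s) - 1) \<omega>)\<^sup>2"
    unfolding b1 a2 by (simp add: power_divide)
  finally show ?thesis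
    unfolding S_series_def m_def[symmetric] T_def b0 .
qed

context ou_flow
begin

lemma integral_joint_bounded:
  fixes g :: "real \<Rightarrow> real"
  assumes [measurable]: "g \<in> borel_measurable borel" and bd: "\<And>x. \<bar>g x\<bar> \<le> C"
  shows "(\<integral>\<xi>. (\<integral>z. g (ou t (\<xi>, z)) \<partial>std_gaussian) \<partial>\<nu>) = (\<integral>\<omega>. g (ou t \<omega>) \<partial>joint)"
    and "integrable joint (\<lambda>\<omega>. g (ou t \<omega>))"
proof -
  interpret J: prob_space joint by (rule prob_space_joint)
  show i: "integrable joint (\<lambda>\<omega>. g (ou t \<omega>))"
    by (rule J.integrable_const_bound[where B=C]) (auto simp: bd)
  show "(\<integral>\<xi>. (\<integral>z. g (ou t (\<xi>, z)) \<partial>std_gaussian) \<partial>\<nu>) = (\<integral>\<omega>. g (ou t \<omega>) \<partial>joint)"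
    using joint.integral_fst'[OF i[unfolded joint_def]] by (simp add: joint_def)
qed

end

text \<open>A fixed time \<open>t\<close> of the process, with the exponential moment that makes the Hermite expansion of the
increment converge.\<close>

locale stein_setting = ou_flow \<nu> for \<nu> +
  fixes M :: "'b measure" and X :: "real \<Rightarrow> 'b \<Rightarrow> real" and p s t :: real
  assumes p: "1 \<le> p" and s: "0 < s" and t: "0 < t"
    and prob_space_M: "prob_space M"
    and X_meas: "X 0 \<in> borel_measurable M" "X t \<in> borel_measurable M"
    and X_law: "distr M borel (X 0) = \<nu>" "distr M borel (X t) = \<nu>"
    and exp_int: "integrable M (\<lambda>\<omega>. exp (((X t \<omega> - X 0 \<omega>) / scale t)\<^sup>2 / 2))"
begin

sublocale M: prob_space M by (rule prob_space_M)

lemmas [measurable] = X_meas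

abbreviation a :: real where "a \<equiv> scale t"

text \<open>The conditional expectations given \<open>X 0\<close> of the coefficients of \<open>hermite k\<close> in \<open>X\<^sub>0 - Z / a\<close> plus \<open>1 / s\<close> times
the Hermite series of the increment.\<close>

definition coeff :: "nat \<Rightarrow> 'b \<Rightarrow> real" where
  "coeff k \<omega> = (if k = 0 then cond_exp_given M (X 0) (\<lambda>w. (X t w - X 0 w) / s + X 0 w) \<omega>
    else if k = Suc 0 then cond_exp_given M (X 0) (\<lambda>w. (X t w - X 0 w)\<^sup>2 / (2 * s) - 1) \<omega> / scale t
    else cond_exp_given M (X 0) (\<lambda>w. (X t w - X 0 w) ^ Suc k) \<omega> / (s * fact (Suc k) * scale t ^ k))"

lemma scale_pos_t: "0 < scale t" using t by (rule scale_pos)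

lemma increment_power_integrable: "integrable M (\<lambda>\<omega>. (X t \<omega> - X 0 \<omega>) ^ k)"
proof -
  have "integrable M (\<lambda>\<omega>. ((X t \<omega> - X 0 \<omega>) / scale t) ^ k)"
    by (rule M.stein_expansion_tendsto_0(2)[where w="\<lambda>_. 0" and b=1 and R=0])
       (use exp_int scale_pos_t X_law in auto)
  then have "integrable M (\<lambda>\<omega>. scale t ^ k * ((X t \<omega> - X 0 \<omega>) / scale t) ^ k)" by simp
  then show ?thesis using scale_pos_t by (simp add: power_divide)
qed

lemma X0_integrable: "integrable M (X 0)"
proof -
  have "integrable (distr M borel (X 0)) (\<lambda>x. x)" using first_moment by (simp add: X_law)
  then show ?thesis by (subst (asm) integrable_distr_eq) auto
qed

text \<open>Up to the terms of \<open>X\<^sub>0 - Z / a\<close>, which affect only the indices zero and one, the summands are \<open>a / s\<close> times those of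
\<open>stein_expansion_tendsto_0\<close>, and their sum vanishes in the limit.\<close>

lemma expectation_coeff_tendsto:
  assumes cont: "continuous_on UNIV w" and supp: "\<And>x. R \<le> \<bar>x\<bar> \<Longrightarrow> w x = 0"
  defines "W \<equiv> hermite_coeff w (exp (- t)) (scale t)"
  shows "(\<lambda>n. \<integral>\<omega>. (\<Sum>k<n. coeff k \<omega> * W k (X 0 \<omega>)) \<partial>M) \<longlonglongrightarrow> (\<integral>x. w x * r t x \<partial>lborel)"
    and "integrable M (\<lambda>\<omega>. \<Sum>k<n. coeff k \<omega> * W k (X 0 \<omega>))"
proof -
  define D where "D \<omega> = X t \<omega> - X 0 \<omega>" for \<omega>
  have [measurable]: "w \<in> borel_measurable borel" by (rule borel_measurable_continuous_onI[OF cont])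
  obtain C where C: "\<And>x. \<bar>w x\<bar> \<le> C" using compact_support_bounded[OF cont supp] by metis
  have [measurable]: "W k \<in> borel_measurable borel" for k unfolding W_def by measurable
  note Wb = hermite_coeff_bound[OF \<open>w \<in> borel_measurable borel\<close> C, of "exp (- t)" "scale t", folded W_def]
  have Dp: "integrable M (\<lambda>\<omega>. D \<omega> ^ k)" for k using increment_power_integrable by (simp add: D_def)
  have D1: "integrable M D" using Dp[of 1] by simp
  have ce: "integrable M (\<lambda>\<omega>. cond_exp_given M (X 0) Y \<omega> * W k (X 0 \<omega>))"
    "(\<integral>\<omega>. cond_exp_given M (X 0) Y \<omega> * W k (X 0 \<omega>) \<partial>M) = (\<integral>\<omega>. Y \<omega> * W k (X 0 \<omega>) \<partial>M)"
    "integrable M (\<lambda>\<omega>. Y \<omega> * W k (X 0 \<omega>))" if Y: "integrable M Y" for Y k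
    by (rule M.cond_exp_given_integral[OF X_meas(1) Y _ Wb], measurable)+
  define E where "E k = (\<integral>\<omega>. D \<omega> ^ Suc k / (s * fact (Suc k) * a ^ k) * W k (X 0 \<omega>) \<partial>M)" for k
  have i_gen: "integrable M (\<lambda>\<omega>. coeff k \<omega> * W k (X 0 \<omega>))"
   and e0: "(\<integral>\<omega>. coeff 0 \<omega> * W 0 (X 0 \<omega>) \<partial>M) = E 0 + (\<integral>\<omega>. X 0 \<omega> * W 0 (X 0 \<omega>) \<partial>M)"
   and e1: "(\<integral>\<omega>. coeff (Suc 0) \<omega> * W (Suc 0) (X 0 \<omega>) \<partial>M) = E (Suc 0) - (\<integral>\<omega>. W (Suc 0) (X 0 \<omega>) \<partial>M) / a"
   and ek: "2 \<le> k \<Longrightarrow> (\<integral>\<omega>. coeff k \<omega> * W k (X 0 \<omega>) \<partial>M) = E k"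
   and iX: "integrable M (\<lambda>\<omega>. X 0 \<omega> * W 0 (X 0 \<omega>))"
   and i1: "integrable M (\<lambda>\<omega>. W (Suc 0) (X 0 \<omega>))" for k
  proof -
    have Y0: "integrable M (\<lambda>\<omega>. D \<omega> / s + X 0 \<omega>)" using D1 X0_integrable by simp
    have Y1: "integrable M (\<lambda>\<omega>. (D \<omega>)\<^sup>2 / (2 * s) - 1)" using Dp[of 2] by simp
    note c0 = ce[OF Y0, of 0, simplified] and c1 = ce[OF Y1, of "Suc 0", simplified]
    note ck = ce[OF Dp[of "Suc k"], of k]
    show iX: "integrable M (\<lambda>\<omega>. X 0 \<omega> * W 0 (X 0 \<omega>))"
      using ce(3)[OF X0_integrable, of 0] by simp
    have iD: "integrable M (\<lambda>\<omega>. D \<omega> * W 0 (X 0 \<omega>))" using ce(3)[OF D1, of 0] by simp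
    show i1: "integrable M (\<lambda>\<omega>. W (Suc 0) (X 0 \<omega>))"
      using ce(3)[of "\<lambda>_. 1" "Suc 0"] by simp
    have iD2: "integrable M (\<lambda>\<omega>. (D \<omega>)\<^sup>2 * W (Suc 0) (X 0 \<omega>))" using ce(3)[OF Dp[of 2], of "Suc 0"] by simp
    show "integrable M (\<lambda>\<omega>. coeff k \<omega> * W k (X 0 \<omega>))"
    proof -
      consider "k = 0" | "k = Suc 0" | "2 \<le> k" by linarith
      then show ?thesis
      proof cases
        case 1 then show ?thesis using c0(1) by (simp add: coeff_def D_def)
      next
        case 2 then show ?thesis using c1(1) by (simp add: coeff_def D_def)
      next
        case 3
        then have "integrable M (\<lambda>\<omega>. (cond_exp_given M (X 0) (\<lambda>w. D w ^ Suc k) \<omega> * W k (X 0 \<omega>)) / (s * fact (Suc k) * a ^ k))"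
          using ck(1) by (intro integrable_divide) simp
        then show ?thesis using 3 by (simp add: coeff_def D_def del: power_Suc fact_Suc)
      qed
    qed
    have "(\<integral>\<omega>. coeff 0 \<omega> * W 0 (X 0 \<omega>) \<partial>M) = (\<integral>\<omega>. (D \<omega> / s + X 0 \<omega>) * W 0 (X 0 \<omega>) \<partial>M)"
      using c0(2) by (simp add: coeff_def D_def)
    also have "\<dots> = (\<integral>\<omega>. D \<omega> * W 0 (X 0 \<omega>) / s + X 0 \<omega> * W 0 (X 0 \<omega>) \<partial>M)"
      by (simp add: distrib_right)
    also have "\<dots> = E 0 + (\<integral>\<omega>. X 0 \<omega> * W 0 (X 0 \<omega>) \<partial>M)"
      using iD iX by (simp add: E_def)
    finally show "(\<integral>\<omega>. coeff 0 \<omega> * W 0 (X 0 \<omega>) \<partial>M) = E 0 + (\<integral>\<omega>. X 0 \<omega> * W 0 (X 0 \<omega>) \<partial>M)" .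
    have "(\<integral>\<omega>. coeff (Suc 0) \<omega> * W (Suc 0) (X 0 \<omega>) \<partial>M) = (\<integral>\<omega>. ((D \<omega>)\<^sup>2 / (2 * s) - 1) * W (Suc 0) (X 0 \<omega>) \<partial>M) / a"
      using c1(2) by (simp add: coeff_def D_def)
    also have "(\<integral>\<omega>. ((D \<omega>)\<^sup>2 / (2 * s) - 1) * W (Suc 0) (X 0 \<omega>) \<partial>M) =
       (\<integral>\<omega>. (D \<omega>)\<^sup>2 * W (Suc 0) (X 0 \<omega>) / (2 * s) - W (Suc 0) (X 0 \<omega>) \<partial>M)"
      by (simp add: left_diff_distrib)
    also have "\<dots> = (\<integral>\<omega>. (D \<omega>)\<^sup>2 * W (Suc 0) (X 0 \<omega>) \<partial>M) / (2 * s) - (\<integral>\<omega>. W (Suc 0) (X 0 \<omega>) \<partial>M)"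
      using iD2 i1 by simp
    also have "\<dots> / a = E (Suc 0) - (\<integral>\<omega>. W (Suc 0) (X 0 \<omega>) \<partial>M) / a"
      by (simp add: E_def diff_divide_distrib power2_eq_square ac_simps)
    finally show "(\<integral>\<omega>. coeff (Suc 0) \<omega> * W (Suc 0) (X 0 \<omega>) \<partial>M) = E (Suc 0) - (\<integral>\<omega>. W (Suc 0) (X 0 \<omega>) \<partial>M) / a" .
    show "(\<integral>\<omega>. coeff k \<omega> * W k (X 0 \<omega>) \<partial>M) = E k" if "2 \<le> k"
    proof -
      have "(\<integral>\<omega>. coeff k \<omega> * W k (X 0 \<omega>) \<partial>M) =
        (\<integral>\<omega>. (cond_exp_given M (X 0) (\<lambda>w. D w ^ Suc k) \<omega> * W k (X 0 \<omega>)) / (s * fact (Suc k) * a ^ k) \<partial>M)"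
        using that by (intro Bochner_Integration.integral_cong) (auto simp: coeff_def D_def)
      also have "\<dots> = (\<integral>\<omega>. D \<omega> ^ Suc k * W k (X 0 \<omega>) \<partial>M) / (s * fact (Suc k) * a ^ k)"
        using ck(2) by (simp del: power_Suc fact_Suc)
      also have "\<dots> = E k" unfolding E_def by (simp del: power_Suc fact_Suc)
      finally show ?thesis .
    qed
  qed
  show si: "integrable M (\<lambda>\<omega>. \<Sum>k<n. coeff k \<omega> * W k (X 0 \<omega>))" for n
    by (intro Bochner_Integration.integrable_sum i_gen)
  \<comment> \<open>The contribution of \<open>X\<^sub>0 - Z / a\<close>.\<close>
  define L where "L = (\<integral>\<omega>. X 0 \<omega> * W 0 (X 0 \<omega>) \<partial>M) - (\<integral>\<omega>. W (Suc 0) (X 0 \<omega>) \<partial>M) / a"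
  have sumE: "(\<integral>\<omega>. (\<Sum>k<n. coeff k \<omega> * W k (X 0 \<omega>)) \<partial>M) = (\<Sum>k<n. E k) + L" if "2 \<le> n" for n
  proof -
    have split: "(\<Sum>k<n. f k) = f 0 + f (Suc 0) + (\<Sum>k\<in>{2..<n}. f k)" for f :: "nat \<Rightarrow> real"
    proof -
      have "{..<n} = {0, Suc 0} \<union> {2..<n}" using that by (auto simp: numeral_2_eq_2 not_less_eq_eq less_Suc_eq)
      then show ?thesis by (simp add: sum.union_disjoint)
    qed
    have "(\<integral>\<omega>. (\<Sum>k<n. coeff k \<omega> * W k (X 0 \<omega>)) \<partial>M) = (\<Sum>k<n. \<integral>\<omega>. coeff k \<omega> * W k (X 0 \<omega>) \<partial>M)"
      by (intro Bochner_Integration.integral_sum i_gen)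
    also have "\<dots> = (\<Sum>k<n. E k) + L"
      unfolding split by (simp add: e0 e1 ek L_def)
    finally show ?thesis .
  qed
  have E_alt: "E k = a / s * (\<integral>\<omega>. ((X t \<omega> - X 0 \<omega>) / a) ^ Suc k / fact (Suc k) * W k (X 0 \<omega>) \<partial>M)" for k
  proof -
    have "D \<omega> ^ Suc k / (s * fact (Suc k) * a ^ k) * W k (X 0 \<omega>) =
       a / s * (((X t \<omega> - X 0 \<omega>) / a) ^ Suc k / fact (Suc k) * W k (X 0 \<omega>))" for \<omega>
      using scale_pos_t s by (simp add: D_def power_divide field_simps del: fact_Suc)
    then show ?thesis unfolding E_def by (simp del: power_Suc fact_Suc)
  qed
  have "(\<lambda>n. \<Sum>k<n. \<integral>\<omega>. ((X t \<omega> - X 0 \<omega>) / a) ^ Suc k / fact (Suc k) * W k (X 0 \<omega>) \<partial>M) \<longlonglongrightarrow> 0"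
    unfolding W_def
    by (rule M.stein_expansion_tendsto_0(1)[OF X_meas _ scale_pos_t _ cont supp exp_int]) (auto simp: X_law)
  then have "(\<lambda>n. a / s * (\<Sum>k<n. \<integral>\<omega>. ((X t \<omega> - X 0 \<omega>) / a) ^ Suc k / fact (Suc k) * W k (X 0 \<omega>) \<partial>M) + L) \<longlonglongrightarrow> a / s * 0 + L"
    by (intro tendsto_intros)
  then have "(\<lambda>n. (\<Sum>k<n. E k) + L) \<longlonglongrightarrow> L"
    by (simp add: E_alt sum_distrib_left del: power_Suc fact_Suc)
  then have lim: "(\<lambda>n. \<integral>\<omega>. (\<Sum>k<n. coeff k \<omega> * W k (X 0 \<omega>)) \<partial>M) \<longlonglongrightarrow> L"
    by (rule Lim_transform_eventually) (use sumE in \<open>auto intro!: eventually_sequentiallyI[of 2]\<close>)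
  have "L = (\<integral>\<omega>. X 0 \<omega> * W 0 (X 0 \<omega>) - W (Suc 0) (X 0 \<omega>) / a \<partial>M)"
    using iX i1 by (simp add: L_def)
  also have "\<dots> = (\<integral>\<xi>. \<xi> * W 0 \<xi> - W (Suc 0) \<xi> / a \<partial>distr M borel (X 0))"
    by (subst integral_distr) auto
  also have "\<dots> = (\<integral>\<xi>. (\<integral>z. w (ou t (\<xi>, z)) * (\<xi> - z / a) \<partial>std_gaussian) \<partial>\<nu>)"
    unfolding X_law
  proof (rule Bochner_Integration.integral_cong[OF refl])
    fix \<xi>
    have e: "expgrowth (\<lambda>z. w (exp (- t) * (\<xi> + a * z)))" by (rule expgrowth_bounded[of _ C]) (use C in auto)
    have ii: "integrable std_gaussian (\<lambda>z. w (exp (- t) * (\<xi> + a * z)))"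
      "integrable std_gaussian (\<lambda>z. w (exp (- t) * (\<xi> + a * z)) * z)"
      using e by (intro expgrowth_integrable expgrowth_mult expgrowth_ident; simp)+
    have "(\<integral>z. w (ou t (\<xi>, z)) * (\<xi> - z / a) \<partial>std_gaussian) =
       (\<integral>z. \<xi> * w (exp (- t) * (\<xi> + a * z)) - (w (exp (- t) * (\<xi> + a * z)) * z) / a \<partial>std_gaussian)"
      by (simp add: ou_def right_diff_distrib left_diff_distrib ac_simps)
    also have "\<dots> = \<xi> * W 0 \<xi> - W (Suc 0) \<xi> / a"
      using ii by (simp add: W_def hermite_coeff_def)
    finally show "\<xi> * W 0 \<xi> - W (Suc 0) \<xi> / a = (\<integral>z. w (ou t (\<xi>, z)) * (\<xi> - z / a) \<partial>std_gaussian)" by simp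
  qed
  also have "\<dots> = (\<integral>x. w x * r t x \<partial>lborel)"
    by (rule integral_ou_compact(2)[OF cont supp t])
  finally show "(\<lambda>n. \<integral>\<omega>. (\<Sum>k<n. coeff k \<omega> * W k (X 0 \<omega>)) \<partial>M) \<longlonglongrightarrow> (\<integral>x. w x * r t x \<partial>lborel)"
    using lim by simp
qed

text \<open>The conditional Jensen inequality in the form that is needed, with \<open>\<psi>\<close> a lower bound of \<open>\<bar>y\<bar> powr p\<close> that has
continuous slopes \<open>\<kappa>\<close>.  Writing \<open>u (F\<^sub>t)\<close> for the conditional expectation of \<open>X\<^sub>0 - Z / a\<close> given \<open>F\<^sub>t\<close>, the tangent
inequality is integrated at the point \<open>c = \<theta> * u\<close> with the partial Hermite sum as \<open>y\<close>.  The cutoff \<open>\<theta>\<close> makes the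
slope at \<open>c (F\<^sub>t)\<close> a test function with compact support, so \<open>expectation_coeff_tendsto\<close> identifies the limit of the linear
term, and the sign of \<open>\<kappa>\<close> shows that the difference between \<open>u\<close> and \<open>c\<close> can only help.\<close>

lemma convex_functional_bound:
  fixes \<psi> \<kappa> :: "real \<Rightarrow> real" and c :: "real \<Rightarrow> real"
  assumes tangent: "\<And>x y. \<psi> x + \<kappa> x * (y - x) \<le> \<bar>y\<bar> powr p"
    and \<psi>: "continuous_on UNIV \<psi>" "\<psi> 0 = 0" and \<kappa>: "continuous_on UNIV \<kappa>" "\<kappa> 0 = 0"
      "\<And>x. 0 \<le> \<kappa> x * x"
    and \<theta>: "continuous_on UNIV \<theta>" "\<And>x. 0 \<le> \<theta> x" "\<And>x. \<theta> x \<le> 1" "\<And>x. R \<le> \<bar>x\<bar> \<Longrightarrow> \<theta> x = 0"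
  shows "ennreal (\<integral>\<omega>. \<psi> (\<theta> (ou t \<omega>) * (r t (ou t \<omega>) / q t (ou t \<omega>))) \<partial>joint) \<le>
    (\<integral>\<^sup>+\<omega>. ennreal_powr (S_series M X s p t \<omega>) (p / 2) \<partial>M)"
proof -
  define u where "u x = r t x / q t x" for x
  define c where "c x = \<theta> x * u x" for x
  define w where "w x = \<kappa> (c x)" for x
  define A where "A x = \<psi> (c x) - \<kappa> (c x) * c x" for x
  have uc: "continuous_on UNIV u"
    unfolding u_def using q_pos[OF t]
    by (intro continuous_at_imp_continuous_on ballI continuous_at_sequentiallyI tendsto_divide qr_tendsto t)
      (auto simp: less_le)
  have cc: "continuous_on UNIV c" unfolding c_def by (intro continuous_intros \<theta> uc)
  have c0: "c x = 0" if "R \<le> \<bar>x\<bar>" for x using \<theta>(4)[OF that] by (simp add: c_def)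
  have wc: "continuous_on UNIV w" unfolding w_def by (rule continuous_on_compose2[OF \<kappa>(1) cc]) auto
  have w0: "w x = 0" if "R \<le> \<bar>x\<bar>" for x using c0[OF that] \<kappa> by (simp add: w_def)
  have pc: "continuous_on UNIV (\<lambda>x. \<psi> (c x))" by (rule continuous_on_compose2[OF \<psi>(1) cc]) auto
  have Ac: "continuous_on UNIV A" unfolding A_def by (intro continuous_intros pc cc continuous_on_compose2[OF \<kappa>(1) cc]) auto
  have A0: "A x = 0" if "R \<le> \<bar>x\<bar>" for x using c0[OF that] \<psi> by (simp add: A_def)
  have bc: "continuous_on UNIV (\<lambda>x. w x * (u x - c x))" by (intro continuous_intros wc uc cc)
  have [measurable]: "A \<in> borel_measurable borel" "w \<in> borel_measurable borel"
    using Ac wc by (auto intro: borel_measurable_continuous_onI)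
  obtain CA where CA: "\<And>x. \<bar>A x\<bar> \<le> CA" using compact_support_bounded[OF Ac A0] by metis
  obtain Cw where Cw: "\<And>x. \<bar>w x\<bar> \<le> Cw" using compact_support_bounded[OF wc w0] by metis
  let ?W = "hermite_coeff w (exp (- t)) (scale t)"
  define B where "B = (\<integral>\<^sup>+\<omega>. ennreal_powr (S_series M X s p t \<omega>) (p / 2) \<partial>M)"
  define \<alpha> where "\<alpha> \<xi> = (\<integral>z. A (ou t (\<xi>, z)) \<partial>std_gaussian)" for \<xi>
  have [measurable]: "\<alpha> \<in> borel_measurable borel" unfolding \<alpha>_def ou_def by measurable
  have \<alpha>b: "\<bar>\<alpha> \<xi>\<bar> \<le> CA" for \<xi>
    unfolding \<alpha>_def by (rule gaussian_integral_abs_le) (use CA in \<open>auto simp: ou_def\<close>)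
  have \<alpha>i: "integrable M (\<lambda>\<omega>. \<alpha> (X 0 \<omega>))"
    by (rule M.integrable_const_bound[where B=CA]) (use \<alpha>b in auto)
  have si: "integrable M (\<lambda>\<omega>. \<Sum>k<n. coeff k \<omega> * ?W k (X 0 \<omega>))" for n
    by (rule expectation_coeff_tendsto(2)[OF wc]) (rule w0)
  have pointwise: "ennreal (\<alpha> (X 0 \<omega>) + (\<Sum>k<n. coeff k \<omega> * ?W k (X 0 \<omega>))) \<le> ennreal_powr (S_series M X s p t \<omega>) (p / 2)"
    if n: "2 \<le> n" for n \<omega>
  proof -
    define \<xi> where "\<xi> = X 0 \<omega>"
    define G where "G z = (\<Sum>k<n. coeff k \<omega> * hermite k z)" for z
    have eG: "expgrowth G" unfolding G_def by (rule expgrowth_hermite_sum)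
    have eA: "expgrowth (\<lambda>z. A (ou t (\<xi>, z)))" by (rule expgrowth_bounded[of _ CA]) (use CA in \<open>auto simp: ou_def\<close>)
    have ew: "expgrowth (\<lambda>z. w (ou t (\<xi>, z)))" by (rule expgrowth_bounded[of _ Cw]) (use Cw in \<open>auto simp: ou_def\<close>)
    have "(\<integral>z. w (ou t (\<xi>, z)) * G z \<partial>std_gaussian) = (\<Sum>k<n. coeff k \<omega> * ?W k \<xi>)"
      unfolding G_def integral_mult_hermite_sum[OF ew] by (simp add: hermite_coeff_def ou_def)
    then have "\<alpha> \<xi> + (\<Sum>k<n. coeff k \<omega> * ?W k \<xi>) = (\<integral>z. A (ou t (\<xi>, z)) + w (ou t (\<xi>, z)) * G z \<partial>std_gaussian)"
      using expgrowth_integrable[OF eA] expgrowth_integrable[OF expgrowth_mult[OF ew eG]] by (simp add: \<alpha>_def)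
    also have "\<dots> \<le> (\<integral>z. \<bar>G z\<bar> powr p \<partial>std_gaussian)"
    proof (rule integral_mono)
      show "A (ou t (\<xi>, z)) + w (ou t (\<xi>, z)) * G z \<le> \<bar>G z\<bar> powr p" for z
        using tangent[of "c (ou t (\<xi>, z))" "G z"] by (simp add: A_def w_def algebra_simps)
      show "integrable std_gaussian (\<lambda>z. A (ou t (\<xi>, z)) + w (ou t (\<xi>, z)) * G z)"
        by (intro expgrowth_integrable expgrowth_add eA expgrowth_mult ew eG)
      show "integrable std_gaussian (\<lambda>z. \<bar>G z\<bar> powr p)"
        using p by (intro expgrowth_integrable expgrowth_abs_powr eG) auto
    qed
    also have "\<dots> \<le> (\<Sum>k<n. max 1 (p - 1) ^ k * (coeff k \<omega>)\<^sup>2 * fact k) powr (p / 2)"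
      unfolding G_def by (rule hypercontractivity[OF p])
    finally have "ennreal (\<alpha> \<xi> + (\<Sum>k<n. coeff k \<omega> * ?W k \<xi>)) \<le>
       ennreal ((\<Sum>k<n. max 1 (p - 1) ^ k * (coeff k \<omega>)\<^sup>2 * fact k) powr (p / 2))"
      by (rule ennreal_leI)
    also have "\<dots> = ennreal_powr (ennreal (\<Sum>k<n. max 1 (p - 1) ^ k * (coeff k \<omega>)\<^sup>2 * fact k)) (p / 2)"
      by (intro ennreal_powr_ennreal[symmetric] sum_nonneg) auto
    also have "\<dots> \<le> ennreal_powr (S_series M X s p t \<omega>) (p / 2)"
      using p by (intro ennreal_powr_mono S_series_ge[OF t n s]) (auto simp: coeff_def)
    finally show ?thesis by (simp add: \<xi>_def)
  qed
  have le: "ennreal ((\<integral>\<omega>. \<alpha> (X 0 \<omega>) \<partial>M) + (\<integral>\<omega>. (\<Sum>k<n. coeff k \<omega> * ?W k (X 0 \<omega>)) \<partial>M)) \<le> B" if n: "2 \<le> n" for n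
  proof -
    have int: "integrable M (\<lambda>\<omega>. \<alpha> (X 0 \<omega>) + (\<Sum>k<n. coeff k \<omega> * ?W k (X 0 \<omega>)))"
      by (intro Bochner_Integration.integrable_add \<alpha>i si)
    have "ennreal ((\<integral>\<omega>. \<alpha> (X 0 \<omega>) \<partial>M) + (\<integral>\<omega>. (\<Sum>k<n. coeff k \<omega> * ?W k (X 0 \<omega>)) \<partial>M)) =
        ennreal (\<integral>\<omega>. \<alpha> (X 0 \<omega>) + (\<Sum>k<n. coeff k \<omega> * ?W k (X 0 \<omega>)) \<partial>M)"
      using \<alpha>i si[of n] by simp
    also have "\<dots> \<le> ennreal (\<integral>\<omega>. max 0 (\<alpha> (X 0 \<omega>) + (\<Sum>k<n. coeff k \<omega> * ?W k (X 0 \<omega>))) \<partial>M)"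
      using int by (intro ennreal_leI integral_mono) auto
    also have "\<dots> = (\<integral>\<^sup>+\<omega>. ennreal (max 0 (\<alpha> (X 0 \<omega>) + (\<Sum>k<n. coeff k \<omega> * ?W k (X 0 \<omega>)))) \<partial>M)"
      using int by (intro nn_integral_eq_integral[symmetric]) auto
    also have "\<dots> \<le> B"
      unfolding B_def using pointwise[OF n] by (intro nn_integral_mono) simp
    finally show ?thesis .
  qed
  have "(\<lambda>n. ennreal ((\<integral>\<omega>. \<alpha> (X 0 \<omega>) \<partial>M) + (\<integral>\<omega>. (\<Sum>k<n. coeff k \<omega> * ?W k (X 0 \<omega>)) \<partial>M))) \<longlonglongrightarrow>
      ennreal ((\<integral>\<omega>. \<alpha> (X 0 \<omega>) \<partial>M) + (\<integral>x. w x * r t x \<partial>lborel))"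
    by (intro tendsto_ennrealI tendsto_add tendsto_const expectation_coeff_tendsto(1)[OF wc w0])
  then have lim: "ennreal ((\<integral>\<omega>. \<alpha> (X 0 \<omega>) \<partial>M) + (\<integral>x. w x * r t x \<partial>lborel)) \<le> B"
    by (rule LIMSEQ_le_const2) (use le in auto)
  have cov: "(\<integral>x. g x * q t x \<partial>lborel) = (\<integral>\<omega>. g (ou t \<omega>) \<partial>joint)" "integrable joint (\<lambda>\<omega>. g (ou t \<omega>))"
    if g: "continuous_on UNIV g" "\<And>x. R \<le> \<bar>x\<bar> \<Longrightarrow> g x = 0" for g
  proof -
    obtain C where C: "\<And>x. \<bar>g x\<bar> \<le> C" using compact_support_bounded[OF g] by metis
    have "g \<in> borel_measurable borel" by (rule borel_measurable_continuous_onI[OF g(1)])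
    from integral_joint_bounded[OF this C]
    show "(\<integral>x. g x * q t x \<partial>lborel) = (\<integral>\<omega>. g (ou t \<omega>) \<partial>joint)" "integrable joint (\<lambda>\<omega>. g (ou t \<omega>))"
      using integral_ou_compact(1)[OF g t] by auto
  qed
  have "(\<integral>\<omega>. \<alpha> (X 0 \<omega>) \<partial>M) = (\<integral>\<xi>. \<alpha> \<xi> \<partial>distr M borel (X 0))" by (subst integral_distr) auto
  also have "\<dots> = (\<integral>\<omega>. A (ou t \<omega>) \<partial>joint)"
    unfolding X_law \<alpha>_def by (rule integral_joint_bounded(1)[OF _ CA]) simp
  finally have EA: "(\<integral>\<omega>. \<alpha> (X 0 \<omega>) \<partial>M) = (\<integral>\<omega>. A (ou t \<omega>) \<partial>joint)" .
  have wuc: "continuous_on UNIV (\<lambda>x. w x * u x)" by (intro continuous_intros wc uc)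
  have "(\<integral>x. w x * r t x \<partial>lborel) = (\<integral>x. (w x * u x) * q t x \<partial>lborel)"
  proof (rule Bochner_Integration.integral_cong[OF refl])
    show "w x * r t x = w x * u x * q t x" for x using q_pos[OF t, of x] by (simp add: u_def)
  qed
  also have "\<dots> = (\<integral>\<omega>. w (ou t \<omega>) * u (ou t \<omega>) \<partial>joint)" by (rule cov(1)[OF wuc]) (simp add: w0)
  finally have Ew: "(\<integral>x. w x * r t x \<partial>lborel) = (\<integral>\<omega>. w (ou t \<omega>) * u (ou t \<omega>) \<partial>joint)" .
  have "(\<integral>\<omega>. \<psi> (c (ou t \<omega>)) \<partial>joint) \<le> (\<integral>\<omega>. A (ou t \<omega>) + w (ou t \<omega>) * u (ou t \<omega>) \<partial>joint)"
  proof (rule integral_mono)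
    show "integrable joint (\<lambda>\<omega>. \<psi> (c (ou t \<omega>)))" by (rule cov(2)[OF pc]) (simp add: c0 \<psi>)
    show "integrable joint (\<lambda>\<omega>. A (ou t \<omega>) + w (ou t \<omega>) * u (ou t \<omega>))"
      by (intro Bochner_Integration.integrable_add cov(2)[OF Ac A0] cov(2)[OF wuc]) (simp_all add: w0)
    show "\<psi> (c (ou t \<omega>)) \<le> A (ou t \<omega>) + w (ou t \<omega>) * u (ou t \<omega>)" for \<omega>
    proof -
      let ?x = "ou t \<omega>"
      have "0 \<le> \<kappa> (c ?x) * (u ?x - c ?x)"
      proof (cases "\<theta> ?x = 0")
        case True then show ?thesis using \<kappa> by (simp add: c_def)
      next
        case False
        then have th: "0 < \<theta> ?x" using \<theta>(2)[of ?x] by simp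
        have "\<kappa> (c ?x) * (u ?x - c ?x) = (\<kappa> (c ?x) * c ?x) * ((1 - \<theta> ?x) / \<theta> ?x)"
          using th by (simp add: c_def field_simps)
        also have "\<dots> \<ge> 0" using th \<theta>(3)[of ?x] by (intro mult_nonneg_nonneg[OF \<kappa>(3)]) simp
        finally show ?thesis .
      qed
      then show ?thesis by (simp add: A_def w_def algebra_simps)
    qed
  qed
  also have "\<dots> = (\<integral>\<omega>. A (ou t \<omega>) \<partial>joint) + (\<integral>\<omega>. w (ou t \<omega>) * u (ou t \<omega>) \<partial>joint)"
    by (intro Bochner_Integration.integral_add cov(2)[OF Ac A0] cov(2)[OF wuc]) (simp_all add: w0)
  finally have "ennreal (\<integral>\<omega>. \<psi> (c (ou t \<omega>)) \<partial>joint) \<le> ennreal ((\<integral>\<omega>. \<alpha> (X 0 \<omega>) \<partial>M) + (\<integral>x. w x * r t x \<partial>lborel))"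
    unfolding EA Ew by (rule ennreal_leI)
  also note lim
  finally show ?thesis by (simp add: B_def c_def u_def)
qed

text \<open>Fatou's lemma.\<close>

lemma nn_integral_le_of_approx:
  fixes g :: "nat \<Rightarrow> real \<Rightarrow> real"
  assumes cont: "\<And>n. continuous_on UNIV (g n)" and nn: "\<And>n x. 0 \<le> g n x"
    and supp: "\<And>n x. real n + 1 \<le> \<bar>x\<bar> \<Longrightarrow> g n x = 0"
    and lim: "\<And>x. (\<lambda>n. g n x) \<longlonglongrightarrow> G x"
    and le: "\<And>n. ennreal (\<integral>\<omega>. g n (ou t \<omega>) \<partial>joint) \<le> B"
  shows "(\<integral>\<^sup>+\<omega>. ennreal (G (ou t \<omega>)) \<partial>joint) \<le> B"
proof -
  have [measurable]: "g n \<in> borel_measurable borel" for n by (rule borel_measurable_continuous_onI[OF cont])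
  have "(\<integral>\<^sup>+\<omega>. ennreal (g n (ou t \<omega>)) \<partial>joint) \<le> B" for n
  proof -
    obtain C where C: "\<And>x. \<bar>g n x\<bar> \<le> C" using compact_support_bounded[OF cont supp] by metis
    have "integrable joint (\<lambda>\<omega>. g n (ou t \<omega>))" by (rule integral_joint_bounded(2)[OF _ C]) simp
    then have "(\<integral>\<^sup>+\<omega>. ennreal (g n (ou t \<omega>)) \<partial>joint) = ennreal (\<integral>\<omega>. g n (ou t \<omega>) \<partial>joint)"
      using nn by (intro nn_integral_eq_integral) auto
    then show ?thesis using le by simp
  qed
  then have "liminf (\<lambda>n. \<integral>\<^sup>+\<omega>. ennreal (g n (ou t \<omega>)) \<partial>joint) \<le> B"
    by (intro Liminf_le) (auto intro: always_eventually)
  moreover have "(\<integral>\<^sup>+\<omega>. liminf (\<lambda>n. ennreal (g n (ou t \<omega>))) \<partial>joint) \<le> liminf (\<lambda>n. \<integral>\<^sup>+\<omega>. ennreal (g n (ou t \<omega>)) \<partial>joint)"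
    by (rule nn_integral_liminf) measurable
  moreover have "liminf (\<lambda>n. ennreal (g n x)) = ennreal (G x)" for x
    by (rule lim_imp_Liminf) (auto intro!: tendsto_ennrealI lim)
  ultimately show ?thesis by simp
qed

text \<open>For \<open>p > 1\<close> the power itself has continuous slopes.  For \<open>p = 1\<close> the sign function is replaced by the
continuous approximations \<open>K m\<close>, which are slopes of lower bounds of the absolute value.\<close>

lemma velocity_bound:
  "(\<integral>\<^sup>+\<omega>. ennreal (\<bar>r t (ou t \<omega>) / q t (ou t \<omega>)\<bar> powr p) \<partial>joint) \<le>
    (\<integral>\<^sup>+\<omega>. ennreal_powr (S_series M X s p t \<omega>) (p / 2) \<partial>M)"
proof -
  define u where "u x = r t x / q t x" for x
  have uc: "continuous_on UNIV u"
    unfolding u_def using q_pos[OF t]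
    by (intro continuous_at_imp_continuous_on ballI continuous_at_sequentiallyI tendsto_divide qr_tendsto t)
      (auto simp: less_le)
  have cl: "(\<lambda>n. cutoff n x * u x) \<longlonglongrightarrow> u x" for x
    using tendsto_mult[OF cutoff_tendsto tendsto_const[of "u x"]] by simp
  have cc: "continuous_on UNIV (\<lambda>x. cutoff n x * u x)" for n
    by (intro continuous_intros continuous_cutoff uc)
  note cut = continuous_cutoff cutoff(1) cutoff(2) cutoff(3)
  show ?thesis
  proof (cases "p = 1")
    case False
    with p have p1: "1 < p" by simp
    let ?\<psi> = "\<lambda>x::real. \<bar>x\<bar> powr p"
    have \<psi>c: "continuous_on UNIV ?\<psi>" using p1 by (intro continuous_on_powr' continuous_intros) auto
    have "(\<integral>\<^sup>+\<omega>. ennreal (?\<psi> (u (ou t \<omega>))) \<partial>joint) \<le> (\<integral>\<^sup>+\<omega>. ennreal_powr (S_series M X s p t \<omega>) (p / 2) \<partial>M)"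
    proof (rule nn_integral_le_of_approx[where g="\<lambda>n x. ?\<psi> (cutoff n x * u x)" and G="\<lambda>x. ?\<psi> (u x)"])
      show "continuous_on UNIV (\<lambda>x. ?\<psi> (cutoff n x * u x))" for n
        by (rule continuous_on_compose2[OF \<psi>c cc]) auto
      show "(\<lambda>n. ?\<psi> (cutoff n x * u x)) \<longlonglongrightarrow> ?\<psi> (u x)" for x
        by (rule continuous_on_tendsto_compose[OF \<psi>c cl]) auto
      show "ennreal (\<integral>\<omega>. ?\<psi> (cutoff n (ou t \<omega>) * u (ou t \<omega>)) \<partial>joint) \<le> (\<integral>\<^sup>+\<omega>. ennreal_powr (S_series M X s p t \<omega>) (p / 2) \<partial>M)" for n
        unfolding u_def
      proof (rule convex_functional_bound[where \<kappa>="\<lambda>x. p * (sgn x * \<bar>x\<bar> powr (p - 1))" and \<psi>="?\<psi>"])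
        show "?\<psi> x + p * (sgn x * \<bar>x\<bar> powr (p - 1)) * (y - x) \<le> \<bar>y\<bar> powr p" for x y
          by (rule powr_tangent_le[OF p1])
        show "continuous_on UNIV (\<lambda>x. p * (sgn x * \<bar>x\<bar> powr (p - 1)))"
          using p1 by (intro continuous_intros continuous_sgn_powr) auto
        show "0 \<le> p * (sgn x * \<bar>x\<bar> powr (p - 1)) * x" for x
          using p1 by (auto simp: sgn_if mult_nonneg_nonneg mult_nonpos_nonpos mult_le_0_iff)
      qed (use \<psi>c cut in auto)
    qed (use p1 cutoff(3) in auto)
    then show ?thesis by (simp add: u_def)
  next
    case True
    define K where "K m x = max (- 1) (min 1 (real m * x))" for m and x :: real
    have Kc: "continuous_on UNIV (K m)" for m unfolding K_def by (intro continuous_intros)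
    have Kn: "0 \<le> K m x * x" for m x
    proof (cases "0 \<le> x")
      case True
      then have "0 \<le> real m * x" by simp
      then have "0 \<le> K m x" by (simp add: K_def le_max_iff_disj)
      then show ?thesis using True by simp
    next
      case False
      then have "real m * x \<le> 0" by (intro mult_nonneg_nonpos) auto
      then have "K m x \<le> 0" by (simp add: K_def min_le_iff_disj)
      then show ?thesis using False by (intro mult_nonpos_nonpos) auto
    qed
    have Kb: "\<bar>K m x\<bar> \<le> 1" for m x by (auto simp: K_def)
    have Kl: "(\<lambda>m. K m (x m) * x m) \<longlonglongrightarrow> \<bar>y\<bar>" if "eventually (\<lambda>m. x m = y) sequentially" for x y
    proof (cases "y = 0")
      case True
      have "eventually (\<lambda>m. K m (x m) * x m = \<bar>y\<bar>) sequentially"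
        using that by eventually_elim (simp add: True)
      then show ?thesis by (rule tendsto_eventually)
    next
      case False
      obtain N where N: "1 / \<bar>y\<bar> \<le> real N" using real_arch_simple by blast
      have "eventually (\<lambda>m. K m (x m) * x m = \<bar>y\<bar>) sequentially"
        using that eventually_ge_at_top[of N]
      proof eventually_elim
        case (elim m)
        have "1 / \<bar>y\<bar> \<le> real m" using N elim by simp
        then have "1 \<le> real m * \<bar>y\<bar>" using False by (simp add: field_simps)
        then have "K m y = sgn y" using False by (auto simp: K_def sgn_if max_def min_def abs_if split: if_splits)
        then show ?case using elim by (simp add: sgn_if)
      qed
      then show ?thesis by (rule tendsto_eventually)
    qed
    have "(\<integral>\<^sup>+\<omega>. ennreal \<bar>u (ou t \<omega>)\<bar> \<partial>joint) \<le> (\<integral>\<^sup>+\<omega>. ennreal_powr (S_series M X s p t \<omega>) (p / 2) \<partial>M)"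
    proof (rule nn_integral_le_of_approx[where g="\<lambda>n x. K n (cutoff n x * u x) * (cutoff n x * u x)" and G="\<lambda>x. \<bar>u x\<bar>"])
      show "continuous_on UNIV (\<lambda>x. K n (cutoff n x * u x) * (cutoff n x * u x))" for n
        by (intro continuous_on_mult cc continuous_on_compose2[OF Kc cc]) auto
      show "(\<lambda>n. K n (cutoff n x * u x) * (cutoff n x * u x)) \<longlonglongrightarrow> \<bar>u x\<bar>" for x
      proof (rule Kl)
        obtain N where N: "\<bar>x\<bar> \<le> real N" using real_arch_simple by blast
        show "eventually (\<lambda>n. cutoff n x * u x = u x) sequentially"
          using eventually_ge_at_top[of N] by eventually_elim (use N in \<open>simp add: cutoff(4)\<close>)
      qed
      show "ennreal (\<integral>\<omega>. K n (cutoff n (ou t \<omega>) * u (ou t \<omega>)) * (cutoff n (ou t \<omega>) * u (ou t \<omega>)) \<partial>joint) \<le> (\<integral>\<^sup>+\<omega>. ennreal_powr (S_series M X s p t \<omega>) (p / 2) \<partial>M)" for n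
        unfolding u_def
      proof (rule convex_functional_bound[where \<kappa>="K n" and \<psi>="\<lambda>x. K n x * x"])
        show "K n x * x + K n x * (y - x) \<le> \<bar>y\<bar> powr p" for x y
        proof -
          have "K n x * y \<le> \<bar>K n x\<bar> * \<bar>y\<bar>" by (simp flip: abs_mult)
          also have "\<dots> \<le> 1 * \<bar>y\<bar>" by (intro mult_right_mono Kb) simp
          finally show ?thesis using True by (simp add: algebra_simps)
        qed
        show "continuous_on UNIV (\<lambda>x. K n x * x)" by (intro continuous_intros Kc)
      qed (use Kc Kn cut in \<open>auto simp: K_def\<close>)
    qed (use Kn cutoff(3) in auto)
    then show ?thesis using True by (simp add: u_def)
  qed
qed

end

theorem theorem7:
  fixes M :: "'a measure" and X :: "real \<Rightarrow> 'a \<Rightarrow> real"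
    and \<nu> :: "real measure" and p s :: real
  assumes p: "p \<ge> 1"
    and nu: "prob_space \<nu>" "sets \<nu> = sets borel"
    and nu_moment: "integrable \<nu> (\<lambda>x. \<bar>x\<bar> powr p)"
    and M: "prob_space M"
    and X_measurable: "\<And>t. t \<ge> 0 \<Longrightarrow> X t \<in> borel_measurable M"
    and X_distr: "\<And>t. t \<ge> 0 \<Longrightarrow> distr M borel (X t) = \<nu>"
    and exp_moment: "\<forall>\<epsilon>>0. \<exists>\<xi>>0. \<exists>C>0. \<forall>t\<in>{\<epsilon>..inverse \<epsilon>}.
      (\<integral>\<^sup>+\<omega>. ennreal (exp (p * (1 + \<xi>) * max 1 (p - 1) * \<bar>X t \<omega> - X 0 \<omega>\<bar>\<^sup>2
                           / (2 * (exp (2 * t) - 1)))) \<partial>M) \<le> ennreal C"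
    and s: "s > 0"
  shows "wasserstein p \<nu> std_gaussian \<le>
    (\<integral>\<^sup>+t\<in>{0<..}. ennreal (exp (- t)) *
       ennreal_powr (\<integral>\<^sup>+\<omega>. ennreal_powr (S_series M X s p t \<omega>) (p / 2) \<partial>M) (1 / p) \<partial>lborel)"
proof -
  interpret N: prob_space \<nu> by fact
  have "borel_measurable \<nu> = (borel_measurable borel :: (real \<Rightarrow> real) set)"
    by (rule measurable_cong_sets[OF nu(2) refl])
  then have id_nu: "(\<lambda>x. x) \<in> borel_measurable \<nu>" by simp
  have first: "integrable \<nu> (\<lambda>x. x)"
  proof (rule Bochner_Integration.integrable_bound)
    show "integrable \<nu> (\<lambda>x. 1 + \<bar>x\<bar> powr p)" using nu_moment by simp
    show "AE x in \<nu>. norm x \<le> norm (1 + \<bar>x\<bar> powr p)"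
    proof (rule AE_I2)
      fix x :: real
      have "\<bar>x\<bar> \<le> 1 + \<bar>x\<bar> powr p"
      proof (cases "\<bar>x\<bar> \<le> 1")
        case False
        then have "\<bar>x\<bar> powr 1 \<le> \<bar>x\<bar> powr p" using p by (intro powr_mono) auto
        then show ?thesis using False by simp
      qed (auto intro: order_trans)
      then show "norm x \<le> norm (1 + \<bar>x\<bar> powr p)" by simp
    qed
  qed (rule id_nu)
  interpret O: ou_flow \<nu>
    by unfold_locales (use nu first in auto)
  have exp_int: "integrable M (\<lambda>\<omega>. exp (((X t \<omega> - X 0 \<omega>) / scale t)\<^sup>2 / 2))" if t: "0 < t" for t
  proof -
    \<comment> \<open>The largest parameter whose interval of times contains \<open>t\<close>.\<close>
    define \<epsilon> where "\<epsilon> = min t (inverse t)"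
    have \<epsilon>: "0 < \<epsilon>" "t \<in> {\<epsilon>..inverse \<epsilon>}"
      using t by (auto simp: \<epsilon>_def min_def inverse_le_iff le_imp_inverse_le)
    from exp_moment[rule_format, OF \<epsilon>(1)] \<epsilon>(2) obtain \<xi> C where \<xi>: "0 < \<xi>"
      and le: "(\<integral>\<^sup>+\<omega>. ennreal (exp (p * (1 + \<xi>) * max 1 (p - 1) * \<bar>X t \<omega> - X 0 \<omega>\<bar>\<^sup>2
                           / (2 * (exp (2 * t) - 1)))) \<partial>M) \<le> ennreal C"
      by blast
    have [measurable]: "X t \<in> borel_measurable M" "X 0 \<in> borel_measurable M"
      using X_measurable t by auto
    have a: "0 < scale t" using t by (rule scale_pos)
    have "1 * 1 * 1 \<le> p * (1 + \<xi>) * max 1 (p - 1)"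
      using p \<xi> by (intro mult_mono) auto
    then have c: "1 \<le> p * (1 + \<xi>) * max 1 (p - 1)" by simp
    have pw: "((X t \<omega> - X 0 \<omega>) / scale t)\<^sup>2 / 2 \<le> p * (1 + \<xi>) * max 1 (p - 1) * \<bar>X t \<omega> - X 0 \<omega>\<bar>\<^sup>2 / (2 * (exp (2 * t) - 1))" for \<omega>
    proof -
      have e: "((X t \<omega> - X 0 \<omega>) / scale t)\<^sup>2 / 2 = \<bar>X t \<omega> - X 0 \<omega>\<bar>\<^sup>2 / (2 * (exp (2 * t) - 1))"
        using scale_square[OF t] by (simp add: power_divide)
      have "0 \<le> ((X t \<omega> - X 0 \<omega>) / scale t)\<^sup>2 / 2" by simp
      from mult_right_mono[OF c this] show ?thesis unfolding e by (simp only: mult_1_left times_divide_eq_right)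
    qed
    show ?thesis
    proof (rule integrableI_bounded)
      have "(\<integral>\<^sup>+\<omega>. ennreal (norm (exp (((X t \<omega> - X 0 \<omega>) / scale t)\<^sup>2 / 2))) \<partial>M) \<le> ennreal C"
        by (rule order_trans[OF nn_integral_mono le]) (use pw in \<open>auto intro!: ennreal_leI\<close>)
      also have "\<dots> < \<infinity>" by simp
      finally show "(\<integral>\<^sup>+\<omega>. ennreal (norm (exp (((X t \<omega> - X 0 \<omega>) / scale t)\<^sup>2 / 2))) \<partial>M) < \<infinity>" .
    qed measurable
  qed
  have vel: "ennreal_powr (\<integral>\<^sup>+\<omega>. ennreal (\<bar>O.velocity t (O.ou t \<omega>)\<bar> powr p) \<partial>O.joint) (1 / p) \<le>
     ennreal (exp (- t)) * ennreal_powr (\<integral>\<^sup>+\<omega>. ennreal_powr (S_series M X s p t \<omega>) (p / 2) \<partial>M) (1 / p)"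
    if t: "0 < t" for t
  proof -
    interpret S: stein_setting \<nu> M X p s t
    proof (intro stein_setting.intro stein_setting_axioms.intro O.ou_flow_axioms)
      show "1 \<le> p" "0 < s" "0 < t" "prob_space M" by (fact p s t M)+
      show "X 0 \<in> borel_measurable M" "X t \<in> borel_measurable M"
        using X_measurable t by (simp_all add: less_imp_le)
      show "distr M borel (X 0) = \<nu>" "distr M borel (X t) = \<nu>"
        using X_distr t by (simp_all add: less_imp_le)
      show "integrable M (\<lambda>\<omega>. exp (((X t \<omega> - X 0 \<omega>) / scale t)\<^sup>2 / 2))" by (rule exp_int[OF t])
    qed
    let ?B = "\<integral>\<^sup>+\<omega>. ennreal_powr (S_series M X s p t \<omega>) (p / 2) \<partial>M"
    have "(\<integral>\<^sup>+\<omega>. ennreal (\<bar>O.velocity t (O.ou t \<omega>)\<bar> powr p) \<partial>O.joint) =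
       (\<integral>\<^sup>+\<omega>. ennreal (exp (- t) powr p) * ennreal (\<bar>O.r t (O.ou t \<omega>) / O.q t (O.ou t \<omega>)\<bar> powr p) \<partial>O.joint)"
    proof (rule nn_integral_cong)
      fix \<omega>
      have "\<bar>O.velocity t x\<bar> = exp (- t) * \<bar>O.r t x / O.q t x\<bar>" for x
        by (simp add: O.velocity_def abs_mult)
      then show "ennreal (\<bar>O.velocity t (O.ou t \<omega>)\<bar> powr p) =
         ennreal (exp (- t) powr p) * ennreal (\<bar>O.r t (O.ou t \<omega>) / O.q t (O.ou t \<omega>)\<bar> powr p)"
        by (simp only: powr_mult) (simp add: ennreal_mult)
    qed
    also have "\<dots> = ennreal (exp (- t) powr p) * (\<integral>\<^sup>+\<omega>. ennreal (\<bar>O.r t (O.ou t \<omega>) / O.q t (O.ou t \<omega>)\<bar> powr p) \<partial>O.joint)"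
      by (rule nn_integral_cmult) measurable
    also have "\<dots> \<le> ennreal (exp (- t) powr p) * ?B"
      by (rule mult_left_mono[OF S.velocity_bound]) simp
    finally have "ennreal_powr (\<integral>\<^sup>+\<omega>. ennreal (\<bar>O.velocity t (O.ou t \<omega>)\<bar> powr p) \<partial>O.joint) (1 / p) \<le>
        ennreal_powr (ennreal (exp (- t) powr p) * ?B) (1 / p)"
      using p by (intro ennreal_powr_mono) auto
    also have "\<dots> = ennreal ((exp (- t) powr p) powr (1 / p)) * ennreal_powr ?B (1 / p)"
      by (rule ennreal_powr_mult_left) simp
    also have "(exp (- t) powr p) powr (1 / p) = exp (- t)" using p by (simp add: powr_powr)
    finally show ?thesis .
  qed
  have "wasserstein p \<nu> std_gaussian \<le>
    (\<integral>\<^sup>+t\<in>{0<..}. ennreal_powr (\<integral>\<^sup>+\<omega>. ennreal (\<bar>O.velocity t (O.ou t \<omega>)\<bar> powr p) \<partial>O.joint) (1 / p) \<partial>lborel)"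
    by (rule O.wasserstein_le_velocity[OF p])
  also have "\<dots> \<le> (\<integral>\<^sup>+t\<in>{0<..}. ennreal (exp (- t)) *
       ennreal_powr (\<integral>\<^sup>+\<omega>. ennreal_powr (S_series M X s p t \<omega>) (p / 2) \<partial>M) (1 / p) \<partial>lborel)"
    using vel by (intro nn_integral_mono) (auto split: split_indicator)
  finally show ?thesis .
qed

end
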